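(* Let $q\in\mathbb{N}\setminus\{1\}$ and let $X$ be the geometric armadillo tail surface with parameter $r=\frac{1}{q}$. Then $X$ admits a cylinder decomposition (in the direction of slope $\frac{1}{2-r}=\frac{q}{2q-1}$) which has a rigid spine. Moreover, there is no parabolic affine diffeomorphism of $X$ that fixes this cylinder decomposition.
   Context: Fix $r\in(0,1)$. Set $l_k=r^{k-1}$ and $s_k=l_1+\dots+l_k$ ($s_0=0$), and for $k\ge 1$ let $\square_k=[s_{k-1},s_k]\times[0,l_k]\subset\mathbb{R}^2$. The geometric armadillo tail with parameter $r$ is obtained from the union $P$ of all squares $\square_k$ (the polygonal representation) by the edge identifications: the top edge of each $\square_k$ is glued to its bottom edge by vertical translation; for each $k\ge1$, the part $\{s_k\}\times[l_{k+1},l_k]$ of the right edge of $\square_k$ not shared with $\square_{k+1}$ is glued by horizontal translation to $\{0\}\times[l_{k+1},l_k]$ on the left edge of $\square_1$. All vertices become a single point, an infinite-degree (wild) singularity; the armadillo tail surface is the complement of this point (a finite-area, infinite-genus translation surface), and the armadillo tail is its metric completion. Slopes/directions are measured in the polygonal representation. A saddle connection is a straight-line segment from the singularity to itself with no singular point in its interior. A cylinder is a closed subset whose interior is foliated by homotopic closed straight-line trajectories (waist curves) and whose boundary consists of saddle connections. A cylinder decomposition is a collection of (possibly infinitely many) cylinders whose waist curves all have the same direction, any two meeting at most along their boundaries, such that the closure of their union is the whole surface. A spine is a line segment contained in the closure of the union but not in any of the cylinders; a rigid spine is a spine consisting of a single saddle connection. An affine diffeomorphism is a diffeomorphism that is affine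 in translation charts; its (constant) derivative $D\phi$ lies in $GL_2(\mathbb{R})$. It is parabolic if $D\phi$ is a non-identity parabolic element of $SL_2(\mathbb{R})$. *)

theory Defs
  imports "HOL-Analysis.Analysis"
begin

definition arm_l :: "real \<Rightarrow> nat \<Rightarrow> real" where
  "arm_l r k = r ^ (k - 1)"

definition arm_s :: "real \<Rightarrow> nat \<Rightarrow> real" where
  "arm_s r k = (\<Sum>i=1..k. arm_l r i)"

definition arm_square :: "real \<Rightarrow> nat \<Rightarrow> (real^2) set" where
  "arm_square r k = cbox (vector [arm_s r (k - 1), 0]) (vector [arm_s r k, arm_l r k])"

definition arm_P :: "real \<Rightarrow> (real^2) set" where
  "arm_P r = (\<Union>k\<in>{1..}. arm_square r k)"

(* the accumulation point of the squares (added by metric completion) *)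
definition arm_Lpt :: "real \<Rightarrow> real^2" where
  "arm_Lpt r = vector [1 / (1 - r), 0]"

definition arm_Pbar :: "real \<Rightarrow> (real^2) set" where
  "arm_Pbar r = arm_P r \<union> {arm_Lpt r}"

definition arm_corners :: "real \<Rightarrow> nat \<Rightarrow> (real^2) set" where
  "arm_corners r k = {vector [arm_s r (k - 1), 0], vector [arm_s r k, 0],
                      vector [arm_s r (k - 1), arm_l r k], vector [arm_s r k, arm_l r k]}"

definition arm_vtx :: "real \<Rightarrow> (real^2) set" where
  "arm_vtx r = (\<Union>k\<in>{1..}. arm_corners r k) \<union> {arm_Lpt r}"

definition arm_glue0 :: "real \<Rightarrow> real^2 \<Rightarrow> real^2 \<Rightarrow> bool" where
  "arm_glue0 r x y \<longleftrightarrow>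
     (x \<in> arm_vtx r \<and> y \<in> arm_vtx r) \<or>
     (\<exists>k\<ge>1. \<exists>t. arm_s r (k - 1) \<le> t \<and> t \<le> arm_s r k \<and>
         x = vector [t, arm_l r k] \<and> y = vector [t, 0]) \<or>
     (\<exists>k\<ge>1. \<exists>u. arm_l r (Suc k) \<le> u \<and> u \<le> arm_l r k \<and>
         x = vector [arm_s r k, u] \<and> y = vector [0, u])"

definition arm_eqv :: "real \<Rightarrow> real^2 \<Rightarrow> real^2 \<Rightarrow> bool" where
  "arm_eqv r = (\<lambda>x y. arm_glue0 r x y \<or> arm_glue0 r y x)\<^sup>*\<^sup>*"

definition arm_cls :: "real \<Rightarrow> real^2 \<Rightarrow> (real^2) set" where
  "arm_cls r x = {y. arm_eqv r x y}"

definition arm_X :: "real \<Rightarrow> (real^2) set set" where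
  "arm_X r = arm_cls r ` arm_Pbar r"

(* the singular point (the class of all vertices) *)
definition arm_sing :: "real \<Rightarrow> (real^2) set" where
  "arm_sing r = arm_cls r 0"

definition arm_Xo :: "real \<Rightarrow> (real^2) set set" where
  "arm_Xo r = arm_X r - {arm_sing r}"

definition surf_open :: "real \<Rightarrow> (real^2) set set \<Rightarrow> bool" where
  "surf_open r U \<longleftrightarrow> U \<subseteq> arm_X r \<and> openin (top_of_set (arm_Pbar r)) (\<Union>U)"

definition surf_closed :: "real \<Rightarrow> (real^2) set set \<Rightarrow> bool" where
  "surf_closed r U \<longleftrightarrow> U \<subseteq> arm_X r \<and> closedin (top_of_set (arm_Pbar r)) (\<Union>U)"

definition surf_closure :: "real \<Rightarrow> (real^2) set set \<Rightarrow> (real^2) set set" where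
  "surf_closure r A = \<Inter>{B. surf_closed r B \<and> A \<subseteq> B}"

definition surf_interior :: "real \<Rightarrow> (real^2) set set \<Rightarrow> (real^2) set set" where
  "surf_interior r A = \<Union>{U. surf_open r U \<and> U \<subseteq> A}"

(* c restricted to [a,b] is a straight-line trajectory with constant velocity w avoiding the
   singularity, given in the polygon by finitely many straight pieces, consecutive pieces
   being glued at their ends *)
definition lchain :: "real \<Rightarrow> (real \<Rightarrow> (real^2) set) \<Rightarrow> real^2 \<Rightarrow> real \<Rightarrow> real \<Rightarrow> bool" where
  "lchain r c w a b \<longleftrightarrow>
     (\<exists>n ts xs. 0 < n \<and> ts 0 = a \<and> ts n = b \<and> (\<forall>i<n. ts i < ts (Suc i)) \<and>
        (\<forall>i<n. \<forall>t\<in>{ts i..ts (Suc i)}.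
            xs i + (t - ts i) *\<^sub>R w \<in> arm_Pbar r - arm_sing r \<and>
            c t = arm_cls r (xs i + (t - ts i) *\<^sub>R w)))"

definition straight_open :: "real \<Rightarrow> (real \<Rightarrow> (real^2) set) \<Rightarrow> real^2 \<Rightarrow> real \<Rightarrow> real \<Rightarrow> bool" where
  "straight_open r c w a b \<longleftrightarrow> (\<forall>a' b'. a < a' \<and> a' < b' \<and> b' < b \<longrightarrow> lchain r c w a' b')"

definition sflow :: "real \<Rightarrow> (real^2) set \<Rightarrow> real^2 \<Rightarrow> (real^2) set \<Rightarrow> bool" where
  "sflow r p w q \<longleftrightarrow> (\<exists>c. lchain r c w 0 1 \<and> c 0 = p \<and> c 1 = q)"

definition saddle_conn :: "real \<Rightarrow> (real^2) set set \<Rightarrow> bool" where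
  "saddle_conn r S \<longleftrightarrow>
     (\<exists>c w. w \<noteq> 0 \<and> straight_open r c w 0 1 \<and>
        c 0 = arm_sing r \<and> c 1 = arm_sing r \<and>
        (\<forall>U. surf_open r U \<and> arm_sing r \<in> U \<longrightarrow>
            (\<exists>e>0. \<forall>t. 0 < t \<and> t < e \<longrightarrow> c t \<in> U \<and> c (1 - t) \<in> U)) \<and>
        S = c ` {0..1})"

definition is_cyl :: "real \<Rightarrow> (real^2) set set \<Rightarrow> real^2 \<Rightarrow> bool" where
  "is_cyl r C d \<longleftrightarrow>
     C \<subseteq> arm_X r \<and> surf_closed r C \<and>
     (\<exists>u n circ h F. norm u = 1 \<and> (\<exists>m. u = m *\<^sub>R d) \<and> norm n = 1 \<and> inner u n = 0 \<and>
        circ > 0 \<and> h > 0 \<and>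
        (\<forall>s. \<forall>t\<in>{0<..<h}. F (s + circ) t = F s t) \<and>
        inj_on (\<lambda>(s, t). F s t) ({0..<circ} \<times> {0<..<h}) \<and>
        (\<forall>t\<in>{0<..<h}. \<forall>a b. a < b \<longrightarrow> lchain r (\<lambda>s. F s t) u a b) \<and>
        (\<forall>s a b. 0 < a \<and> a < b \<and> b < h \<longrightarrow> lchain r (\<lambda>t. F s t) n a b) \<and>
        surf_interior r C = (\<lambda>(s, t). F s t) ` ({0..<circ} \<times> {0<..<h}) \<and>
        C = surf_closure r ((\<lambda>(s, t). F s t) ` ({0..<circ} \<times> {0<..<h}))) \<and>
     C - surf_interior r C = \<Union>{S. saddle_conn r S \<and> S \<subseteq> C - surf_interior r C}"

definition cyl_decomp :: "real \<Rightarrow> (real^2) set set set \<Rightarrow> real^2 \<Rightarrow> bool" where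
  "cyl_decomp r D d \<longleftrightarrow>
     (\<forall>C\<in>D. is_cyl r C d) \<and>
     (\<forall>C1\<in>D. \<forall>C2\<in>D. C1 \<noteq> C2 \<longrightarrow>
        C1 \<inter> C2 \<subseteq> (C1 - surf_interior r C1) \<inter> (C2 - surf_interior r C2)) \<and>
     surf_closure r (\<Union>D) = arm_X r"

definition has_rigid_spine :: "real \<Rightarrow> (real^2) set set set \<Rightarrow> bool" where
  "has_rigid_spine r D \<longleftrightarrow>
     (\<exists>S. saddle_conn r S \<and> S \<subseteq> surf_closure r (\<Union>D) \<and> (S - {arm_sing r}) \<inter> \<Union>D = {})"

definition affine_diffeo :: "real \<Rightarrow> ((real^2) set \<Rightarrow> (real^2) set) \<Rightarrow> real^2^2 \<Rightarrow> bool" where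
  "affine_diffeo r \<phi> A \<longleftrightarrow>
     det A \<noteq> 0 \<and> bij_betw \<phi> (arm_Xo r) (arm_Xo r) \<and>
     (\<forall>p\<in>arm_Xo r. \<exists>e>0. \<forall>w q. norm w < e \<and> sflow r p w q \<longrightarrow> sflow r (\<phi> p) (A *v w) (\<phi> q))"

definition parabolic :: "real^2^2 \<Rightarrow> bool" where
  "parabolic A \<longleftrightarrow> det A = 1 \<and> \<bar>trace A\<bar> = 2 \<and> A \<noteq> mat 1 \<and> A \<noteq> - mat 1"

definition fixes_decomp :: "real \<Rightarrow> ((real^2) set \<Rightarrow> (real^2) set) \<Rightarrow> (real^2) set set set \<Rightarrow> bool" where
  "fixes_decomp r \<phi> D \<longleftrightarrow>
     (\<lambda>C. \<phi> ` (C - {arm_sing r})) ` D = (\<lambda>C. C - {arm_sing r}) ` D"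

end

theory Submission
  imports Defs
begin

text \<open>
  Every flow line of slope \<open>q / (2q - 1)\<close> in a square carries a label \<open>u\<close>, the affinely rescaled height at which its
  backward continuation through the preceding squares leaves the left edge of the first square. In these labels the
  first return to the left edge is a piecewise translation, and for every \<open>k\<close> the finitely many label
  intervals \<open>[c - r^k, c - r^(k+1)]\<close>, with \<open>c\<close> running through numbers of the form \<open>n * r^i\<close> and their
  shifts by \<open>- q\<close>, are permuted cyclically; they sweep out one cylinder. These cylinders exhaust the surface except
  for the flow line with label \<open>0\<close>, which runs from a vertex through all squares into the accumulation point and is
  the rigid spine.

  Consecutive cylinders share one open saddle connection, and other pairs meet only in the singularity, so an
  affine diffeomorphism that permutes the cylinders induces an automorphism of a one-ended path and fixes each
  of them. If it is parabolic, its square fixes the direction of the cylinders and hence every common saddle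
  connection pointwise. Comparing two of these across a very thin cylinder shows that the derivative of the square
  also fixes the vertical vector, so that it is the identity, which is impossible for a parabolic element.
\<close>

text \<open>The hypothesis \<open>r = 1 / q\<close> enters through base-\<open>q\<close> digits. A
  positive label is rounded up to a number \<open>c\<close> with one nonzero digit, and the defect
  \<open>c - label\<close> is what the flow preserves. Each return to the left edge raises the digit
  by one, the carry \<open>q * r ^ Suc i = r ^ i\<close> moves it to the next position, and at
  \<open>c = q\<close> the return makes the offset 0. The label is then minus the defect; it
  descends the tail to the first square whose side does not exceed the defect, and the exit there
  restarts the count at \<open>2 * r ^ k\<close>. The powers of \<open>r\<close> enclosing the
  defect therefore number the cylinders, and the label 0, with no defect, is left over.

  The topological obstacle is the singular class, which has infinitely many representatives and no
  chart. Regular classes are finite and have charts in which straight continuation is unique; all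
  comparisons of paths and of affine images rest on this. Near the singularity the arguments return
  to the polygon itself, often to squares close to its limit point.

  The affine map is squared because a parabolic derivative may have the eigenvalue -1.\<close>

definition pt :: "real \<Rightarrow> real \<Rightarrow> real^2" where
  "pt x y = vector [x, y]"

lemma pt_nth [simp]: "pt x y $ 1 = x" "pt x y $ 2 = y"
  by (simp_all add: pt_def)

lemma pt_eq_iff [simp]: "pt a b = pt c d \<longleftrightarrow> a = c \<and> b = d"
  by (auto simp: vec_eq_iff forall_2)

lemma pt_eta: "p = pt (p $ 1) (p $ 2)"
  by (simp add: vec_eq_iff forall_2)

lemma pt_cases: obtains x y where "p = pt x y"
  using pt_eta by blast

lemma pt_add: "pt a b + pt c d = pt (a + c) (b + d)"
  by (simp add: vec_eq_iff forall_2)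

lemma pt_add_vec: "pt a b + v = pt (a + v $ 1) (b + v $ 2)"
  by (simp add: vec_eq_iff forall_2)

lemma pt_scaleR: "s *\<^sub>R pt a b = pt (s * a) (s * b)"
  by (simp add: vec_eq_iff forall_2)

lemma pt_zero: "pt 0 0 = 0"
  by (simp add: vec_eq_iff forall_2)

lemma arm_l_Suc [simp]: "arm_l r (Suc e) = r ^ e"
  by (simp add: arm_l_def)

lemma ex_ge_1_iff: "(\<exists>k\<ge>1. P k) \<longleftrightarrow> (\<exists>e. P (Suc e))"
  by (metis One_nat_def Suc_le_D le_SucI le_numeral_extra(4) not_less_eq_eq zero_le)

text \<open>Side lengths are kept in the form \<open>r ^ Suc e\<close>; unfolding the power would
  hide the level of the square from the facts about levels.\<close>

declare power_Suc [simp del]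

section \<open>Automorphisms of the one-ended path and squares of parabolic matrices\<close>

text \<open>Vertex 0 is the only one with a single neighbour: if \<open>f 0 = Suc m\<close>, the
  preimages of \<open>m\<close> and \<open>m + 2\<close> would both be neighbours of 0, hence both
  equal to 1. From there the path cannot fold back because \<open>f\<close> is injective.\<close>

lemma path_graph_automorphism:
  fixes f :: "nat \<Rightarrow> nat"
  assumes "inj f" "surj f" "\<And>k j. (k = Suc j \<or> j = Suc k) \<longleftrightarrow> (f k = Suc (f j) \<or> f j = Suc (f k))"
  shows "f k = k"
proof (induction k rule: less_induct)
  case (less k)
  have z: "f 0 = 0"
  proof (rule ccontr)
    assume "f 0 \<noteq> 0"
    then obtain m where m: "f 0 = Suc m" by (cases "f 0") auto
    obtain a b where ab: "f a = m" "f b = Suc (Suc m)" using assms(2) by (metis surjD)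
    have "a = Suc 0" "b = Suc 0" using assms(3)[of 0 a] assms(3)[of 0 b] m ab by auto
    then show False using ab by simp
  qed
  show ?case
  proof (cases k)
    case (Suc i)
    have i: "f i = i" using less Suc by simp
    have "f k = Suc (f i) \<or> f i = Suc (f k)" using assms(3)[of k i] Suc by simp
    moreover have "f i \<noteq> Suc (f k)"
    proof
      assume "f i = Suc (f k)"
      then have "f k < k" using i Suc by simp
      then have "f (f k) = f k" using less by blast
      then have "f k = k" using assms(1) by (simp add: inj_eq)
      then show False using \<open>f k < k\<close> by simp
    qed
    ultimately show ?thesis using i Suc by simp
  qed (use z in simp)
qed

lemma mat2_eqI:
  fixes A B :: "real^2^2"
  assumes "A$1$1 = B$1$1" "A$1$2 = B$1$2" "A$2$1 = B$2$1" "A$2$2 = B$2$2"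
  shows "A = B"
  using assms by (simp add: vec_eq_iff forall_2)

lemma mat_nth_2: "(mat 1 :: real^2^2)$1$1 = 1" "(mat 1 :: real^2^2)$1$2 = 0"
   "(mat 1 :: real^2^2)$2$1 = 0" "(mat 1 :: real^2^2)$2$2 = 1"
  by (simp_all add: mat_def)

lemma trace_2: "trace (A :: real^2^2) = A$1$1 + A$2$2"
  by (simp add: trace_def sum_2)

text \<open>The trace of the square is the squared trace minus twice the determinant, so both signs
  of the trace lead to 2. If the square were the identity, the nonzero trace would force
  \<open>A\<close> to be diagonal with equal entries 1 or -1.\<close>

lemma parabolic_square:
  assumes "parabolic A"
  shows "det (A ** A) = 1" "trace (A ** A) = 2" "A ** A \<noteq> mat 1"
proof -
  define a b c d where abcd: "a = A$1$1" "b = A$1$2" "c = A$2$1" "d = A$2$2"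
  have det: "a * d - b * c = 1" using assms unfolding parabolic_def abcd by (simp add: det_2)
  have tr: "\<bar>a + d\<bar> = 2" using assms unfolding parabolic_def abcd by (simp add: trace_2)
  have e: "(A ** A)$1$1 = a * a + b * c" "(A ** A)$1$2 = a * b + b * d"
    "(A ** A)$2$1 = c * a + d * c" "(A ** A)$2$2 = c * b + d * d"
    unfolding abcd by (simp_all add: matrix_matrix_mult_def sum_2)
  have tr2: "(a + d) * (a + d) = 4" using tr by (metis abs_mult_self_eq mult_2 numeral_Bit0 numeral_times_numeral semiring_norm(13) semiring_norm(11))
  show "det (A ** A) = 1" using assms unfolding parabolic_def by (simp add: det_mul)
  show "trace (A ** A) = 2" unfolding trace_2 e using det tr2 by (simp add: algebra_simps)
  show "A ** A \<noteq> mat 1"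
  proof
    assume "A ** A = mat 1"
    then have "b * (a + d) = 0" "c * (a + d) = 0" using e mat_nth_2 by (simp_all add: algebra_simps)
    moreover have "a + d \<noteq> 0" using tr by auto
    ultimately have bc: "b = 0" "c = 0" by auto
    have "(a - d) * (a - d) = (a + d) * (a + d) - 4 * (a * d)" by (simp add: algebra_simps)
    then have "a = d" using tr2 det bc by simp
    then have "a = 1 \<or> a = - 1" using tr by auto
    then have "A = mat 1 \<or> A = - mat 1"
      using bc \<open>a = d\<close> mat_nth_2 unfolding abcd by (auto intro!: mat2_eqI simp del: mat_0 )
    then show False using assms unfolding parabolic_def by blast
  qed
qed

lemma int_multiple_zero:
  fixes x :: real
  assumes "0 < x" "- x < of_int j * x" "of_int j * x < x"
  shows "j = 0"
proof -
  have "of_int (- 1) * x < of_int j * x" "of_int j * x < of_int 1 * x" using assms by simp_all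
  then have "of_int (- 1) < (of_int j :: real)" "(of_int j :: real) < of_int 1"
    using mult_less_cancel_right_pos[OF assms(1)] by blast+
  then show ?thesis by linarith
qed

section \<open>Powers of \<open>r\<close> and positions of the squares\<close>

locale tail =
  fixes q :: nat and r :: real
  assumes q_ge_2: "2 \<le> q" and qr: "real q * r = 1"
begin

lemma Q_ge_2: "2 \<le> real q"
  using q_ge_2 by simp

lemma r_pos: "0 < r"
  using qr Q_ge_2 by (metis mult_pos_pos not_numeral_le_zero of_nat_0_le_iff order_le_less zero_less_mult_pos zero_less_one)

lemma r_le_half: "r \<le> 1 / 2"
proof -
  have "2 * r \<le> real q * r"
    using Q_ge_2 r_pos by (intro mult_right_mono) auto
  then show ?thesis using qr by simp
qed

lemma r_less_1: "r < 1"
  using r_le_half by simp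

lemma rpow_pos [simp]: "0 < r ^ e"
  using r_pos by simp

lemma q_rpow: "real q * r ^ Suc e = r ^ e"
  using qr by (simp add: power_Suc mult.assoc[symmetric])

lemma rpow_Suc_le: "2 * r ^ Suc e \<le> r ^ e"
  using mult_right_mono[OF r_le_half, of "r ^ e"] rpow_pos[of e] by (simp add: power_Suc)

lemma rpow_Suc_less: "r ^ Suc e < r ^ e"
  using rpow_Suc_le[of e] rpow_pos[of "Suc e"] by linarith

lemma rpow_le_iff: "r ^ i \<le> r ^ j \<longleftrightarrow> j \<le> i"
  using power_decreasing_iff[OF r_pos r_less_1] by simp

lemma rpow_less_iff: "r ^ i < r ^ j \<longleftrightarrow> j < i"
  using rpow_le_iff[of j i] by (simp add: not_le[symmetric])

lemma rpow_eq_iff: "r ^ i = r ^ j \<longleftrightarrow> i = j"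
  using rpow_le_iff[of j i] rpow_le_iff[of i j] by (auto intro: antisym)

lemma rpow_le_1: "r ^ e \<le> 1"
  using rpow_le_iff[of e 0] by simp

lemma rpow_not_between: "\<not> (r ^ Suc e < r ^ i \<and> r ^ i < r ^ e)"
  by (simp only: rpow_less_iff) auto

text \<open>Squares are indexed from \<open>0\<close> here: square \<open>e\<close> has side \<open>r ^ e\<close> and its left edge at \<open>S e\<close>.\<close>

abbreviation S :: "nat \<Rightarrow> real" where "S \<equiv> arm_s r"

definition Sinf :: real where "Sinf = 1 / (1 - r)"

lemma S_0 [simp]: "S 0 = 0"
  by (simp add: arm_s_def)

lemma S_Suc: "S (Suc e) = S e + r ^ e"
  by (simp add: arm_s_def arm_l_def)

lemma S_eq: "(1 - r) * S e = 1 - r ^ e"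
proof (induction e)
  case (Suc e)
  have "(1 - r) * S (Suc e) = (1 - r) * S e + (1 - r) * r ^ e" by (simp add: S_Suc algebra_simps)
  then show ?case unfolding Suc by (simp add: power_Suc algebra_simps)
qed simp

lemma S_closed: "S e = (1 - r ^ e) * Sinf"
  using S_eq[of e] r_less_1 by (simp add: Sinf_def field_simps)

lemma Sinf_pos: "0 < Sinf"
  using r_less_1 by (simp add: Sinf_def)

lemma S_less_Sinf: "S e < Sinf"
proof -
  have "S e = Sinf - r ^ e * Sinf" using S_closed[of e] by (simp add: algebra_simps)
  moreover have "0 < r ^ e * Sinf" using Sinf_pos by simp
  ultimately show ?thesis by linarith
qed

lemma S_less_iff: "S i < S j \<longleftrightarrow> i < j"
proof -
  have "S i < S j \<longleftrightarrow> r ^ j < r ^ i"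
    unfolding S_closed using Sinf_pos by (simp add: mult_less_cancel_right)
  then show ?thesis by (simp add: rpow_less_iff)
qed

lemma S_le_iff: "S i \<le> S j \<longleftrightarrow> i \<le> j"
  using S_less_iff[of j i] by (simp add: not_less[symmetric])

lemma S_eq_iff: "S i = S j \<longleftrightarrow> i = j"
  using S_le_iff[of i j] S_le_iff[of j i] by (auto intro: antisym)

lemma S_nonneg: "0 \<le> S e"
  using S_le_iff[of 0 e] by simp

lemma S_Suc_pos: "0 < S (Suc e)"
  using S_less_iff[of 0 "Suc e"] by simp

lemma S_not_between: "\<not> (S e < S i \<and> S i < S (Suc e))"
  by (simp only: S_less_iff) auto

lemma S_interval_unique:
  assumes "S e < x" "x < S (Suc e)" "S i \<le> x" "x \<le> S (Suc i)"
  shows "i = e"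
proof -
  have "S e < S (Suc i)" "S i < S (Suc e)" using assms by linarith+
  then show ?thesis unfolding S_less_iff by simp
qed

lemma rpow_interval_unique:
  assumes "r ^ Suc e < y" "y < r ^ e" "r ^ Suc i \<le> y" "y \<le> r ^ i"
  shows "i = e"
proof -
  have "r ^ Suc e < r ^ i" "r ^ Suc i < r ^ e" using assms by linarith+
  then show ?thesis unfolding rpow_less_iff by simp
qed

section \<open>The polygon and its gluing classes\<close>

abbreviation Pbar :: "(real^2) set" where "Pbar \<equiv> arm_Pbar r"

lemma Pbar_iff: "pt x y \<in> Pbar \<longleftrightarrow>
    (\<exists>e. S e \<le> x \<and> x \<le> S (Suc e) \<and> 0 \<le> y \<and> y \<le> r ^ e) \<or> (x = Sinf \<and> y = 0)"
proof -
  have "pt x y \<in> arm_square r (Suc e) \<longleftrightarrow> S e \<le> x \<and> x \<le> S (Suc e) \<and> 0 \<le> y \<and> y \<le> r ^ e" for e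
    unfolding arm_square_def pt_def[symmetric] by (auto simp: mem_box_cart forall_2)
  moreover have "pt x y \<in> arm_P r \<longleftrightarrow> (\<exists>e. pt x y \<in> arm_square r (Suc e))"
    unfolding arm_P_def using ex_ge_1_iff[of "\<lambda>k. pt x y \<in> arm_square r k"] by auto
  moreover have "pt x y = arm_Lpt r \<longleftrightarrow> x = Sinf \<and> y = 0"
    unfolding arm_Lpt_def pt_def[symmetric] by (simp add: Sinf_def)
  ultimately show ?thesis unfolding arm_Pbar_def by auto
qed

lemma Pbar_square: "S e \<le> x \<Longrightarrow> x \<le> S (Suc e) \<Longrightarrow> 0 \<le> y \<Longrightarrow> y \<le> r ^ e \<Longrightarrow> pt x y \<in> Pbar"
  using Pbar_iff by blast

lemma Pbar_between:
  assumes "S e < x" "x < S (Suc e)"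
  shows "pt x y \<in> Pbar \<longleftrightarrow> 0 \<le> y \<and> y \<le> r ^ e"
  using assms S_interval_unique[OF assms] S_less_Sinf[of "Suc e"] unfolding Pbar_iff
  by (auto intro!: exI[of _ e])

text \<open>The points \<open>pt 0 (r ^ e)\<close> are not corners of squares, but the gluing of the right edges identifies them
  with corners.\<close>

definition sing :: "(real^2) set" where
  "sing = {p. \<exists>e. p = pt (S e) 0 \<or> p = pt (S e) (r ^ e) \<or> p = pt (S (Suc e)) (r ^ e) \<or> p = pt 0 (r ^ e)} \<union> {pt Sinf 0}"

lemma sing_iff: "pt x y \<in> sing \<longleftrightarrow>
   (\<exists>e. x = S e \<and> (y = 0 \<or> y = r ^ e)) \<or> (\<exists>e. x = S (Suc e) \<and> y = r ^ e) \<or> (\<exists>e. x = 0 \<and> y = r ^ e) \<or> (x = Sinf \<and> y = 0)"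
  unfolding sing_def by auto

lemma vtx_iff: "pt x y \<in> arm_vtx r \<longleftrightarrow>
   (\<exists>e. x = S e \<and> (y = 0 \<or> y = r ^ e)) \<or> (\<exists>e. x = S (Suc e) \<and> y = r ^ e) \<or> (x = Sinf \<and> y = 0)"
proof -
  have "pt x y \<in> arm_corners r (Suc e) \<longleftrightarrow>
     (x = S e \<or> x = S (Suc e)) \<and> (y = 0 \<or> y = r ^ e)" for e
    unfolding arm_corners_def pt_def[symmetric] by auto
  moreover have "pt x y \<in> arm_vtx r \<longleftrightarrow> (\<exists>e. pt x y \<in> arm_corners r (Suc e)) \<or> pt x y = arm_Lpt r"
    unfolding arm_vtx_def using ex_ge_1_iff[of "\<lambda>k. pt x y \<in> arm_corners r k"] by auto
  moreover have "pt x y = arm_Lpt r \<longleftrightarrow> x = Sinf \<and> y = 0"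
    unfolding arm_Lpt_def pt_def[symmetric] by (simp add: Sinf_def)
  ultimately show ?thesis by auto
qed

lemma sing_between: "S e < x \<Longrightarrow> x < S (Suc e) \<Longrightarrow> pt x y \<notin> sing"
  unfolding sing_iff using S_not_between[of e] S_less_Sinf[of "Suc e"] S_nonneg[of e] by auto

lemma sing_left: "r ^ Suc e < y \<Longrightarrow> y < r ^ e \<Longrightarrow> pt 0 y \<notin> sing"
  using rpow_not_between[of e] less_trans[OF rpow_pos[of "Suc e"], of y] unfolding sing_iff by auto

lemma sing_right:
  assumes "0 < y" "y < r ^ e" "y \<noteq> r ^ Suc e"
  shows "pt (S (Suc e)) y \<notin> sing"
  unfolding sing_iff using assms S_Suc_pos[of e] by (auto simp: S_eq_iff)

text \<open>\<open>key\<close> selects one point of each gluing class, so that the transitive closure in the gluing relation becomes an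
  equation; the origin represents the singular class.\<close>

definition key :: "real^2 \<Rightarrow> real^2" where
  "key p = (if p \<in> sing then 0
     else if \<exists>e. S e < p $ 1 \<and> p $ 1 < S (Suc e) \<and> p $ 2 = r ^ e then pt (p $ 1) 0
     else if \<exists>e. p $ 1 = S (Suc e) \<and> r ^ Suc e < p $ 2 \<and> p $ 2 < r ^ e then pt 0 (p $ 2)
     else p)"

lemma key_sing: "p \<in> sing \<Longrightarrow> key p = 0"
  by (simp add: key_def)

lemma key_top: "S e < x \<Longrightarrow> x < S (Suc e) \<Longrightarrow> key (pt x (r ^ e)) = pt x 0"
  using sing_between[of e x "r ^ e"] unfolding key_def by auto

lemma key_between:
  assumes "S e < x" "x < S (Suc e)" "y < r ^ e"
  shows "key (pt x y) = pt x y"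
proof -
  have "\<not> (\<exists>i. S i < x \<and> x < S (Suc i) \<and> y = r ^ i)"
    using S_interval_unique[OF assms(1,2)] assms(3) by (metis less_imp_le less_irrefl)
  moreover have "\<not> (\<exists>i. x = S (Suc i))" using S_not_between assms by blast
  ultimately show ?thesis using sing_between[OF assms(1,2)] unfolding key_def by auto
qed

lemma key_right: "r ^ Suc e < y \<Longrightarrow> y < r ^ e \<Longrightarrow> key (pt (S (Suc e)) y) = pt 0 y"
  using sing_right[of y e] rpow_pos[of "Suc e"] S_not_between unfolding key_def by auto

lemma key_shared:
  assumes "0 < y" "y < r ^ Suc e"
  shows "key (pt (S (Suc e)) y) = pt (S (Suc e)) y"
proof -
  have "\<not> (\<exists>i. S (Suc e) = S (Suc i) \<and> r ^ Suc i < y)"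
    using assms(2) S_eq_iff by force
  moreover have "y < r ^ e" using assms rpow_Suc_less[of e] by linarith
  ultimately show ?thesis using sing_right[of y e] assms S_not_between[of _ "Suc e"] unfolding key_def by auto
qed

lemma key_left:
  assumes "r ^ Suc e < y" "y < r ^ e"
  shows "key (pt 0 y) = pt 0 y"
proof -
  have "\<not> S i < 0" "0 \<noteq> S (Suc i)" for i using S_nonneg[of i] S_Suc_pos[of i] by auto
  then show ?thesis using sing_left[OF assms] unfolding key_def by auto
qed

lemma key_cases:
  obtains (s) "pt x y \<in> sing" | (t) e where "S e < x" "x < S (Suc e)" "y = r ^ e"
    | (l) e where "x = S (Suc e)" "r ^ Suc e < y" "y < r ^ e" | (n) "key (pt x y) = pt x y"
proof (cases "pt x y \<in> sing \<or> (\<exists>e. S e < x \<and> x < S (Suc e) \<and> y = r ^ e)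
    \<or> (\<exists>e. x = S (Suc e) \<and> r ^ Suc e < y \<and> y < r ^ e)")
  case True
  then show ?thesis using s t l by blast
next
  case False
  then show ?thesis by (intro n) (auto simp: key_def)
qed

lemma sing_edge:
  assumes "S e \<le> t" "t \<le> S (Suc e)" "\<not> (S e < t \<and> t < S (Suc e))"
  shows "pt t (r ^ e) \<in> sing" "pt t 0 \<in> sing"
proof -
  have "t = S e \<or> t = S (Suc e)" using assms by linarith
  then show "pt t (r ^ e) \<in> sing" "pt t 0 \<in> sing" unfolding sing_iff by auto
qed

lemma glue0_key:
  assumes "arm_glue0 r x y"
  shows "key x = key y"
proof -
  have vs: "p \<in> arm_vtx r \<Longrightarrow> p \<in> sing" for p
    by (cases p rule: pt_cases) (auto simp: vtx_iff sing_iff)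
  consider (v) "x \<in> arm_vtx r" "y \<in> arm_vtx r"
    | (t) e t where "S e \<le> t" "t \<le> S (Suc e)" "x = pt t (r ^ e)" "y = pt t 0"
    | (l) e u where "r ^ Suc e \<le> u" "u \<le> r ^ e" "x = pt (S (Suc e)) u" "y = pt 0 u"
    using assms unfolding arm_glue0_def pt_def[symmetric] ex_ge_1_iff by auto
  then show ?thesis
  proof cases
    case v
    then show ?thesis using vs by (simp add: key_sing)
  next
    case (t e t)
    show ?thesis
    proof (cases "S e < t \<and> t < S (Suc e)")
      case True
      then show ?thesis using t key_top[of e t] key_between[of e t 0] by simp
    next
      case False
      then show ?thesis using t sing_edge[of e t] by (simp add: key_sing)
    qed
  next
    case (l e u)
    show ?thesis
    proof (cases "r ^ Suc e < u \<and> u < r ^ e")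
      case True
      then show ?thesis using l key_right[of e u] key_left[of e u] by simp
    next
      case False
      then have "u = r ^ Suc e \<or> u = r ^ e" using l by linarith
      then have "x \<in> sing" "y \<in> sing" using l by (auto simp: sing_iff)
      then show ?thesis by (simp add: key_sing)
    qed
  qed
qed

lemma arm_eqv_refl: "arm_eqv r x x"
  by (simp add: arm_eqv_def)

lemma arm_eqv_sym: "arm_eqv r x y \<Longrightarrow> arm_eqv r y x"
proof -
  have "symp (\<lambda>x y. arm_glue0 r x y \<or> arm_glue0 r y x)" by (rule sympI) blast
  from sympD[OF symp_rtranclp[OF this]] show "arm_eqv r x y \<Longrightarrow> arm_eqv r y x"
    unfolding arm_eqv_def .
qed

lemma arm_eqv_trans: "arm_eqv r x y \<Longrightarrow> arm_eqv r y z \<Longrightarrow> arm_eqv r x z"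
  unfolding arm_eqv_def by (rule rtranclp_trans)

lemma arm_eqv_glue: "arm_glue0 r x y \<Longrightarrow> arm_eqv r x y"
  unfolding arm_eqv_def by blast

lemma eqv_sing:
  assumes "p \<in> sing"
  shows "arm_eqv r p 0"
proof -
  have 0: "(0::real^2) \<in> arm_vtx r"
    unfolding pt_zero[symmetric] vtx_iff by (auto intro!: exI[of _ 0])
  obtain x y where p: "p = pt x y" by (rule pt_cases)
  show ?thesis
  proof (cases "p \<in> arm_vtx r")
    case True
    then show ?thesis using 0 by (intro arm_eqv_glue) (simp add: arm_glue0_def)
  next
    case False
    then obtain e where e: "x = 0" "y = r ^ e" using assms unfolding p sing_iff vtx_iff by auto
    let ?z = "pt (S (Suc e)) (r ^ e)"
    have "?z \<in> arm_vtx r" unfolding vtx_iff by auto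
    then have "arm_eqv r ?z 0" using 0 by (intro arm_eqv_glue) (simp add: arm_glue0_def)
    moreover have "arm_glue0 r ?z p"
      unfolding arm_glue0_def pt_def[symmetric] ex_ge_1_iff p e
      by (intro disjI2 exI[of _ e] exI[of _ "r ^ e"]) (use rpow_Suc_less[of e] in simp)
    then have "arm_eqv r p ?z" by (metis arm_eqv_glue arm_eqv_sym)
    ultimately show ?thesis by (metis arm_eqv_trans)
  qed
qed

lemma eqv_key: "arm_eqv r p (key p)"
proof -
  obtain x y where p: "p = pt x y" by (rule pt_cases)
  show ?thesis unfolding p
  proof (cases x y rule: key_cases)
    case s
    then show "arm_eqv r (pt x y) (key (pt x y))" using eqv_sing by (simp add: key_sing)
  next
    case (t e)
    then have "arm_glue0 r (pt x y) (pt x 0)"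
      unfolding arm_glue0_def pt_def[symmetric] ex_ge_1_iff by force
    then show "arm_eqv r (pt x y) (key (pt x y))" using t key_top[of e x] by (simp add: arm_eqv_glue)
  next
    case (l e)
    then have "arm_glue0 r (pt x y) (pt 0 y)"
      unfolding arm_glue0_def pt_def[symmetric] ex_ge_1_iff by force
    then show "arm_eqv r (pt x y) (key (pt x y))" using l key_right[of e y] by (simp add: arm_eqv_glue)
  next
    case n
    then show "arm_eqv r (pt x y) (key (pt x y))" by (simp add: arm_eqv_refl)
  qed
qed

text \<open>Every generating identification preserves \<open>key\<close>, and every point is joined
  to its own \<open>key\<close>; no chain of identifications has to be analysed beyond this.\<close>

lemma eqv_iff_key: "arm_eqv r x y \<longleftrightarrow> key x = key y"
proof
  assume "arm_eqv r x y"
  then show "key x = key y"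
    unfolding arm_eqv_def by induction (auto dest: glue0_key)
next
  assume "key x = key y"
  then show "arm_eqv r x y" using eqv_key[of x] eqv_key[of y] by (metis arm_eqv_sym arm_eqv_trans)
qed

abbreviation cls :: "real^2 \<Rightarrow> (real^2) set" where "cls \<equiv> arm_cls r"

lemma cls_eq: "cls x = {y. key y = key x}"
  unfolding arm_cls_def eqv_iff_key by auto

lemma cls_eq_iff: "cls x = cls y \<longleftrightarrow> key x = key y"
  unfolding cls_eq by auto

lemma mem_cls: "y \<in> cls x \<longleftrightarrow> key y = key x"
  unfolding cls_eq by auto

lemma zero_sing: "0 \<in> sing"
  unfolding pt_zero[symmetric] sing_iff by (metis S_0)

lemma key_eq_0_iff: "key p = 0 \<longleftrightarrow> p \<in> sing"
proof
  assume k: "key p = 0"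
  obtain x y where p: "p = pt x y" by (rule pt_cases)
  show "p \<in> sing"
  proof (rule ccontr)
    assume n: "p \<notin> sing"
    then have "p \<noteq> 0" using zero_sing by metis
    then show False using k n unfolding key_def pt_zero[symmetric] p
      by (smt (verit, best) S_nonneg pt_eq_iff pt_nth rpow_pos)
  qed
qed (rule key_sing)

lemma arm_sing_eq: "arm_sing r = sing"
  unfolding arm_sing_def cls_eq key_sing[OF zero_sing] key_eq_0_iff by simp

lemma cls_sing_iff: "cls p = arm_sing r \<longleftrightarrow> p \<in> sing"
  unfolding arm_sing_def cls_eq_iff key_sing[OF zero_sing] key_eq_0_iff ..

lemma key_preimage:
  assumes "key z = p" "p \<noteq> 0"
  shows "z = p \<or> (\<exists>e x. S e < x \<and> x < S (Suc e) \<and> z = pt x (r ^ e) \<and> p = pt x 0)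
     \<or> (\<exists>e y. r ^ Suc e < y \<and> y < r ^ e \<and> z = pt (S (Suc e)) y \<and> p = pt 0 y)"
proof -
  obtain x y where z: "z = pt x y" by (rule pt_cases)
  show ?thesis using assms unfolding key_def z by (auto split: if_splits)
qed

lemma sing_Pbar: "p \<in> sing \<Longrightarrow> p \<in> Pbar"
proof -
  assume s: "p \<in> sing"
  obtain x y where p: "p = pt x y" by (rule pt_cases)
  have "S e \<le> S (Suc e)" for e by (simp add: S_le_iff)
  moreover have le: "0 \<le> r ^ e" for e using rpow_pos[of e] by linarith
  moreover have "pt 0 (r ^ e) \<in> Pbar" for e
    unfolding Pbar_iff using rpow_le_1[of e] le[of e] S_Suc_pos[of 0] by (auto intro!: exI[of _ 0])
  ultimately show "p \<in> Pbar"
    using s Pbar_iff[of Sinf 0] Pbar_square unfolding p sing_iff by (metis order_refl)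
qed

lemma key_Pbar_iff: "key p \<in> Pbar \<longleftrightarrow> p \<in> Pbar"
proof -
  obtain x y where p: "p = pt x y" by (rule pt_cases)
  show ?thesis unfolding p
  proof (cases x y rule: key_cases)
    case s
    then show "key (pt x y) \<in> Pbar \<longleftrightarrow> pt x y \<in> Pbar" using sing_Pbar zero_sing by (simp add: key_sing)
  next
    case (t e)
    then show "key (pt x y) \<in> Pbar \<longleftrightarrow> pt x y \<in> Pbar"
      using key_top[of e x] Pbar_between[of e x] less_imp_le[OF rpow_pos[of e]] by simp
  next
    case (l e)
    moreover have "0 \<le> y" "y \<le> r ^ 0"
      using l(2) less_trans[OF l(3), of 2] l(3) rpow_le_1[of e] rpow_pos[of "Suc e"] by (linarith, simp)
    ultimately have "pt 0 y \<in> Pbar" "pt x y \<in> Pbar"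
      using S_Suc_pos[of 0] S_le_iff[of e "Suc e"] Pbar_square[of 0 0 y] Pbar_square[of e x y] by simp_all
    then show "key (pt x y) \<in> Pbar \<longleftrightarrow> pt x y \<in> Pbar" using l key_right[of e y] by simp
  qed simp
qed

lemma key_eq_Pbar: "key x = key y \<Longrightarrow> x \<in> Pbar \<longleftrightarrow> y \<in> Pbar"
  by (metis key_Pbar_iff)

lemma key_eq_sing: "key x = key y \<Longrightarrow> x \<in> sing \<longleftrightarrow> y \<in> sing"
  by (metis key_eq_0_iff)

lemma cls_in_X_iff: "cls p \<in> arm_X r \<longleftrightarrow> p \<in> Pbar"
proof
  assume "cls p \<in> arm_X r"
  then obtain p' where "p' \<in> Pbar" "cls p = cls p'" unfolding arm_X_def by auto
  then show "p \<in> Pbar" using cls_eq_iff[of p p'] key_eq_Pbar[of p p'] by simp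
qed (simp add: arm_X_def)

lemma X_cases: assumes "c \<in> arm_X r" obtains p where "p \<in> Pbar" "c = cls p"
  using assms unfolding arm_X_def by auto

lemma X_mem: "c \<in> arm_X r \<Longrightarrow> p \<in> c \<Longrightarrow> c = cls p \<and> p \<in> Pbar"
  by (metis X_cases cls_eq_iff mem_cls key_eq_Pbar)

lemma Union_mem: "B \<subseteq> arm_X r \<Longrightarrow> p \<in> \<Union>B \<longleftrightarrow> cls p \<in> B"
  using X_mem mem_cls by blast

lemma Union_sub_Pbar: "B \<subseteq> arm_X r \<Longrightarrow> \<Union>B \<subseteq> Pbar"
  using X_mem by blast

lemma sing_in_X: "arm_sing r \<in> arm_X r"
  using cls_in_X_iff sing_Pbar zero_sing unfolding arm_sing_def by blast

subsection \<open>Local structure at regular points\<close>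


text \<open>\<open>p\<close> and \<open>p'\<close> are the two points of a regular class on a glued edge and \<open>\<nu>\<close> is the inward normal at \<open>p\<close>.
  Classes with a single interior point are covered by \<open>p' = p\<close> and \<open>\<nu> = 0\<close>.\<close>

definition edge_at :: "real^2 \<Rightarrow> real^2 \<Rightarrow> real^2 \<Rightarrow> real^2 \<Rightarrow> bool" where
  "edge_at p p' \<nu> v \<longleftrightarrow>
     (p + v \<in> Pbar \<longleftrightarrow> 0 \<le> \<nu> \<bullet> v) \<and> (p' + v \<in> Pbar \<longleftrightarrow> \<nu> \<bullet> v \<le> 0) \<and>
     (\<nu> \<bullet> v = 0 \<longrightarrow> key (p + v) = key (p' + v)) \<and>
     (0 \<le> \<nu> \<bullet> v \<longrightarrow> p + v \<notin> sing \<and> (\<forall>z. key z = key (p + v) \<longrightarrow> z = p + v \<or> z = p' + v)) \<and>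
     (\<nu> \<bullet> v \<le> 0 \<longrightarrow> p' + v \<notin> sing \<and> (\<forall>z. key z = key (p' + v) \<longrightarrow> z = p + v \<or> z = p' + v))"

definition edge_pair :: "real^2 \<Rightarrow> real^2 \<Rightarrow> real^2 \<Rightarrow> real \<Rightarrow> bool" where
  "edge_pair p p' \<nu> \<epsilon> \<longleftrightarrow> (\<forall>v. norm v < \<epsilon> \<longrightarrow> edge_at p p' \<nu> v)"

lemma edge_pair_swap: "edge_pair p p' \<nu> \<epsilon> \<Longrightarrow> edge_pair p' p (- \<nu>) \<epsilon>"
  unfolding edge_pair_def edge_at_def by auto

lemma comp_less: "norm (v::real^2) < e \<Longrightarrow> \<bar>v $ 1\<bar> < e \<and> \<bar>v $ 2\<bar> < e"
  using component_le_norm_cart[of v 1] component_le_norm_cart[of v 2] by simp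

lemma inner_pt: "pt a b \<bullet> v = a * v $ 1 + b * v $ 2"
  by (simp add: inner_vec_def sum_2)

text \<open>Points that \<open>key\<close> really moves are sent to a coordinate axis, so a value
  with two positive coordinates has no further representative.\<close>

lemma key_preimage_pos:
  assumes "key z = pt x y" "0 < x" "0 < y"
  shows "z = pt x y"
  using key_preimage[OF assms(1)] assms(2,3) by (auto simp: pt_zero[symmetric])

lemma edge_pair_interior:
  assumes "0 < \<epsilon>" "\<And>x' y'. \<bar>x' - x\<bar> < \<epsilon> \<Longrightarrow> \<bar>y' - y\<bar> < \<epsilon> \<Longrightarrow>
     0 < x' \<and> 0 < y' \<and> pt x' y' \<in> Pbar \<and> pt x' y' \<notin> sing \<and> key (pt x' y') = pt x' y'"
  shows "edge_pair (pt x y) (pt x y) 0 \<epsilon>"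
  unfolding edge_pair_def
proof (intro allI impI)
  fix v :: "real^2" assume "norm v < \<epsilon>"
  then have *: "\<bar>(x + v $ 1) - x\<bar> < \<epsilon>" "\<bar>(y + v $ 2) - y\<bar> < \<epsilon>" using comp_less by auto
  show "edge_at (pt x y) (pt x y) 0 v"
    using assms(2)[OF *] key_preimage_pos unfolding edge_at_def pt_add_vec by auto
qed

lemma edge_pair_square:
  assumes "S e < x" "x < S (Suc e)" "0 < y" "y < r ^ e"
  shows "\<exists>\<epsilon>>0. edge_pair (pt x y) (pt x y) 0 \<epsilon>"
proof -
  define \<epsilon> where "\<epsilon> = Min {x - S e, S (Suc e) - x, y, r ^ e - y}"
  have "0 < \<epsilon>" using assms unfolding \<epsilon>_def by simp
  moreover have "edge_pair (pt x y) (pt x y) 0 \<epsilon>"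
  proof (rule edge_pair_interior[OF \<open>0 < \<epsilon>\<close>])
    fix x' y' assume "\<bar>x' - x\<bar> < \<epsilon>" "\<bar>y' - y\<bar> < \<epsilon>"
    then have "S e < x'" "x' < S (Suc e)" "0 < y'" "y' < r ^ e" unfolding \<epsilon>_def by auto
    then show "0 < x' \<and> 0 < y' \<and> pt x' y' \<in> Pbar \<and> pt x' y' \<notin> sing \<and> key (pt x' y') = pt x' y'"
      using sing_between[of e x' y'] key_between[of e x' y'] Pbar_between[of e x' y'] S_nonneg[of e] by auto
  qed
  ultimately show ?thesis by blast
qed

lemma edge_pair_shared:
  assumes "0 < y" "y < r ^ Suc e"
  shows "\<exists>\<epsilon>>0. edge_pair (pt (S (Suc e)) y) (pt (S (Suc e)) y) 0 \<epsilon>"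
proof -
  \<comment> \<open>The bound \<open>r ^ Suc e\<close> is the side of the smaller neighbour; it
    keeps the abscissa within squares \<open>e\<close> and \<open>Suc e\<close>.\<close>
  define \<epsilon> where "\<epsilon> = Min {r ^ Suc e, y, r ^ Suc e - y}"
  have "0 < \<epsilon>" using assms unfolding \<epsilon>_def by simp
  moreover have "edge_pair (pt (S (Suc e)) y) (pt (S (Suc e)) y) 0 \<epsilon>"
  proof (rule edge_pair_interior[OF \<open>0 < \<epsilon>\<close>])
    fix x' y' assume "\<bar>x' - S (Suc e)\<bar> < \<epsilon>" "\<bar>y' - y\<bar> < \<epsilon>"
    then have b: "\<bar>x' - S (Suc e)\<bar> < r ^ Suc e" "0 < y'" "y' < r ^ Suc e" unfolding \<epsilon>_def by auto
    then have b': "S e < x'" "x' < S (Suc (Suc e))" "y' < r ^ e"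
      using rpow_Suc_less[of e] S_Suc[of e] S_Suc[of "Suc e"] by auto
    show "0 < x' \<and> 0 < y' \<and> pt x' y' \<in> Pbar \<and> pt x' y' \<notin> sing \<and> key (pt x' y') = pt x' y'"
    proof (cases "x' = S (Suc e)")
      case True
      then show ?thesis using b b' key_shared[of y' e] sing_right[of y' e] S_nonneg[of e] S_le_iff[of e "Suc e"]
        by (auto intro!: Pbar_square[of e])
    next
      case False
      then consider "S e < x'" "x' < S (Suc e)" | "S (Suc e) < x'" "x' < S (Suc (Suc e))"
        using b' by linarith
      then show ?thesis
        using b b' sing_between[of e x' y'] key_between[of e x' y'] Pbar_between[of e x' y'] S_nonneg[of e]
         sing_between[of "Suc e" x' y'] key_between[of "Suc e" x' y'] Pbar_between[of "Suc e" x' y']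
        by cases auto
    qed
  qed
  ultimately show ?thesis by blast
qed

lemma edge_pair_horizontal:
  assumes "S e < x" "x < S (Suc e)"
  shows "\<exists>\<epsilon>>0. edge_pair (pt x 0) (pt x (r ^ e)) (pt 0 1) \<epsilon>"
proof -
  define \<epsilon> where "\<epsilon> = Min {x - S e, S (Suc e) - x, r ^ e}"
  have "0 < \<epsilon>" using assms unfolding \<epsilon>_def by simp
  moreover have "edge_pair (pt x 0) (pt x (r ^ e)) (pt 0 1) \<epsilon>"
    unfolding edge_pair_def
  proof (intro allI impI)
    fix v :: "real^2" assume "norm v < \<epsilon>"
    then have v: "S e < x + v $ 1" "x + v $ 1 < S (Suc e)" "\<bar>v $ 2\<bar> < r ^ e"
      using comp_less[of v \<epsilon>] unfolding \<epsilon>_def by auto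
    let ?x = "x + v $ 1" and ?y = "v $ 2"
    note n = sing_between[OF v(1,2)] and P = Pbar_between[OF v(1,2)]
    have i: "i = e" if "S i < ?x" "?x < S (Suc i)" for i
      using S_interval_unique[OF v(1,2), of i] that by simp
    have x0: "?x \<noteq> 0" using v S_nonneg[of e] by linarith
    have k0: "key (pt ?x ?y) = pt ?x ?y" using v key_between[OF v(1,2), of ?y] by simp
    have k1: "key (pt ?x (r ^ e + ?y)) = pt ?x (if ?y = 0 then 0 else r ^ e + ?y)" if "?y \<le> 0"
      using v that key_between[OF v(1,2), of "r ^ e + ?y"] key_top[OF v(1,2)] by auto
    have z0: "z = pt ?x ?y \<or> z = pt ?x (r ^ e + ?y)" if "key z = pt ?x ?y" for z
      using key_preimage[OF that] i x0 by (auto simp: pt_zero[symmetric])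
    have z1: "z = pt ?x ?y \<or> z = pt ?x (r ^ e + ?y)" if "key z = pt ?x (r ^ e + ?y)" "?y < 0" for z
      using key_preimage[OF that(1)] i x0 v(3) that by (auto simp: pt_zero[symmetric])
    consider "?y < 0" | "?y = 0" | "0 < ?y" by linarith
    then show "edge_at (pt x 0) (pt x (r ^ e)) (pt 0 1) v"
      unfolding edge_at_def pt_add_vec inner_pt using v(3) n P k0 k1 z0 z1 less_imp_le[OF rpow_pos[of e]] by cases auto
  qed
  ultimately show ?thesis by blast
qed

lemma edge_pair_vertical:
  assumes "r ^ Suc e < y" "y < r ^ e"
  shows "\<exists>\<epsilon>>0. edge_pair (pt 0 y) (pt (S (Suc e)) y) (pt 1 0) \<epsilon>"
proof -
  define \<epsilon> where "\<epsilon> = Min {y - r ^ Suc e, r ^ e - y, r ^ Suc e}"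
  have "0 < \<epsilon>" using assms unfolding \<epsilon>_def by simp
  moreover have "edge_pair (pt 0 y) (pt (S (Suc e)) y) (pt 1 0) \<epsilon>"
    unfolding edge_pair_def
  proof (intro allI impI)
    fix v :: "real^2" assume "norm v < \<epsilon>"
    then have v: "r ^ Suc e < y + v $ 2" "y + v $ 2 < r ^ e" "\<bar>v $ 1\<bar> < r ^ Suc e"
      using comp_less[of v \<epsilon>] unfolding \<epsilon>_def by auto
    let ?x = "v $ 1" and ?y = "y + v $ 2"
    have y: "0 < ?y" "?y < 1" using v rpow_pos[of "Suc e"] rpow_le_1[of e] by linarith+
    have S1: "S (Suc 0) = 1" by (simp add: S_Suc)
    have x1: "?x < 1" using v(3) rpow_le_1[of "Suc e"] by linarith
    have i: "i = e" if "r ^ Suc i < ?y" "?y < r ^ i" for i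
      using rpow_interval_unique[OF v(1,2), of i] that by simp
    have SS: "S (Suc e) = S e + r ^ e" "S (Suc (Suc e)) = S (Suc e) + r ^ Suc e" by (rule S_Suc)+
    have ub: "S e < S (Suc e) + ?x" "S (Suc e) + ?x < S (Suc (Suc e))"
      using v(3) rpow_Suc_less[of e] SS by auto
    have left: "0 < ?x \<Longrightarrow> key (pt ?x ?y) = pt ?x ?y \<and> pt ?x ?y \<in> Pbar \<and> pt ?x ?y \<notin> sing"
      using key_between[of 0 ?x ?y] Pbar_between[of 0 ?x ?y] sing_between[of 0 ?x ?y] S1 x1 y by simp
    have left0: "key (pt 0 ?y) = pt 0 ?y \<and> pt 0 ?y \<in> Pbar \<and> pt 0 ?y \<notin> sing"
      using key_left[OF v(1,2)] sing_left[OF v(1,2)] Pbar_square[of 0 0 ?y] S1 y by simp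
    have leftn: "pt ?x ?y \<notin> Pbar" if "?x < 0"
    proof -
      have "\<not> S i \<le> ?x" for i using that S_nonneg[of i] by linarith
      moreover have "?x \<noteq> Sinf" using that Sinf_pos by linarith
      ultimately show ?thesis unfolding Pbar_iff by blast
    qed
    have right: "?x < 0 \<Longrightarrow> key (pt (S (Suc e) + ?x) ?y) = pt (S (Suc e) + ?x) ?y \<and>
        pt (S (Suc e) + ?x) ?y \<in> Pbar \<and> pt (S (Suc e) + ?x) ?y \<notin> sing"
      using key_between[of e "S (Suc e) + ?x" ?y] Pbar_between[of e "S (Suc e) + ?x" ?y]
        sing_between[of e "S (Suc e) + ?x" ?y] ub v y by auto
    have right0: "key (pt (S (Suc e)) ?y) = pt 0 ?y \<and> pt (S (Suc e)) ?y \<in> Pbar \<and> pt (S (Suc e)) ?y \<notin> sing"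
      using key_right[OF v(1,2)] sing_right[of ?y e] Pbar_square[of e "S (Suc e)" ?y] S_le_iff[of e "Suc e"] y v by auto
    have rightn: "0 < ?x \<Longrightarrow> pt (S (Suc e) + ?x) ?y \<notin> Pbar"
      using Pbar_between[of "Suc e" "S (Suc e) + ?x" ?y] ub v by auto
    have zl: "z = pt ?x ?y" if "key z = pt ?x ?y" "0 < ?x" for z
      using key_preimage_pos[OF that y(1)] .
    have zr: "z = pt (S (Suc e) + ?x) ?y" if "key z = pt (S (Suc e) + ?x) ?y" for z
      using key_preimage_pos[OF that _ y(1)] ub S_nonneg[of e] by simp
    have z0: "z = pt 0 ?y \<or> z = pt (S (Suc e)) ?y" if "key z = pt 0 ?y" for z
      using key_preimage[OF that] i y(1) by (auto simp: pt_zero[symmetric])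
    consider "?x < 0" | "?x = 0" | "0 < ?x" by linarith
    then show "edge_at (pt 0 y) (pt (S (Suc e)) y) (pt 1 0) v"
    proof cases
      case 1
      then show ?thesis unfolding edge_at_def pt_add_vec inner_pt using right leftn zr by simp
    next
      case 2
      then show ?thesis unfolding edge_at_def pt_add_vec inner_pt using right0 left0 z0 by simp
    next
      case 3
      then show ?thesis unfolding edge_at_def pt_add_vec inner_pt using left rightn zl by simp
    qed
  qed
  ultimately show ?thesis by blast
qed

lemma left_edge_cases:
  assumes "0 < y" "y < 1" "pt 0 y \<notin> sing"
  obtains e where "r ^ Suc e < y" "y < r ^ e"
proof -
  obtain n where n: "r ^ n < y" using real_arch_pow_inv[OF assms(1) r_less_1] by blast
  define i where "i = (LEAST n. r ^ n < y)"
  have i: "r ^ i < y" unfolding i_def using n by (rule LeastI)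
  have "i \<noteq> 0" using i assms(2) by (metis power_0 less_asym)
  then obtain e where e: "i = Suc e" by (cases i) auto
  have "\<not> r ^ e < y" using not_less_Least[of e "\<lambda>n. r ^ n < y"] unfolding i_def[symmetric] e by simp
  moreover have "y \<noteq> r ^ e" using assms(3) unfolding sing_iff by auto
  ultimately show ?thesis using that i e by force
qed

lemma local_structure:
  assumes "p \<in> Pbar" "p \<notin> sing"
  shows "\<exists>p' \<nu> \<epsilon>. 0 < \<epsilon> \<and> edge_pair p p' \<nu> \<epsilon>"
proof -
  obtain x y where p: "p = pt x y" by (rule pt_cases)
  have "\<not> (x = Sinf \<and> y = 0)" using assms(2) unfolding p sing_iff by blast
  then obtain e where e: "S e \<le> x" "x \<le> S (Suc e)" "0 \<le> y" "y \<le> r ^ e"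
    using assms(1) unfolding p Pbar_iff by blast
  have n: "y \<noteq> 0 \<and> y \<noteq> r ^ e" if "x = S e \<or> x = S (Suc e)"
    using assms(2) that unfolding p sing_iff by blast
  have n': "y \<noteq> r ^ Suc e" if "x = S (Suc e)"
    using assms(2) that unfolding p sing_iff by blast
  consider (m) "S e < x" "x < S (Suc e)" | (l) "x = S e" | (r) "x = S (Suc e)" using e by linarith
  then show ?thesis
  proof cases
    case m
    consider "y = 0" | "y = r ^ e" | "0 < y" "y < r ^ e" using e by linarith
    then show ?thesis
      using edge_pair_horizontal[OF m] edge_pair_square[OF m, of y] edge_pair_swap[of "pt x 0" "pt x (r ^ e)"]
      unfolding p by cases blast+
  next
    case l
    have y: "0 < y" "y < r ^ e" using n e l by auto
    show ?thesis
    proof (cases e)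
      case 0
      then obtain i where "r ^ Suc i < y" "y < r ^ i"
        using left_edge_cases[of y] y assms(2) l unfolding p by auto
      then show ?thesis using edge_pair_vertical[of i y] 0 l unfolding p by auto
    next
      case (Suc i)
      then show ?thesis using edge_pair_shared[of y i] y l unfolding p by auto
    qed
  next
    case r
    have y: "0 < y" "y < r ^ e" using n e r by auto
    show ?thesis
    proof (cases "y < r ^ Suc e")
      case True
      then show ?thesis using edge_pair_shared[of y e] y r unfolding p by auto
    next
      case False
      then have "r ^ Suc e < y" using n' r by auto
      then show ?thesis
        using edge_pair_vertical[of e y] y r edge_pair_swap[of "pt 0 y" "pt x y"] unfolding p by blast
    qed
  qed
qed

text \<open>A substitute for a manifold chart: for short \<open>v\<close> the end class of the
  displacement \<open>v\<close> exists and is regular, does not depend on the representative, is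
  joined to the centre by a segment, and has no representatives other than translates by the same
  \<open>v\<close>.\<close>

definition chart :: "real^2 \<Rightarrow> real \<Rightarrow> bool" where
  "chart p \<epsilon> \<longleftrightarrow> finite (cls p) \<and> (\<forall>v. norm v < \<epsilon> \<longrightarrow>
     (\<exists>x\<in>cls p. x + v \<in> Pbar) \<and>
     (\<forall>x\<in>cls p. x + v \<in> Pbar \<longrightarrow> x + v \<notin> sing \<and> (\<forall>s\<in>{0..1}. x + s *\<^sub>R v \<in> Pbar) \<and>
        (\<forall>y\<in>cls p. y + v \<in> Pbar \<longrightarrow> key (y + v) = key (x + v)) \<and>
        (\<forall>z. key z = key (x + v) \<longrightarrow> (\<exists>x'\<in>cls p. z = x' + v))))"

lemma chart_exists:
  assumes "p \<in> Pbar" "p \<notin> sing"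
  shows "\<exists>\<epsilon>>0. chart p \<epsilon>"
proof -
  obtain p' \<nu> \<epsilon> where \<epsilon>: "0 < \<epsilon>" and ep: "edge_pair p p' \<nu> \<epsilon>"
    using local_structure[OF assms] by blast
  have at: "edge_at p p' \<nu> v" if "norm v < \<epsilon>" for v
    using ep that unfolding edge_pair_def by blast
  have cp: "cls p = {p, p'}"
    using at[of 0] \<epsilon> unfolding edge_at_def by (auto simp: cls_eq)
  have "chart p \<epsilon>"
    unfolding chart_def cp
  proof (intro conjI allI impI)
    fix v :: "real^2" assume "norm v < \<epsilon>"
    note av = at[OF this]
    show "\<exists>x\<in>{p, p'}. x + v \<in> Pbar"
      using av linear[of 0 "\<nu> \<bullet> v"] unfolding edge_at_def by auto
    have sv: "edge_at p p' \<nu> (s *\<^sub>R v)" if "s \<in> {0..1}" for s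
      using that mult_left_le_one_le[of "norm v" s] \<open>norm v < \<epsilon>\<close> by (intro at) auto
    have s1: "x + s *\<^sub>R v \<in> Pbar" if "x \<in> {p, p'}" "x + v \<in> Pbar" "s \<in> {0..1}" for x s
    proof -
      have "0 \<le> \<nu> \<bullet> v \<Longrightarrow> 0 \<le> \<nu> \<bullet> (s *\<^sub>R v)" "\<nu> \<bullet> v \<le> 0 \<Longrightarrow> \<nu> \<bullet> (s *\<^sub>R v) \<le> 0"
        using that(3) by (simp_all add: mult_nonneg_nonneg mult_nonneg_nonpos)
      moreover have "x = p \<or> x = p'" using that(1) by simp
      ultimately show ?thesis using that(2) av sv[OF that(3)] unfolding edge_at_def by blast
    qed
    have n: "x + v \<notin> sing" if "x \<in> {p, p'}" "x + v \<in> Pbar" for x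
      using that av unfolding edge_at_def by auto
    have u: "key (y + v) = key (x + v)" if "x \<in> {p, p'}" "x + v \<in> Pbar" "y \<in> {p, p'}" "y + v \<in> Pbar" for x y
    proof -
      have "key (p + v) = key (p' + v)" if "p + v \<in> Pbar" "p' + v \<in> Pbar"
        using av that antisym[of 0 "\<nu> \<bullet> v"] unfolding edge_at_def by simp
      then show ?thesis using that by auto
    qed
    have z: "\<exists>x'\<in>{p, p'}. z = x' + v" if "x \<in> {p, p'}" "x + v \<in> Pbar" "key z = key (x + v)" for x z
      using that av unfolding edge_at_def by auto
    show "\<forall>x\<in>{p, p'}. x + v \<in> Pbar \<longrightarrow> x + v \<notin> sing \<and> (\<forall>s\<in>{0..1}. x + s *\<^sub>R v \<in> Pbar) \<and>
        (\<forall>y\<in>{p, p'}. y + v \<in> Pbar \<longrightarrow> key (y + v) = key (x + v)) \<and>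
        (\<forall>z. key z = key (x + v) \<longrightarrow> (\<exists>x'\<in>{p, p'}. z = x' + v))"
      using s1 n u z by blast
  qed simp
  then show ?thesis using \<epsilon> by blast
qed

subsection \<open>Straight steps and straight paths\<close>


text \<open>A trajectory of a single polygonal piece. The case \<open>v = 0\<close> is allowed and
  says that the class is regular.\<close>

definition hop :: "(real^2) set \<Rightarrow> real^2 \<Rightarrow> (real^2) set \<Rightarrow> bool" where
  "hop a v b \<longleftrightarrow> (\<exists>x. a = cls x \<and> b = cls (x + v) \<and> (\<forall>s\<in>{0..1}. x + s *\<^sub>R v \<in> Pbar - sing))"

lemma hopI: "(\<And>s. 0 \<le> s \<Longrightarrow> s \<le> 1 \<Longrightarrow> x + s *\<^sub>R v \<in> Pbar - sing) \<Longrightarrow> hop (cls x) v (cls (x + v))"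
  unfolding hop_def by auto

lemma hop_start:
  assumes "hop a v b"
  shows "\<exists>x. a = cls x \<and> x \<in> Pbar - sing"
proof -
  obtain x where x: "a = cls x" "\<forall>s\<in>{0..1}. x + s *\<^sub>R v \<in> Pbar - sing"
    using assms unfolding hop_def by blast
  from x(2)[rule_format, of 0] show ?thesis using x(1) by auto
qed

lemma hop_sub:
  assumes "\<forall>s\<in>{0..1}. x + s *\<^sub>R v \<in> Pbar - sing" "0 \<le> s" "s \<le> 1"
  shows "hop (cls x) (s *\<^sub>R v) (cls (x + s *\<^sub>R v))"
proof (rule hopI)
  fix s' :: real assume "0 \<le> s'" "s' \<le> 1"
  then have "s' * s \<in> {0..1}" using assms by (auto intro: mult_le_one)
  from assms(1)[rule_format, OF this] show "x + s' *\<^sub>R s *\<^sub>R v \<in> Pbar - sing" by simp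
qed

lemma chart_D:
  assumes "chart p \<epsilon>" "norm v < \<epsilon>"
  shows "\<exists>x\<in>cls p. x + v \<in> Pbar"
    "x \<in> cls p \<Longrightarrow> x + v \<in> Pbar \<Longrightarrow> x + v \<notin> sing"
    "x \<in> cls p \<Longrightarrow> x + v \<in> Pbar \<Longrightarrow> s \<in> {0..1} \<Longrightarrow> x + s *\<^sub>R v \<in> Pbar"
    "x \<in> cls p \<Longrightarrow> x + v \<in> Pbar \<Longrightarrow> y \<in> cls p \<Longrightarrow> y + v \<in> Pbar \<Longrightarrow> key (y + v) = key (x + v)"
    "x \<in> cls p \<Longrightarrow> x + v \<in> Pbar \<Longrightarrow> key z = key (x + v) \<Longrightarrow> \<exists>x'\<in>cls p. z = x' + v"
  using assms unfolding chart_def by blast+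

lemma norm_scale_less: "norm (v::real^2) < \<epsilon> \<Longrightarrow> 0 \<le> s \<Longrightarrow> s \<le> 1 \<Longrightarrow> norm (s *\<^sub>R v) < \<epsilon>"
  using mult_left_le_one_le[of "norm v" s] by simp

lemma hop_in_chart:
  assumes "chart p \<epsilon>" "norm v < \<epsilon>" "x \<in> cls p" "x + v \<in> Pbar"
  shows "hop (cls p) v (cls (x + v))"
proof -
  have "cls p = cls x" using assms(3) by (simp add: cls_eq_iff mem_cls)
  moreover have "x + s *\<^sub>R v \<in> Pbar - sing" if "0 \<le> s" "s \<le> 1" for s
    using chart_D(3)[OF assms(1,2,3,4), of s] chart_D(2)[OF assms(1) norm_scale_less[OF assms(2) that] assms(3)] that
    by auto
  ultimately show ?thesis using hopI[of x v] by simp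
qed

lemma hop_unique:
  assumes "chart p \<epsilon>" "norm v < \<epsilon>" "hop (cls p) v b" "hop (cls p) v b'"
  shows "b = b'"
proof -
  have *: "\<exists>x\<in>cls p. x + v \<in> Pbar \<and> b = cls (x + v)" if "hop (cls p) v b" for b
  proof -
    from that obtain x where x: "cls p = cls x" "b = cls (x + v)" "\<forall>s\<in>{0..1}. x + s *\<^sub>R v \<in> Pbar - sing"
      unfolding hop_def by blast
    from x(3)[rule_format, of 1] x(1,2) show ?thesis by (auto simp: mem_cls)
  qed
  from *[OF assms(3)] *[OF assms(4)] obtain x y where "x \<in> cls p" "x + v \<in> Pbar" "b = cls (x + v)"
    "y \<in> cls p" "y + v \<in> Pbar" "b' = cls (y + v)" by blast
  with chart_D(4)[OF assms(1,2), of x y] show ?thesis by (simp add: cls_eq_iff)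
qed

text \<open>The backward counterpart of \<open>hop_unique\<close>. Both directions are needed to see
  that agreement of two paths is an open and closed condition.\<close>

lemma hop_start_unique:
  assumes "chart p \<epsilon>" "norm v < \<epsilon>" "hop (cls p) v b" "hop a' v b"
  shows "a' = cls p"
proof -
  obtain x where x: "cls p = cls x" "b = cls (x + v)" "\<forall>s\<in>{0..1}. x + s *\<^sub>R v \<in> Pbar - sing"
    using assms(3) unfolding hop_def by blast
  then have x': "x \<in> cls p" "x + v \<in> Pbar" using x(3)[rule_format, of 1] by (auto simp: mem_cls)
  obtain y where y: "a' = cls y" "b = cls (y + v)" using assms(4) unfolding hop_def by blast
  have "key (y + v) = key (x + v)" using x(2) y(2) by (simp add: cls_eq_iff)
  then obtain x'' where "x'' \<in> cls p" "y + v = x'' + v" using chart_D(5)[OF assms(1,2) x'] by blast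
  then show ?thesis using y(1) by (simp add: mem_cls cls_eq_iff)
qed

lemma hop_sflow:
  assumes "hop a v b"
  shows "sflow r a v b"
proof -
  obtain x where x: "a = cls x" "b = cls (x + v)" "\<forall>s\<in>{0..1}. x + s *\<^sub>R v \<in> Pbar - sing"
    using assms unfolding hop_def by blast
  have "lchain r (\<lambda>t. cls (x + t *\<^sub>R v)) v 0 1"
    unfolding lchain_def arm_sing_eq
    by (rule exI[of _ 1], rule exI[of _ real], rule exI[of _ "\<lambda>_. x"]) (use x(3) in auto)
  then show ?thesis unfolding sflow_def
    by (intro exI[of _ "\<lambda>t. cls (x + t *\<^sub>R v)"]) (simp add: x)
qed

text \<open>At each gluing between two pieces the point is replaced by another representative of its
  class, and in a chart every such representative is again a translate of one in
  \<open>cls p\<close>. Hence all pieces can be traced from the centre, and the last one is a single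
  segment.\<close>

lemma sflow_hop:
  assumes "chart p \<epsilon>" "norm v < \<epsilon>" "sflow r (cls p) v b"
  shows "hop (cls p) v b"
proof -
  obtain c n ts xs where c: "c 0 = cls p" "c 1 = b" and n: "0 < n" "ts 0 = 0" "ts n = (1::real)"
    "\<forall>i<n. ts i < ts (Suc i)"
    and xs: "\<forall>i<n. \<forall>t\<in>{ts i..ts (Suc i)}. xs i + (t - ts i) *\<^sub>R v \<in> Pbar - sing \<and>
        c t = cls (xs i + (t - ts i) *\<^sub>R v)"
    using assms(3) unfolding sflow_def lchain_def arm_sing_eq by blast
  have mono: "ts i \<le> ts j" if "i \<le> j" "j \<le> n" for i j
    using that
  proof (induction rule: dec_induct)
    case (step m)
    then show ?case using n(4)[rule_format, of m] by simp
  qed simp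
  have "\<exists>x\<in>cls p. x + ts i *\<^sub>R v \<in> Pbar \<and> c (ts i) = cls (x + ts i *\<^sub>R v)" if "i \<le> n" for i
    using that
  proof (induction i)
    case 0
    have "xs 0 \<in> Pbar" "c 0 = cls (xs 0)"
      using xs[rule_format, of 0 0] n(1) n(4)[rule_format, of 0] n(2) by simp_all
    then have "p \<in> Pbar" using c(1) by (metis cls_in_X_iff)
    then show ?case using c(1) n(2) by (auto simp: mem_cls)
  next
    case (Suc i)
    then obtain x where x: "x \<in> cls p" "x + ts i *\<^sub>R v \<in> Pbar" "c (ts i) = cls (x + ts i *\<^sub>R v)" by auto
    have i: "i < n" "ts i < ts (Suc i)" using Suc.prems n(4) by auto
    have "0 \<le> ts i" "ts i \<le> 1" using mono[of 0 i] mono[of i n] i n by simp_all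
    then have small: "norm (ts i *\<^sub>R v) < \<epsilon>" using norm_scale_less[OF assms(2)] by blast
    have "c (ts i) = cls (xs i)" using xs[rule_format, OF i(1), of "ts i"] i(2) by simp
    then have "key (xs i) = key (x + ts i *\<^sub>R v)" using x(3) by (simp add: cls_eq_iff)
    then obtain x' where x': "x' \<in> cls p" "xs i = x' + ts i *\<^sub>R v"
      using chart_D(5)[OF assms(1) small x(1,2)] by blast
    have "xs i + (ts (Suc i) - ts i) *\<^sub>R v = x' + ts (Suc i) *\<^sub>R v"
      using x'(2) by (simp add: algebra_simps)
    then have "x' + ts (Suc i) *\<^sub>R v \<in> Pbar \<and> c (ts (Suc i)) = cls (x' + ts (Suc i) *\<^sub>R v)"
      using xs[rule_format, OF i(1), of "ts (Suc i)"] i(2) by simp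
    then show ?case using x'(1) by blast
  qed
  from this[of n] obtain x where "x \<in> cls p" "x + v \<in> Pbar" "b = cls (x + v)"
    using n(3) c(2) by auto
  then show ?thesis using hop_in_chart[OF assms(1,2)] by simp
qed

section \<open>Locally straight paths and developing maps\<close>

text \<open>The local form of \<open>lchain\<close>. It makes sense on open parameter sets, is
  inherited by images under affine maps and suits connectedness arguments.\<close>

definition cpath :: "(real \<Rightarrow> (real^2) set) \<Rightarrow> real^2 \<Rightarrow> real set \<Rightarrow> bool" where
  "cpath c w I \<longleftrightarrow> (\<forall>t\<in>I. \<exists>\<epsilon>>0. \<forall>\<sigma>. \<bar>\<sigma>\<bar> < \<epsilon> \<and> t + \<sigma> \<in> I \<longrightarrow> hop (c t) (\<sigma> *\<^sub>R w) (c (t + \<sigma>)))"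

lemma cpath_subset: "cpath c w I \<Longrightarrow> J \<subseteq> I \<Longrightarrow> cpath c w J"
  unfolding cpath_def by blast

lemma cpath_start:
  assumes "cpath c w I" "t \<in> I"
  obtains x where "c t = cls x" "x \<in> Pbar" "x \<notin> sing"
proof -
  obtain \<epsilon> where "0 < \<epsilon>" "\<forall>\<sigma>. \<bar>\<sigma>\<bar> < \<epsilon> \<and> t + \<sigma> \<in> I \<longrightarrow> hop (c t) (\<sigma> *\<^sub>R w) (c (t + \<sigma>))"
    using assms unfolding cpath_def by blast
  then have "hop (c t) (0 *\<^sub>R w) (c (t + 0))" using assms(2) by (metis abs_zero add.right_neutral)
  then show ?thesis using hop_start that by blast
qed

lemma small_scale:
  assumes "0 < (\<epsilon>::real)"
  shows "\<exists>\<delta>>0. \<forall>\<sigma>. \<bar>\<sigma>\<bar> < \<delta> \<longrightarrow> norm (\<sigma> *\<^sub>R (w::real^2)) < \<epsilon>"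
proof (intro exI[of _ "\<epsilon> / (norm w + 1)"] conjI allI impI)
  have *: "0 < norm w + 1" using norm_ge_zero[of w] by linarith
  then show "0 < \<epsilon> / (norm w + 1)" using assms by simp
  fix \<sigma> :: real assume "\<bar>\<sigma>\<bar> < \<epsilon> / (norm w + 1)"
  then have "\<bar>\<sigma>\<bar> * (norm w + 1) < \<epsilon>" using * by (simp add: pos_less_divide_eq)
  then show "norm (\<sigma> *\<^sub>R w) < \<epsilon>" by (simp add: algebra_simps)
qed

lemma cpath_nhd:
  assumes "cpath c w I" "t \<in> I"
  obtains p \<epsilon> where "c t = cls p" "p \<in> Pbar" "p \<notin> sing" "0 < \<epsilon>"
    "\<And>\<sigma>. \<bar>\<sigma>\<bar> < \<epsilon> \<Longrightarrow> t + \<sigma> \<in> I \<Longrightarrow> hop (c t) (\<sigma> *\<^sub>R w) (c (t + \<sigma>))"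
    "\<And>\<sigma> b. \<bar>\<sigma>\<bar> < \<epsilon> \<Longrightarrow> t + \<sigma> \<in> I \<Longrightarrow> hop (c t) (\<sigma> *\<^sub>R w) b \<Longrightarrow> b = c (t + \<sigma>)"
    "\<And>\<sigma> a. \<bar>\<sigma>\<bar> < \<epsilon> \<Longrightarrow> t + \<sigma> \<in> I \<Longrightarrow> hop a (\<sigma> *\<^sub>R w) (c (t + \<sigma>)) \<Longrightarrow> a = c t"
proof -
  obtain p where p: "c t = cls p" "p \<in> Pbar" "p \<notin> sing" using cpath_start[OF assms] .
  obtain \<epsilon>1 where \<epsilon>1: "0 < \<epsilon>1" "\<And>\<sigma>. \<bar>\<sigma>\<bar> < \<epsilon>1 \<Longrightarrow> t + \<sigma> \<in> I \<Longrightarrow> hop (c t) (\<sigma> *\<^sub>R w) (c (t + \<sigma>))"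
    using assms unfolding cpath_def by blast
  obtain \<epsilon>2 where \<epsilon>2: "0 < \<epsilon>2" "chart p \<epsilon>2" using chart_exists p by blast
  obtain \<delta> where \<delta>: "0 < \<delta>" "\<forall>\<sigma>. \<bar>\<sigma>\<bar> < \<delta> \<longrightarrow> norm (\<sigma> *\<^sub>R w) < \<epsilon>2" using small_scale[OF \<epsilon>2(1)] by blast
  show ?thesis
  proof (rule that[of p "min \<epsilon>1 \<delta>"])
    show "0 < min \<epsilon>1 \<delta>" using \<epsilon>1 \<delta> by simp
    fix \<sigma> assume \<sigma>: "\<bar>\<sigma>\<bar> < min \<epsilon>1 \<delta>" "t + \<sigma> \<in> I"
    then show h: "hop (c t) (\<sigma> *\<^sub>R w) (c (t + \<sigma>))" using \<epsilon>1(2) by simp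
    have n: "norm (\<sigma> *\<^sub>R w) < \<epsilon>2" using \<delta>(2) \<sigma>(1) by auto
    show "hop (c t) (\<sigma> *\<^sub>R w) b \<Longrightarrow> b = c (t + \<sigma>)" for b
      using hop_unique[OF \<epsilon>2(2) n] h unfolding p(1) by blast
    show "hop a (\<sigma> *\<^sub>R w) (c (t + \<sigma>)) \<Longrightarrow> a = c t" for a
      using hop_start_unique[OF \<epsilon>2(2) n] h unfolding p(1) by blast
  qed (use p in auto)
qed

text \<open>Agreement is locally constant: forward uniqueness of hops carries it from a parameter to
  its neighbours, backward uniqueness from the neighbours to the parameter.\<close>

lemma cpath_unique:
  assumes "cpath c w I" "cpath c' w I" "connected I" "t0 \<in> I" "c t0 = c' t0" "t \<in> I"
  shows "c t = c' t"
proof -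
  have "\<forall>a\<in>I. eventually (\<lambda>b. (c a = c' a) = (c b = c' b)) (at a within I)"
  proof
    fix a assume a: "a \<in> I"
    show "eventually (\<lambda>b. (c a = c' a) = (c b = c' b)) (at a within I)"
    proof (rule cpath_nhd[OF assms(1) a], rule cpath_nhd[OF assms(2) a])
      fix p \<epsilon> p' \<epsilon>' 
      assume 1: "0 < \<epsilon>" "\<And>\<sigma>. \<bar>\<sigma>\<bar> < \<epsilon> \<Longrightarrow> a + \<sigma> \<in> I \<Longrightarrow> hop (c a) (\<sigma> *\<^sub>R w) (c (a + \<sigma>))"
        "\<And>\<sigma> b. \<bar>\<sigma>\<bar> < \<epsilon> \<Longrightarrow> a + \<sigma> \<in> I \<Longrightarrow> hop (c a) (\<sigma> *\<^sub>R w) b \<Longrightarrow> b = c (a + \<sigma>)"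
        "\<And>\<sigma> b. \<bar>\<sigma>\<bar> < \<epsilon> \<Longrightarrow> a + \<sigma> \<in> I \<Longrightarrow> hop b (\<sigma> *\<^sub>R w) (c (a + \<sigma>)) \<Longrightarrow> b = c a"
      assume 2: "0 < \<epsilon>'" "\<And>\<sigma>. \<bar>\<sigma>\<bar> < \<epsilon>' \<Longrightarrow> a + \<sigma> \<in> I \<Longrightarrow> hop (c' a) (\<sigma> *\<^sub>R w) (c' (a + \<sigma>))"
      show ?thesis
        unfolding eventually_at
      proof (intro exI[of _ "min \<epsilon> \<epsilon>'"] conjI ballI impI)
        fix b assume b: "b \<in> I" "b \<noteq> a \<and> dist b a < min \<epsilon> \<epsilon>'"
        define \<sigma> where "\<sigma> = b - a"
        have s: "\<bar>\<sigma>\<bar> < \<epsilon>" "\<bar>\<sigma>\<bar> < \<epsilon>'" "a + \<sigma> \<in> I" "b = a + \<sigma>" using b unfolding \<sigma>_def by (auto simp: dist_real_def)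
        show "(c a = c' a) = (c b = c' b)"
          unfolding s(4) using 1(3,4)[OF s(1,3)] 2(2)[OF s(2,3)] by metis
      qed (use 1 2 in simp)
    qed
  qed
  from connected_local_const[OF assms(3,4,6) this] show ?thesis using assms(5) by simp
qed

lemma lchain_trans:
  assumes "lchain r c w a b" "lchain r c w b d"
  shows "lchain r c w a d"
proof -
  obtain n1 ts1 xs1 where 1: "0 < n1" "ts1 0 = a" "ts1 n1 = b" "\<forall>i<n1. ts1 i < ts1 (Suc i)"
      "\<forall>i<n1. \<forall>t\<in>{ts1 i..ts1 (Suc i)}. xs1 i + (t - ts1 i) *\<^sub>R w \<in> Pbar - arm_sing r \<and> c t = cls (xs1 i + (t - ts1 i) *\<^sub>R w)"
    using assms(1) unfolding lchain_def by blast
  obtain n2 ts2 xs2 where 2: "0 < n2" "ts2 0 = b" "ts2 n2 = d" "\<forall>i<n2. ts2 i < ts2 (Suc i)"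
      "\<forall>i<n2. \<forall>t\<in>{ts2 i..ts2 (Suc i)}. xs2 i + (t - ts2 i) *\<^sub>R w \<in> Pbar - arm_sing r \<and> c t = cls (xs2 i + (t - ts2 i) *\<^sub>R w)"
    using assms(2) unfolding lchain_def by blast
  define ts where "ts i = (if i < n1 then ts1 i else ts2 (i - n1))" for i
  define xs where "xs i = (if i < n1 then xs1 i else xs2 (i - n1))" for i
  have A: "ts i = ts1 i \<and> ts (Suc i) = ts1 (Suc i) \<and> xs i = xs1 i" if "i < n1" for i
    using that 1(3) 2(2) unfolding ts_def xs_def by (cases "Suc i = n1") auto
  have B: "ts i = ts2 (i - n1) \<and> ts (Suc i) = ts2 (Suc (i - n1)) \<and> xs i = xs2 (i - n1) \<and> i - n1 < n2"
    if "i < n1 + n2" "\<not> i < n1" for i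
    using that unfolding ts_def xs_def by (auto simp: Suc_diff_le)
  show ?thesis
    unfolding lchain_def
  proof (intro exI[of _ "n1 + n2"] exI[of _ ts] exI[of _ xs] conjI allI impI)
    show "0 < n1 + n2" using 1 by simp
    show "ts 0 = a" "ts (n1 + n2) = d" using 1 2 unfolding ts_def by simp_all
    fix i assume i: "i < n1 + n2"
    show "ts i < ts (Suc i)"
      using A[of i] B[of i] i 1(4) 2(4) by (cases "i < n1") auto
    show "\<forall>t\<in>{ts i..ts (Suc i)}. xs i + (t - ts i) *\<^sub>R w \<in> Pbar - arm_sing r \<and> c t = cls (xs i + (t - ts i) *\<^sub>R w)"
      using A[of i] B[of i] i 1(5) 2(5) by (cases "i < n1") auto
  qed
qed

lemma lchain_straight:
  assumes "a < b" "\<And>t. a \<le> t \<Longrightarrow> t \<le> b \<Longrightarrow> x + (t - a) *\<^sub>R w \<in> Pbar - sing \<and> c t = cls (x + (t - a) *\<^sub>R w)"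
  shows "lchain r c w a b"
  unfolding lchain_def arm_sing_eq
  by (rule exI[of _ 1], rule exI[of _ "\<lambda>i. if i = 0 then a else b"], rule exI[of _ "\<lambda>_. x"])
    (use assms in auto)

lemma cpath_local_lchain:
  assumes "cpath c w I" "connected I" "t \<in> I"
  shows "\<exists>d>0. \<forall>\<sigma>. \<bar>\<sigma>\<bar> < d \<and> t + \<sigma> \<in> I \<longrightarrow>
    (0 < \<sigma> \<longrightarrow> lchain r c w t (t + \<sigma>)) \<and> (\<sigma> < 0 \<longrightarrow> lchain r c w (t + \<sigma>) t)"
proof (rule cpath_nhd[OF assms(1,3)])
  fix p \<epsilon>
  assume \<epsilon>: "0 < \<epsilon>" "\<And>\<sigma>. \<bar>\<sigma>\<bar> < \<epsilon> \<Longrightarrow> t + \<sigma> \<in> I \<Longrightarrow> hop (c t) (\<sigma> *\<^sub>R w) (c (t + \<sigma>))"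
    "\<And>\<sigma> b. \<bar>\<sigma>\<bar> < \<epsilon> \<Longrightarrow> t + \<sigma> \<in> I \<Longrightarrow> hop (c t) (\<sigma> *\<^sub>R w) b \<Longrightarrow> b = c (t + \<sigma>)"
  show ?thesis
  proof (intro exI[of _ \<epsilon>] conjI allI impI)
    fix \<sigma> assume \<sigma>: "\<bar>\<sigma>\<bar> < \<epsilon> \<and> t + \<sigma> \<in> I"
    obtain x where x: "c t = cls x" "\<forall>s\<in>{0..1}. x + s *\<^sub>R \<sigma> *\<^sub>R w \<in> Pbar - sing"
      using \<epsilon>(2)[of \<sigma>] \<sigma> unfolding hop_def by blast
    \<comment> \<open>The hop over the full parameter difference is cut at the fraction
      \<open>\<tau> / \<sigma>\<close>; uniqueness of short hops shows that the cut point is on the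
      path \<open>c\<close>.\<close>
    have *: "x + \<tau> *\<^sub>R w \<in> Pbar - sing \<and> c (t + \<tau>) = cls (x + \<tau> *\<^sub>R w)"
      if "0 \<le> \<tau> \<and> \<tau> \<le> \<sigma> \<or> \<sigma> \<le> \<tau> \<and> \<tau> \<le> 0" "\<sigma> \<noteq> 0" for \<tau>
    proof -
      have s: "\<tau> / \<sigma> \<in> {0..1}" "(\<tau> / \<sigma>) *\<^sub>R \<sigma> *\<^sub>R w = \<tau> *\<^sub>R w"
        using that by (auto simp: divide_simps)
      have "hop (c t) (\<tau> *\<^sub>R w) (cls (x + \<tau> *\<^sub>R w))"
        using hop_sub[OF x(2), of "\<tau> / \<sigma>"] s(1) x(1) unfolding s(2) by simp
      moreover have "\<bar>\<tau>\<bar> < \<epsilon>" using \<sigma> that by auto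
      moreover have "t + \<tau> \<in> I"
        using assms(2,3) \<sigma> that(1) connectedD_interval[of I "t" "t + \<sigma>" "t + \<tau>"]
          connectedD_interval[of I "t + \<sigma>" t "t + \<tau>"] by auto
      ultimately have "c (t + \<tau>) = cls (x + \<tau> *\<^sub>R w)" using \<epsilon>(3) by metis
      then show ?thesis using x(2)[rule_format, OF s(1)] unfolding s(2) by simp
    qed
    show "lchain r c w t (t + \<sigma>)" if "0 < \<sigma>"
      by (rule lchain_straight[of _ _ x]) (use that *[of "s - t" for s] in auto)
    show "lchain r c w (t + \<sigma>) t" if "\<sigma> < 0"
    proof (rule lchain_straight[of _ _ "x + \<sigma> *\<^sub>R w"])
      fix s assume "t + \<sigma> \<le> s" "s \<le> t"
      have e: "x + \<sigma> *\<^sub>R w + (s - (t + \<sigma>)) *\<^sub>R w = x + (s - t) *\<^sub>R w" by (simp add: algebra_simps)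
      show "x + \<sigma> *\<^sub>R w + (s - (t + \<sigma>)) *\<^sub>R w \<in> Pbar - sing \<and> c s = cls (x + \<sigma> *\<^sub>R w + (s - (t + \<sigma>)) *\<^sub>R w)"
        unfolding e using *[of "s - t"] that \<open>t + \<sigma> \<le> s\<close> \<open>s \<le> t\<close> by simp
    qed (use that in simp)
  qed (rule \<epsilon>)
qed

text \<open>Bisection of the compact parameter interval replaces a covering argument: short
  intervals around a point are chains by \<open>cpath_local_lchain\<close>, and chains can be
  concatenated.\<close>

lemma cpath_lchain:
  assumes "cpath c w {a..b}" "a < b"
  shows "lchain r c w a b"
proof -
  let ?P = "\<lambda>x y. a \<le> x \<and> y \<le> b \<and> x < y \<longrightarrow> lchain r c w x y"
  have "?P a b"
  proof (rule Bolzano[of a b ?P])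
    show "a \<le> b" using assms by simp
    show "?P x z" if "?P x y" "?P y z" "x \<le> y" "y \<le> z" for x y z
      using that lchain_trans[of c w x y z] by (cases "x = y"; cases "y = z") auto
    fix t assume t: "a \<le> t" "t \<le> b"
    then obtain d where d: "d > 0" "\<And>\<sigma>. \<bar>\<sigma>\<bar> < d \<Longrightarrow> t + \<sigma> \<in> {a..b} \<Longrightarrow>
       (0 < \<sigma> \<longrightarrow> lchain r c w t (t + \<sigma>)) \<and> (\<sigma> < 0 \<longrightarrow> lchain r c w (t + \<sigma>) t)"
      using cpath_local_lchain[OF assms(1), of t] by auto
    show "\<exists>d>0. \<forall>x y. x \<le> t \<and> t \<le> y \<and> y - x < d \<longrightarrow> ?P x y"
    proof (intro exI[of _ d] conjI allI impI)
      fix x y assume xy: "x \<le> t \<and> t \<le> y \<and> y - x < d" "a \<le> x \<and> y \<le> b \<and> x < y"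
      have "x < t \<Longrightarrow> lchain r c w x t" "t < y \<Longrightarrow> lchain r c w t y"
        using d(2)[of "x - t"] d(2)[of "y - t"] xy by auto
      then show "lchain r c w x y" using xy lchain_trans[of c w x t y] by (cases "x = t"; cases "y = t") auto
    qed (rule d)
  qed
  then show ?thesis using assms by simp
qed

text \<open>Locally \<open>D\<close> turns translations of the plane into straight steps on the
  surface. The set \<open>U\<close> need not be open, so boundary lines of strips are
  included.\<close>

definition devel :: "(real^2 \<Rightarrow> (real^2) set) \<Rightarrow> (real^2) set \<Rightarrow> bool" where
  "devel D U \<longleftrightarrow> (\<forall>z\<in>U. \<exists>\<epsilon>>0. \<forall>v. norm v < \<epsilon> \<and> z + v \<in> U \<longrightarrow> hop (D z) v (D (z + v)))"

lemma devel_path: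
  assumes "devel D U" "\<And>t. t \<in> I \<Longrightarrow> z + t *\<^sub>R w \<in> U"
  shows "cpath (\<lambda>t. D (z + t *\<^sub>R w)) w I"
  unfolding cpath_def
proof
  fix t assume t: "t \<in> I"
  obtain \<epsilon> where \<epsilon>: "0 < \<epsilon>" "\<And>v. norm v < \<epsilon> \<Longrightarrow> z + t *\<^sub>R w + v \<in> U \<Longrightarrow> hop (D (z + t *\<^sub>R w)) v (D (z + t *\<^sub>R w + v))"
    using assms(1) assms(2)[OF t] unfolding devel_def by blast
  obtain \<delta> where \<delta>: "0 < \<delta>" "\<forall>\<sigma>. \<bar>\<sigma>\<bar> < \<delta> \<longrightarrow> norm (\<sigma> *\<^sub>R w) < \<epsilon>" using small_scale[OF \<epsilon>(1)] by blast
  show "\<exists>\<epsilon>>0. \<forall>\<sigma>. \<bar>\<sigma>\<bar> < \<epsilon> \<and> t + \<sigma> \<in> I \<longrightarrow> hop (D (z + t *\<^sub>R w)) (\<sigma> *\<^sub>R w) (D (z + (t + \<sigma>) *\<^sub>R w))"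
  proof (intro exI[of _ \<delta>] conjI allI impI)
    fix \<sigma> assume \<sigma>: "\<bar>\<sigma>\<bar> < \<delta> \<and> t + \<sigma> \<in> I"
    have e: "z + (t + \<sigma>) *\<^sub>R w = z + t *\<^sub>R w + \<sigma> *\<^sub>R w" by (simp add: algebra_simps)
    show "hop (D (z + t *\<^sub>R w)) (\<sigma> *\<^sub>R w) (D (z + (t + \<sigma>) *\<^sub>R w))"
      unfolding e using \<sigma> \<delta>(2) assms(2)[of "t + \<sigma>"] by (intro \<epsilon>(2)) (auto simp: e)
  qed (rule \<delta>)
qed

lemma devel_in_X: "devel D U \<Longrightarrow> z \<in> U \<Longrightarrow> \<exists>p. D z = cls p \<and> p \<in> Pbar - sing"
  unfolding devel_def by (metis add.right_neutral hop_start norm_zero)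

text \<open>A point of the polygon close to \<open>y\<close> is reached from
  \<open>cls y = D z\<close> by a hop with some short \<open>v\<close>, and \<open>D (z + v)\<close>
  is reached by the same hop; uniqueness in the chart identifies the two.\<close>

lemma devel_image_open:
  assumes "devel D U" "open U"
  shows "surf_open r (D ` U)"
proof -
  have sub: "D ` U \<subseteq> arm_X r" using devel_in_X[OF assms(1)] cls_in_X_iff by fastforce
  have "openin (top_of_set Pbar) (\<Union> (D ` U))"
    unfolding openin_euclidean_subtopology_iff
  proof (intro conjI ballI)
    show "\<Union> (D ` U) \<subseteq> Pbar" using Union_sub_Pbar[OF sub] .
    fix y assume "y \<in> \<Union> (D ` U)"
    then have "cls y \<in> D ` U" using Union_mem[OF sub] by blast
    then obtain z where z: "z \<in> U" "cls y = D z" by auto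
    then have yP: "y \<in> Pbar" "y \<notin> sing" using devel_in_X[OF assms(1) z(1)]
      by (auto simp: cls_eq_iff dest: key_eq_Pbar key_eq_sing)
    obtain \<epsilon>1 where \<epsilon>1: "0 < \<epsilon>1" "chart y \<epsilon>1" using chart_exists[OF yP] by blast
    obtain \<epsilon>2 where \<epsilon>2: "0 < \<epsilon>2" "\<And>v. norm v < \<epsilon>2 \<Longrightarrow> z + v \<in> U \<Longrightarrow> hop (D z) v (D (z + v))"
      using assms(1) z(1) unfolding devel_def by blast
    obtain \<epsilon>3 where \<epsilon>3: "0 < \<epsilon>3" "ball z \<epsilon>3 \<subseteq> U" using assms(2) z(1) openE by blast
    show "\<exists>e>0. \<forall>x'\<in>Pbar. dist x' y < e \<longrightarrow> x' \<in> \<Union> (D ` U)"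
    proof (intro exI[of _ "min \<epsilon>1 (min \<epsilon>2 \<epsilon>3)"] conjI ballI impI)
      fix x' assume x': "x' \<in> Pbar" "dist x' y < min \<epsilon>1 (min \<epsilon>2 \<epsilon>3)"
      define v where "v = x' - y"
      have v: "norm v < \<epsilon>1" "norm v < \<epsilon>2" "norm v < \<epsilon>3" "x' = y + v"
        using x'(2) unfolding v_def by (auto simp: dist_norm)
      have zv: "z + v \<in> U" using v(3) \<epsilon>3(2) by (auto simp: dist_norm)
      have "hop (cls y) v (D (z + v))" using \<epsilon>2(2)[OF v(2) zv] z(2) by simp
      moreover have "hop (cls y) v (cls x')"
        unfolding v(4) using hop_in_chart[OF \<epsilon>1(2) v(1), of y] x'(1) v(4) by (simp add: mem_cls)
      ultimately have "cls x' = D (z + v)" using hop_unique[OF \<epsilon>1(2) v(1)] by blast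
      then have "cls x' \<in> D ` U" using zv by blast
      then show "x' \<in> \<Union> (D ` U)" using Union_mem[OF sub] by blast
    qed (use \<epsilon>1 \<epsilon>2 \<epsilon>3 in simp)
  qed
  then show ?thesis unfolding surf_open_def using sub by blast
qed

text \<open>A regular class outside the image has finitely many representatives, all at positive
  distance from \<open>K\<close>, and nearby classes consist of translates of them. At the singular
  class this reasoning has no chart to start from, so that class is required to belong to the
  image.\<close>

lemma surf_closed_image:
  assumes "closed K" "K \<subseteq> Pbar" "arm_sing r \<in> cls ` K"
  shows "surf_closed r (cls ` K)"
proof -
  have sub: "cls ` K \<subseteq> arm_X r" using assms(2) cls_in_X_iff by auto
  have "openin (top_of_set Pbar) (Pbar - \<Union> (cls ` K))"
    unfolding openin_euclidean_subtopology_iff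
  proof (intro conjI ballI)
    fix y assume y: "y \<in> Pbar - \<Union> (cls ` K)"
    then have yK: "cls y \<notin> cls ` K" using Union_mem[OF sub] by blast
    then have "y \<notin> sing" using assms(3) cls_sing_iff by metis
    then obtain \<epsilon> where \<epsilon>: "0 < \<epsilon>" "chart y \<epsilon>" using chart_exists y by blast
    have fin: "finite (cls y)" using \<epsilon>(2) unfolding chart_def by blast
    have "\<exists>e>0. \<forall>x'\<in>K. e \<le> dist x' x" if "x \<in> cls y" for x
    proof -
      have "x \<notin> K" using yK that by (metis cls_eq_iff image_eqI mem_cls)
      then have "open (- K)" "x \<in> - K" using assms(1) by auto
      then obtain e where "e > 0" "ball x e \<subseteq> - K" using openE by blast
      then show ?thesis by (intro exI[of _ e]) (force simp: dist_commute not_less[symmetric])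
    qed
    then obtain f where f: "\<And>x. x \<in> cls y \<Longrightarrow> f x > 0 \<and> (\<forall>x'\<in>K. f x \<le> dist x' x)" by metis
    have "\<exists>e>0. \<forall>x\<in>cls y. \<forall>x'\<in>K. e \<le> dist x' x"
    proof (intro exI[of _ "Min (f ` cls y)"] conjI ballI)
      have "y \<in> cls y" by (simp add: mem_cls)
      then show "0 < Min (f ` cls y)" using f fin by (subst Min_gr_iff) auto
      fix x x' assume "x \<in> cls y" "x' \<in> K"
      then show "Min (f ` cls y) \<le> dist x' x" using f fin by (meson Min_le finite_imageI imageI order_trans)
    qed
    then obtain e where e: "e > 0" "\<And>x x'. x \<in> cls y \<Longrightarrow> x' \<in> K \<Longrightarrow> e \<le> dist x' x" by blast
    show "\<exists>e>0. \<forall>x'\<in>Pbar. dist x' y < e \<longrightarrow> x' \<in> Pbar - \<Union> (cls ` K)"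
    proof (intro exI[of _ "min e \<epsilon>"] conjI ballI impI)
      fix x' assume x': "x' \<in> Pbar" "dist x' y < min e \<epsilon>"
      define v where "v = x' - y"
      have v: "norm v < \<epsilon>" "norm v < e" "x' = y + v" using x'(2) unfolding v_def by (auto simp: dist_norm)
      have "cls x' \<notin> cls ` K"
      proof
        assume "cls x' \<in> cls ` K"
        then obtain z where z: "z \<in> K" "key z = key (y + v)" unfolding v(3) by (auto simp: cls_eq_iff)
        then obtain x where "x \<in> cls y" "z = x + v"
          using chart_D(5)[OF \<epsilon>(2) v(1), of y z] x'(1) v(3) by (auto simp: mem_cls)
        then show False using e(2)[of x z] z(1) v(2) by (simp add: dist_norm)
      qed
      then show "x' \<in> Pbar - \<Union> (cls ` K)" using x'(1) Union_mem[OF sub] by blast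
    qed (use e \<epsilon> in simp)
  qed blast
  then have "closedin (top_of_set Pbar) (\<Union> (cls ` K))"
    using Union_sub_Pbar[OF sub] by (simp add: closedin_def)
  then show ?thesis unfolding surf_closed_def using sub by blast
qed

section \<open>Affine maps along straight paths\<close>

lemma Xo_iff: "a \<in> arm_Xo r \<longleftrightarrow> (\<exists>x. a = cls x \<and> x \<in> Pbar \<and> x \<notin> sing)"
  unfolding arm_Xo_def using cls_in_X_iff cls_sing_iff by (auto elim!: X_cases)

lemma cpath_in_Xo: "cpath c w I \<Longrightarrow> t \<in> I \<Longrightarrow> c t \<in> arm_Xo r"
  using cpath_start Xo_iff by metis

text \<open>The definition of an affine map only yields a flow chain between image points. Once the
  image displacement is short for the chart at the image, \<open>sflow_hop\<close> turns this chain
  into one hop.\<close>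

lemma affine_cpath:
  assumes "affine_diffeo r \<phi> A" "cpath c w I"
  shows "cpath (\<lambda>t. \<phi> (c t)) (A *v w) I"
  unfolding cpath_def
proof
  fix t assume t: "t \<in> I"
  have ct: "c t \<in> arm_Xo r" using cpath_in_Xo[OF assms(2) t] .
  then have "\<phi> (c t) \<in> arm_Xo r" using assms(1) unfolding affine_diffeo_def bij_betw_def by blast
  then obtain p where p: "\<phi> (c t) = cls p" "p \<in> Pbar" "p \<notin> sing" using Xo_iff by blast
  obtain \<epsilon>1 where \<epsilon>1: "0 < \<epsilon>1" "chart p \<epsilon>1" using chart_exists p by blast
  obtain \<delta>1 where \<delta>1: "0 < \<delta>1" "\<forall>\<sigma>. \<bar>\<sigma>\<bar> < \<delta>1 \<longrightarrow> norm (\<sigma> *\<^sub>R (A *v w)) < \<epsilon>1" using small_scale[OF \<epsilon>1(1)] by blast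
  obtain \<epsilon>2 where \<epsilon>2: "0 < \<epsilon>2" "\<forall>w q. norm w < \<epsilon>2 \<and> sflow r (c t) w q \<longrightarrow> sflow r (\<phi> (c t)) (A *v w) (\<phi> q)"
    using assms(1) ct unfolding affine_diffeo_def by blast
  obtain \<delta>2 where \<delta>2: "0 < \<delta>2" "\<forall>\<sigma>. \<bar>\<sigma>\<bar> < \<delta>2 \<longrightarrow> norm (\<sigma> *\<^sub>R w) < \<epsilon>2" using small_scale[OF \<epsilon>2(1)] by blast
  obtain \<delta>3 where \<delta>3: "0 < \<delta>3" "\<forall>\<sigma>. \<bar>\<sigma>\<bar> < \<delta>3 \<and> t + \<sigma> \<in> I \<longrightarrow> hop (c t) (\<sigma> *\<^sub>R w) (c (t + \<sigma>))"
    using assms(2) t unfolding cpath_def by blast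
  show "\<exists>\<epsilon>>0. \<forall>\<sigma>. \<bar>\<sigma>\<bar> < \<epsilon> \<and> t + \<sigma> \<in> I \<longrightarrow> hop (\<phi> (c t)) (\<sigma> *\<^sub>R (A *v w)) (\<phi> (c (t + \<sigma>)))"
  proof (intro exI[of _ "min \<delta>1 (min \<delta>2 \<delta>3)"] conjI allI impI)
    fix \<sigma> assume \<sigma>: "\<bar>\<sigma>\<bar> < min \<delta>1 (min \<delta>2 \<delta>3) \<and> t + \<sigma> \<in> I"
    then have "sflow r (c t) (\<sigma> *\<^sub>R w) (c (t + \<sigma>))" using \<delta>3(2) hop_sflow by simp
    then have "sflow r (\<phi> (c t)) (A *v (\<sigma> *\<^sub>R w)) (\<phi> (c (t + \<sigma>)))" using \<epsilon>2(2) \<delta>2(2) \<sigma> by simp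
    then show "hop (\<phi> (c t)) (\<sigma> *\<^sub>R (A *v w)) (\<phi> (c (t + \<sigma>)))"
      unfolding p(1) matrix_vector_mult_scaleR using sflow_hop[OF \<epsilon>1(2)] \<delta>1(2) \<sigma> by simp
  qed (use \<delta>1 \<delta>2 \<delta>3 in simp)
qed

lemma affine_diffeo_compose:
  assumes "affine_diffeo r \<phi> A" "affine_diffeo r \<psi> B"
  shows "affine_diffeo r (\<psi> \<circ> \<phi>) (B ** A)"
  unfolding affine_diffeo_def
proof (intro conjI ballI)
  show "det (B ** A) \<noteq> 0" using assms unfolding affine_diffeo_def by (simp add: det_mul)
  show "bij_betw (\<psi> \<circ> \<phi>) (arm_Xo r) (arm_Xo r)"
    using assms bij_betw_trans unfolding affine_diffeo_def by blast
  fix p assume p: "p \<in> arm_Xo r"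
  then have p': "\<phi> p \<in> arm_Xo r" using assms(1) unfolding affine_diffeo_def bij_betw_def by blast
  obtain e1 where e1: "e1 > 0" "\<forall>w q. norm w < e1 \<and> sflow r p w q \<longrightarrow> sflow r (\<phi> p) (A *v w) (\<phi> q)"
    using assms(1) p unfolding affine_diffeo_def by blast
  obtain e2 where e2: "e2 > 0" "\<forall>w q. norm w < e2 \<and> sflow r (\<phi> p) w q \<longrightarrow> sflow r (\<psi> (\<phi> p)) (B *v w) (\<psi> q)"
    using assms(2) p' unfolding affine_diffeo_def by blast
  obtain K where K: "0 < K" "\<And>w. norm (A *v w) \<le> norm w * K"
    using bounded_linear.pos_bounded[OF matrix_vector_mul_bounded_linear[of A]] by blast
  show "\<exists>e>0. \<forall>w q. norm w < e \<and> sflow r p w q \<longrightarrow> sflow r ((\<psi> \<circ> \<phi>) p) ((B ** A) *v w) ((\<psi> \<circ> \<phi>) q)"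
  proof (intro exI[of _ "min e1 (e2 / K)"] conjI allI impI)
    fix w q assume wq: "norm w < min e1 (e2 / K) \<and> sflow r p w q"
    then have "sflow r (\<phi> p) (A *v w) (\<phi> q)" using e1(2) by simp
    moreover have "norm (A *v w) < e2" using K(2)[of w] wq K(1) by (simp add: pos_less_divide_eq)
    ultimately show "sflow r ((\<psi> \<circ> \<phi>) p) ((B ** A) *v w) ((\<psi> \<circ> \<phi>) q)"
      using e2(2) by (simp add: matrix_vector_mul_assoc[symmetric])
  qed (use e1 e2 K in simp)
qed

subsection \<open>Labels of flow lines\<close>


text \<open>The denominator of the slope: \<open>q / N = 1 / (2 - r)\<close>.\<close>

definition N :: real where "N = 2 * real q - 1"

lemma N_pos: "0 < N"
  using Q_ge_2 by (simp add: N_def)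

text \<open>The flow line of label \<open>u\<close> enters square \<open>e\<close> at height \<open>(u + q * r ^ e) / N\<close> on its left edge and rises with
  slope \<open>q / N\<close>; when it reaches the top edge it continues from the bottom edge. Labels do not change along a flow
  line until it returns to the left edge of the first square.\<close>

definition hgt :: "nat \<Rightarrow> real \<Rightarrow> real \<Rightarrow> real" where
  "hgt e u a = (u + real q * r ^ e + real q * a) / N"

definition lpt :: "nat \<Rightarrow> real \<Rightarrow> real \<Rightarrow> real^2" where
  "lpt e u a = pt (S e + a) (if hgt e u a < r ^ e then hgt e u a else hgt e u a - r ^ e)"

text \<open>Equivalent to an entry height \<open>hgt e u 0\<close> in the half-open interval from 0
  to \<open>r ^ e\<close>; its length \<open>N * r ^ e\<close> is one turn of the vertical
  gluing.\<close>

definition valid :: "nat \<Rightarrow> real \<Rightarrow> bool" where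
  "valid e u \<longleftrightarrow> - (real q * r ^ e) \<le> u \<and> u < (real q - 1) * r ^ e"

lemma hgt_nonneg:
  assumes "valid e u" "0 \<le> a"
  shows "0 \<le> hgt e u a"
  unfolding hgt_def using assms N_pos mult_nonneg_nonneg[of "real q" a] unfolding valid_def
  by (intro divide_nonneg_pos) linarith+

text \<open>Across a square a line rises by \<open>q / N \<le> 2 / 3\<close> of the side, so it
  passes the top edge at most once. This is why \<open>lpt\<close> subtracts \<open>r ^ e\<close>
  only once.\<close>

lemma hgt_less:
  assumes "valid e u" "a \<le> r ^ e"
  shows "hgt e u a < 2 * r ^ e"
proof -
  have 1: "real q * a \<le> real q * r ^ e" using assms(2) Q_ge_2 by (intro mult_left_mono) auto
  have 2: "u < real q * r ^ e - r ^ e" using assms(1) unfolding valid_def by (simp add: algebra_simps)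
  have 3: "2 * r ^ e \<le> real q * r ^ e" using Q_ge_2 by (intro mult_right_mono) (auto simp: less_imp_le)
  have 4: "2 * r ^ e * N = 4 * (real q * r ^ e) - 2 * r ^ e" by (simp add: N_def algebra_simps)
  have "u + real q * r ^ e + real q * a < 2 * r ^ e * N"
    unfolding 4 using 1 2 3 rpow_pos[of e] by linarith
  then show ?thesis unfolding hgt_def using N_pos by (simp add: pos_divide_less_eq)
qed

lemma cls_top_bottom:
  assumes "S e \<le> x" "x \<le> S (Suc e)"
  shows "cls (pt x (r ^ e)) = cls (pt x 0)"
proof -
  have "arm_glue0 r (pt x (r ^ e)) (pt x 0)"
    unfolding arm_glue0_def pt_def[symmetric] ex_ge_1_iff using assms by force
  then show ?thesis by (simp add: cls_eq_iff glue0_key)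
qed

lemma cls_right_left:
  assumes "r ^ Suc e \<le> y" "y \<le> r ^ e"
  shows "cls (pt (S (Suc e)) y) = cls (pt 0 y)"
proof -
  have "arm_glue0 r (pt (S (Suc e)) y) (pt 0 y)"
    unfolding arm_glue0_def pt_def[symmetric] ex_ge_1_iff using assms by force
  then show ?thesis by (simp add: cls_eq_iff glue0_key)
qed

lemma lpt_low:
  assumes "hgt e u a \<le> r ^ e" "0 \<le> a" "a \<le> r ^ e"
  shows "cls (lpt e u a) = cls (pt (S e + a) (hgt e u a))"
proof (cases "hgt e u a < r ^ e")
  case True
  then show ?thesis unfolding lpt_def by simp
next
  case False
  then have "hgt e u a = r ^ e" using assms by simp
  then show ?thesis unfolding lpt_def using cls_top_bottom[of e "S e + a"] assms S_Suc[of e] by simp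
qed

lemma lpt_high:
  assumes "r ^ e \<le> hgt e u a"
  shows "lpt e u a = pt (S e + a) (hgt e u a - r ^ e)"
  unfolding lpt_def using assms by simp

lemma lpt_in_Pbar:
  assumes "valid e u" "0 \<le> a" "a \<le> r ^ e"
  shows "lpt e u a \<in> Pbar"
  using hgt_nonneg[OF assms(1,2)] hgt_less[OF assms(1,3)] assms S_Suc[of e] unfolding lpt_def
  by (intro Pbar_square[of e]) auto

lemma hgt_right: "hgt e u (r ^ e) = r ^ e + (u + r ^ e) / N"
  unfolding hgt_def using N_pos by (simp add: N_def field_simps)

lemma hgt_zero: "hgt (Suc e) u 0 = (u + r ^ e) / N"
  unfolding hgt_def using q_rpow[of e] by simp

lemma hgt_left: "hgt 0 u 0 = (u + real q) / N"
  unfolding hgt_def by simp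

lemma rpow_N: "r ^ Suc e * N = 2 * r ^ e - r ^ Suc e"
  unfolding N_def using q_rpow[of e] by (simp add: algebra_simps)

lemma q1_rpow: "(real q - 1) * r ^ Suc e = r ^ e - r ^ Suc e"
  using q_rpow[of e] by (simp add: algebra_simps)

lemma q1_rpow_ge: "r ^ e \<le> (real q - 1) * r ^ e"
  using mult_right_mono[of 1 "real q - 1" "r ^ e"] Q_ge_2 less_imp_le[OF rpow_pos[of e]] by simp

text \<open>The line has passed the top edge and arrives on the right edge at height
  \<open>(u + r ^ e) / N\<close>, here on the part shared with the next square. This is exactly the
  entry height of label \<open>u\<close> there; the summand \<open>q * r ^ e\<close> in
  \<open>hgt\<close> is chosen to make the two agree.\<close>

lemma glue_next:
  assumes "- (r ^ e) \<le> u" "u \<le> (real q - 1) * r ^ Suc e"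
  shows "cls (lpt e u (r ^ e)) = cls (lpt (Suc e) u 0)"
proof -
  have y: "0 \<le> (u + r ^ e) / N" using assms N_pos by simp
  have "u + r ^ e \<le> r ^ Suc e * N" using assms(2) unfolding q1_rpow rpow_N by simp
  then have "(u + r ^ e) / N \<le> r ^ Suc e" using N_pos by (simp add: pos_divide_le_eq)
  then have "cls (lpt (Suc e) u 0) = cls (pt (S (Suc e)) ((u + r ^ e) / N))"
    using lpt_low[of "Suc e" u 0] less_imp_le[OF rpow_pos[of "Suc e"]] unfolding hgt_zero by simp
  moreover have "lpt e u (r ^ e) = pt (S (Suc e)) ((u + r ^ e) / N)"
    using lpt_high[of e u "r ^ e"] y unfolding hgt_right S_Suc by simp
  ultimately show ?thesis by simp
qed

text \<open>Same exit height as before, but now above the next square, so the point is glued to the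
  left edge of the first square. At height \<open>y\<close> there the label is
  \<open>N * y - q\<close>.\<close>

lemma glue_exit_high:
  assumes "(real q - 1) * r ^ Suc e \<le> u" "u \<le> (real q - 1) * r ^ e"
  shows "cls (lpt e u (r ^ e)) = cls (lpt 0 (u + r ^ e - real q) 0)"
proof -
  have "0 \<le> (real q - 1) * r ^ Suc e" using q1_rpow_ge[of "Suc e"] rpow_pos[of "Suc e"] by linarith
  then have u0: "0 \<le> u + r ^ e" using assms(1) rpow_pos[of e] by linarith
  have y0: "0 \<le> (u + r ^ e) / N" using u0 N_pos by simp
  have "r ^ Suc e * N \<le> u + r ^ e" using assms(1) unfolding q1_rpow rpow_N by simp
  then have y1: "r ^ Suc e \<le> (u + r ^ e) / N" using N_pos by (simp add: pos_le_divide_eq)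
  have "r ^ e * N = (real q - 1) * r ^ e + real q * r ^ e" by (simp add: N_def algebra_simps)
  moreover have "r ^ e \<le> real q * r ^ e" using mult_right_mono[of 1 "real q" "r ^ e"] Q_ge_2 less_imp_le[OF rpow_pos[of e]] by simp
  ultimately have "u + r ^ e \<le> r ^ e * N" using assms(2) by linarith
  then have y2: "(u + r ^ e) / N \<le> r ^ e" using N_pos by (simp add: pos_divide_le_eq)
  have "lpt e u (r ^ e) = pt (S (Suc e)) ((u + r ^ e) / N)"
    using lpt_high[of e u "r ^ e"] y0 unfolding hgt_right S_Suc by simp
  moreover have "cls (lpt 0 (u + r ^ e - real q) 0) = cls (pt 0 ((u + r ^ e) / N))"
    using lpt_low[of 0 "u + r ^ e - real q" 0] y2 rpow_le_1[of e] unfolding hgt_left by simp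
  ultimately show ?thesis using cls_right_left[OF y1 y2] by simp
qed

text \<open>For \<open>u \<le> - (r ^ e)\<close> the line does not go above the top edge; it leaves
  at height \<open>(u + 2 * q * r ^ e) / N\<close>, again above the next square.\<close>

lemma glue_exit_low:
  assumes "- (real q * r ^ e) \<le> u" "u \<le> - (r ^ e)"
  shows "cls (lpt e u (r ^ e)) = cls (lpt 0 (u + 2 * real q * r ^ e - real q) 0)"
proof -
  let ?y = "r ^ e + (u + r ^ e) / N"
  have y2: "?y \<le> r ^ e" using assms(2) N_pos by (simp add: divide_nonpos_pos)
  have yN: "?y = (u + 2 * real q * r ^ e) / N" using N_pos by (simp add: N_def field_simps)
  have "2 * r ^ e \<le> real q * r ^ e" using Q_ge_2 by (intro mult_right_mono) (auto simp: less_imp_le)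
  then have "r ^ Suc e * N \<le> u + 2 * real q * r ^ e" using assms(1) rpow_pos[of "Suc e"] unfolding rpow_N by linarith
  then have y1: "r ^ Suc e \<le> ?y" unfolding yN using N_pos by (simp add: pos_le_divide_eq)
  have "cls (lpt e u (r ^ e)) = cls (pt (S (Suc e)) ?y)"
    using lpt_low[of e u "r ^ e"] y2 less_imp_le[OF rpow_pos[of e]] unfolding hgt_right S_Suc by simp
  moreover have "cls (lpt 0 (u + 2 * real q * r ^ e - real q) 0) = cls (pt 0 ?y)"
    using lpt_low[of 0 "u + 2 * real q * r ^ e - real q" 0] y2 rpow_le_1[of e] unfolding hgt_left yN by simp
  ultimately show ?thesis using cls_right_left[OF y1 y2] by simp
qed

text \<open>The singular points on a right edge are its two ends, both belonging to the label
  \<open>- (r ^ e)\<close> because of the vertical gluing, and the upper left corner of the next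
  square, which belongs to \<open>(q - 1) * r ^ Suc e\<close>.\<close>

lemma lpt_right_nonsing:
  assumes "valid e u" "u \<noteq> - (r ^ e)" "u \<noteq> (real q - 1) * r ^ Suc e"
  shows "lpt e u (r ^ e) \<notin> sing"
proof (cases "u < - (r ^ e)")
  case True
  let ?y = "r ^ e + (u + r ^ e) / N"
  have y2: "?y < r ^ e" using True N_pos by (simp add: divide_neg_pos)
  have yN: "?y = (u + 2 * real q * r ^ e) / N" using N_pos by (simp add: N_def field_simps)
  have "2 * r ^ e \<le> real q * r ^ e" using Q_ge_2 by (intro mult_right_mono) (auto simp: less_imp_le)
  then have "r ^ Suc e * N < u + 2 * real q * r ^ e" using assms(1) rpow_pos[of "Suc e"] unfolding rpow_N valid_def by linarith
  then have y1: "r ^ Suc e < ?y" unfolding yN using N_pos by (simp add: pos_less_divide_eq)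
  have "lpt e u (r ^ e) = pt (S (Suc e)) ?y" using y2 unfolding lpt_def hgt_right S_Suc by simp
  then show ?thesis using sing_right[of ?y e] y1 y2 rpow_pos[of "Suc e"] by simp
next
  case False
  then have u: "- (r ^ e) < u" using assms(2) by simp
  let ?y = "(u + r ^ e) / N"
  have y0: "0 < ?y" using u N_pos by simp
  have "r ^ e * N = 2 * ((real q - 1) * r ^ e) + r ^ e" by (simp add: N_def algebra_simps)
  moreover have "0 \<le> (real q - 1) * r ^ e" using q1_rpow_ge[of e] rpow_pos[of e] by linarith
  ultimately have "u + r ^ e < r ^ e * N" using assms(1) unfolding valid_def by linarith
  then have y1: "?y < r ^ e" using N_pos by (simp add: pos_divide_less_eq)
  have "?y \<noteq> r ^ Suc e"
  proof
    assume "?y = r ^ Suc e"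
    then have "u + r ^ e = r ^ Suc e * N" using N_pos by (simp add: field_simps)
    then show False using assms(3) unfolding rpow_N q1_rpow by simp
  qed
  moreover have "lpt e u (r ^ e) = pt (S (Suc e)) ?y"
    using lpt_high[of e u "r ^ e"] y0 unfolding hgt_right S_Suc by simp
  ultimately show ?thesis using sing_right[of ?y e] y0 y1 by simp
qed

lemma lpt_inner_nonsing: "0 < a \<Longrightarrow> a < r ^ e \<Longrightarrow> lpt e u a \<notin> sing"
  unfolding lpt_def using sing_between[of e "S e + a"] S_Suc[of e] by simp

lemma lpt_right_sing: "lpt e (- (r ^ e)) (r ^ e) \<in> sing" "lpt e ((real q - 1) * r ^ Suc e) (r ^ e) \<in> sing"
proof -
  show "lpt e (- (r ^ e)) (r ^ e) \<in> sing"
  proof -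
    have "lpt e (- (r ^ e)) (r ^ e) = pt (S (Suc e)) 0" unfolding lpt_def hgt_right S_Suc by simp
    moreover have "pt (S (Suc e)) 0 \<in> sing" unfolding sing_iff by blast
    ultimately show ?thesis by simp
  qed
  have "hgt e ((real q - 1) * r ^ Suc e) (r ^ e) = r ^ e + r ^ Suc e"
    unfolding hgt_right q1_rpow using rpow_N[of e] N_pos by (simp add: field_simps)
  moreover have "r ^ e \<le> r ^ e + r ^ Suc e" using rpow_pos[of "Suc e"] by linarith
  ultimately have "lpt e ((real q - 1) * r ^ Suc e) (r ^ e) = pt (S (Suc e)) (r ^ Suc e)"
    using lpt_high[of e "(real q - 1) * r ^ Suc e" "r ^ e"] unfolding S_Suc by simp
  moreover have "pt (S (Suc e)) (r ^ Suc e) \<in> sing" unfolding sing_iff by blast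
  ultimately show "lpt e ((real q - 1) * r ^ Suc e) (r ^ e) \<in> sing" by simp
qed

text \<open>The squares without their top and right edges contain one point of each regular class,
  and this point is the one chosen by \<open>key\<close>.\<close>

lemma key_lpt:
  assumes "valid e u" "0 \<le> a" "a < r ^ e" "lpt e u a \<notin> sing"
  shows "key (lpt e u a) = lpt e u a"
proof -
  define y where "y = (if hgt e u a < r ^ e then hgt e u a else hgt e u a - r ^ e)"
  have P: "lpt e u a = pt (S e + a) y" unfolding lpt_def y_def by simp
  have y: "0 \<le> y" "y < r ^ e"
    using hgt_nonneg[OF assms(1,2)] hgt_less[OF assms(1), of a] assms(3) unfolding y_def by auto
  show ?thesis
  proof (cases "a = 0")
    case False
    then show ?thesis unfolding P using key_between[of e "S e + a" y] y assms S_Suc[of e] by simp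
  next
    case True
    have "pt (S e) 0 \<in> sing" unfolding sing_iff by blast
    then have "y \<noteq> 0" using assms(4) P True by auto
    then have y0: "0 < y" using y by simp
    show ?thesis
    proof (cases e)
      case 0
      obtain i where "r ^ Suc i < y" "y < r ^ i"
        using left_edge_cases[of y] y0 y assms(4) P True 0 by auto
      then show ?thesis using P True 0 key_left[of i y] by simp
    next
      case (Suc i)
      then show ?thesis using P True key_shared[of y i] y y0 by simp
    qed
  qed
qed

text \<open>Labels of one point in the same square can differ only by a turn
  \<open>N * r ^ e\<close> of the vertical gluing, which is the full length of the half-open range
  in \<open>valid\<close>.\<close>

lemma lpt_inj:
  assumes "valid e u" "0 \<le> a" "a < r ^ e" "valid e' u'" "0 \<le> a'" "a' < r ^ e'" "lpt e u a = lpt e' u' a'"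
  shows "e = e' \<and> u = u' \<and> a = a'"
proof -
  have x: "S e + a = S e' + a'" using assms(7) unfolding lpt_def by simp
  have "S e < S (Suc e')" "S e' < S (Suc e)" using x assms S_Suc[of e] S_Suc[of e'] by linarith+
  then have e: "e = e'" unfolding S_less_iff by simp
  then have a: "a = a'" using x by simp
  have "hgt e u a - hgt e u' a \<in> {0, r ^ e, - (r ^ e)}"
    using assms(7) unfolding lpt_def e[symmetric] a[symmetric] by (auto split: if_splits)
  moreover have "hgt e u a - hgt e u' a = (u - u') / N" unfolding hgt_def by (simp add: diff_divide_distrib add_divide_distrib)
  ultimately have "u - u' \<in> {0, r ^ e * N, - (r ^ e * N)}" using N_pos by (auto simp: field_simps)
  moreover have "\<bar>u - u'\<bar> < r ^ e * N"
    using assms(1,4) unfolding valid_def e[symmetric] N_def by (auto simp: algebra_simps)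
  ultimately show ?thesis using e a by auto
qed

lemma label_unique:
  assumes "valid e u" "0 \<le> a" "a < r ^ e" "valid e' u'" "0 \<le> a'" "a' < r ^ e'"
    "cls (lpt e u a) = cls (lpt e' u' a')" "cls (lpt e u a) \<noteq> arm_sing r"
  shows "e = e' \<and> u = u' \<and> a = a'"
proof -
  have "lpt e u a \<notin> sing" "lpt e' u' a' \<notin> sing" using assms(7,8) cls_sing_iff by metis+
  then have "lpt e u a = lpt e' u' a'"
    using key_lpt[OF assms(1-3)] key_lpt[OF assms(4-6)] assms(7) by (simp add: cls_eq_iff)
  then show ?thesis using lpt_inj assms by blast
qed

lemma label_exists_half_open:
  assumes "S e \<le> x" "x < S (Suc e)" "0 \<le> y" "y < r ^ e"
  shows "\<exists>u a. valid e u \<and> 0 \<le> a \<and> a < r ^ e \<and> pt x y = lpt e u a"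
proof -
  define a where "a = x - S e"
  have a: "0 \<le> a" "a < r ^ e" using assms S_Suc[of e] unfolding a_def by auto
  have y: "N * y < N * r ^ e" using assms N_pos by simp
  have y0: "0 \<le> N * y" using assms N_pos by simp
  have Nr: "N * r ^ e = (real q - 1) * r ^ e + real q * r ^ e" by (simp add: N_def algebra_simps)
  have q: "0 \<le> real q * a" "real q * a < real q * r ^ e" using a Q_ge_2 by auto
  have q2: "2 * r ^ e \<le> real q * r ^ e" using Q_ge_2 by (intro mult_right_mono) (auto simp: less_imp_le)
  \<comment> \<open>The cases ask whether the line traced backwards from the point meets the left
    edge directly or first drops through the bottom edge; the latter adds one turn
    \<open>N * r ^ e\<close>.\<close>
  show ?thesis
  proof (cases "real q * a \<le> N * y")
    case True
    let ?u = "N * y - real q * a - real q * r ^ e"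
    have "hgt e ?u a = y" unfolding hgt_def using N_pos by simp
    moreover have "valid e ?u" unfolding valid_def using True y q Nr by linarith
    ultimately show ?thesis using a assms(4)
      by (intro exI[of _ ?u] exI[of _ a]) (simp add: lpt_def a_def)
  next
    case False
    let ?u = "N * y - real q * a - real q * r ^ e + N * r ^ e"
    have "hgt e ?u a = y + r ^ e" unfolding hgt_def using N_pos by (simp add: field_simps)
    moreover have "valid e ?u" unfolding valid_def using False y0 q q1_rpow_ge[of e] Nr rpow_pos[of e]
      by linarith
    ultimately show ?thesis using a assms(3)
      by (intro exI[of _ ?u] exI[of _ a]) (simp add: lpt_def a_def)
  qed
qed

lemma label_exists:
  assumes "p \<in> Pbar" "p \<notin> sing"
  shows "\<exists>e u a. valid e u \<and> 0 \<le> a \<and> a < r ^ e \<and> cls p = cls (lpt e u a)"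
proof -
  obtain x y where p: "p = pt x y" by (rule pt_cases)
  have "\<not> (x = Sinf \<and> y = 0)" using assms(2) unfolding p sing_iff by blast
  then obtain e where e: "S e \<le> x" "x \<le> S (Suc e)" "0 \<le> y" "y \<le> r ^ e"
    using assms(1) unfolding p Pbar_iff by blast
  have n: "y \<noteq> 0 \<and> y \<noteq> r ^ e \<and> y \<noteq> r ^ Suc e" if "x = S (Suc e)"
    using assms(2) that unfolding p sing_iff by blast
  have "\<exists>e' x' y'. S e' \<le> x' \<and> x' < S (Suc e') \<and> 0 \<le> y' \<and> y' < r ^ e' \<and> cls p = cls (pt x' y')"
  proof (cases "x = S (Suc e)")
    case False
    then have x: "x < S (Suc e)" using e by simp
    show ?thesis
    proof (cases "y = r ^ e")
      case True
      then show ?thesis using e x cls_top_bottom[of e x] unfolding p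
        by (intro exI[of _ e] exI[of _ x] exI[of _ 0]) simp
    next
      case False
      then show ?thesis using e x unfolding p by (intro exI[of _ e] exI[of _ x] exI[of _ y]) simp
    qed
  next
    case True
    show ?thesis
    proof (cases "y < r ^ Suc e")
      case True': True
      then show ?thesis using e True S_less_iff[of "Suc e" "Suc (Suc e)"] unfolding p
        by (intro exI[of _ "Suc e"] exI[of _ x] exI[of _ y]) simp
    next
      case False
      have "y < 1" using e n[OF True] rpow_le_1[of e] by linarith
      then show ?thesis using e True False cls_right_left[of e y] S_Suc_pos[of 0] unfolding p
        by (intro exI[of _ 0] exI[of _ 0] exI[of _ y]) simp
    qed
  qed
  then show ?thesis using label_exists_half_open by metis
qed

section \<open>Unfolding families of parallel flow lines\<close>

definition lab :: "real^2 \<Rightarrow> real" where "lab z = N * z $ 2 - real q * z $ 1"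

lemma lab_add: "lab (z + v) = lab z + lab v"
  by (simp add: lab_def algebra_simps)

lemma lab_scale: "lab (s *\<^sub>R v) = s * lab v"
  by (simp add: lab_def algebra_simps)

text \<open>Abscissa at which an unfolded line with itinerary \<open>es\<close> enters its
  \<open>t\<close>-th square.\<close>

definition pos :: "(nat \<Rightarrow> nat) \<Rightarrow> nat \<Rightarrow> real" where
  "pos es t = (\<Sum>i<t. r ^ es i)"

lemma pos_0 [simp]: "pos es 0 = 0" by (simp add: pos_def)

lemma pos_Suc: "pos es (Suc t) = pos es t + r ^ es t" by (simp add: pos_def)

lemma pos_strict_mono: "strict_mono (pos es)"
  by (rule strict_monoI_Suc) (simp add: pos_Suc)

lemma pos_less_iff: "pos es i < pos es j \<longleftrightarrow> i < j"
  using pos_strict_mono strict_mono_less by blast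

lemma pos_nonneg: "0 \<le> pos es t"
  unfolding pos_def by (simp add: sum_nonneg less_imp_le)

lemma pos_unique:
  assumes "pos es t \<le> x" "x < pos es (Suc t)" "pos es t' \<le> x" "x < pos es (Suc t')"
  shows "t = t'"
proof -
  have "pos es t < pos es (Suc t')" "pos es t' < pos es (Suc t)" using assms by linarith+
  then show ?thesis unfolding pos_less_iff by simp
qed

lemma pos_exists:
  assumes "0 \<le> x" "x < pos es T"
  obtains t where "pos es t \<le> x" "x < pos es (Suc t)" "t < T"
proof -
  define t where "t = (LEAST n. x < pos es n)"
  have t: "x < pos es t" unfolding t_def using assms(2) by (rule LeastI)
  have tT: "t \<le> T" unfolding t_def using assms(2) by (rule Least_le)
  have "t \<noteq> 0" using t assms(1) by (metis not_less pos_0)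
  then obtain i where i: "t = Suc i" by (cases t) auto
  have "\<not> x < pos es i" using not_less_Least[of i "\<lambda>n. x < pos es n"] unfolding t_def[symmetric] i by simp
  then show ?thesis using that[of i] t tT unfolding i by simp
qed

definition tower_map :: "(nat \<Rightarrow> nat) \<Rightarrow> (nat \<Rightarrow> real) \<Rightarrow> real^2 \<Rightarrow> (real^2) set" where
  "tower_map es cs z = (let t = (THE t. pos es t \<le> z $ 1 \<and> z $ 1 < pos es (Suc t)) in
     cls (lpt (es t) (cs t + lab z) (z $ 1 - pos es t)))"

lemma tower_map_eq:
  assumes "pos es t \<le> z $ 1" "z $ 1 < pos es (Suc t)"
  shows "tower_map es cs z = cls (lpt (es t) (cs t + lab z) (z $ 1 - pos es t))"
proof -
  have "(THE t. pos es t \<le> z $ 1 \<and> z $ 1 < pos es (Suc t)) = t"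
    using assms pos_unique by blast
  then show ?thesis unfolding tower_map_def by simp
qed

text \<open>The flow lines with labels \<open>cs t + u\<close>, for \<open>u \<in> U\<close>, run in parallel through the squares \<open>es 0\<close>, \<open>es 1\<close>, \<dots>;
  \<open>tower_map\<close> unfolds them into the plane, where \<open>lab\<close> recovers \<open>u\<close>.\<close>

definition tower :: "(nat \<Rightarrow> nat) \<Rightarrow> (nat \<Rightarrow> real) \<Rightarrow> real set \<Rightarrow> bool" where
  "tower es cs U \<longleftrightarrow> (\<forall>t. \<forall>u\<in>U. valid (es t) (cs t + u) \<and>
     cls (lpt (es t) (cs t + u) (r ^ es t)) = cls (lpt (es (Suc t)) (cs (Suc t) + u) 0))"

lemma tower_map_slab:
  assumes "tower es cs U" "lab z \<in> U" "pos es t \<le> z $ 1" "z $ 1 \<le> pos es (Suc t)"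
  shows "tower_map es cs z = cls (lpt (es t) (cs t + lab z) (z $ 1 - pos es t))"
proof (cases "z $ 1 < pos es (Suc t)")
  case True
  then show ?thesis using tower_map_eq assms by blast
next
  case False
  then have z: "z $ 1 = pos es (Suc t)" using assms by simp
  then have "tower_map es cs z = cls (lpt (es (Suc t)) (cs (Suc t) + lab z) 0)"
    using tower_map_eq[of es "Suc t" z cs] pos_Suc[of es "Suc t"] by simp
  then show ?thesis using assms(1,2) pos_Suc[of es t] unfolding tower_def z by simp
qed

text \<open>Two planar representatives suffice: the point at its unwrapped height and its copy
  lowered by \<open>r ^ e\<close>. Both are kept since a point on the top edge has neighbours on
  either side.\<close>

lemma tower_map_slab_nhd:
  assumes tow: "tower es cs U" and z: "lab z \<in> U" "pos es t \<le> z $ 1" "z $ 1 \<le> pos es (Suc t)"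
  shows "\<exists>F \<epsilon>. finite F \<and> 0 < \<epsilon> \<and> (\<forall>v. norm v < \<epsilon> \<and> lab (z + v) \<in> U \<and>
      pos es t \<le> z $ 1 + v $ 1 \<and> z $ 1 + v $ 1 \<le> pos es (Suc t) \<longrightarrow>
      (\<exists>x\<in>F. tower_map es cs z = cls x \<and> tower_map es cs (z + v) = cls (x + v) \<and> x + v \<in> Pbar))"
proof -
  define e where "e = es t"
  define a where "a = z $ 1 - pos es t"
  define h where "h = hgt e (cs t + lab z) a"
  have H: "hgt e (cs t + lab (z + v)) (a + v $ 1) = h + v $ 2" for v
    unfolding h_def hgt_def lab_def using N_pos by (simp add: field_simps)
  have tz: "tower_map es cs (z + v) = cls (lpt e (cs t + lab (z + v)) (a + v $ 1))"
    if "lab (z + v) \<in> U" "pos es t \<le> z $ 1 + v $ 1" "z $ 1 + v $ 1 \<le> pos es (Suc t)" for v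
    using tower_map_slab[OF tow that(1), of t] that unfolding e_def a_def by (simp add: algebra_simps)
  have tz0: "tower_map es cs z = cls (lpt e (cs t + lab z) a)" using tz[of 0] z by simp
  have a: "0 \<le> a" "a \<le> r ^ e" using z pos_Suc[of es t] unfolding a_def e_def by auto
  have low: "tower_map es cs (z + v) = cls (pt (S e + a) h + v) \<and> pt (S e + a) h + v \<in> Pbar"
    if "lab (z + v) \<in> U" "pos es t \<le> z $ 1 + v $ 1" "z $ 1 + v $ 1 \<le> pos es (Suc t)" "h + v $ 2 \<le> r ^ e" for v
  proof -
    have av: "0 \<le> a + v $ 1" "a + v $ 1 \<le> r ^ e" using that pos_Suc[of es t] unfolding a_def e_def by auto
    have va: "valid e (cs t + lab (z + v))" using tow that(1) unfolding tower_def e_def by blast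
    have "cls (lpt e (cs t + lab (z + v)) (a + v $ 1)) = cls (pt (S e + (a + v $ 1)) (h + v $ 2))"
      using lpt_low[of e "cs t + lab (z + v)" "a + v $ 1"] H that(4) av by simp
    moreover have "pt (S e + (a + v $ 1)) (h + v $ 2) \<in> Pbar"
      using hgt_nonneg[OF va av(1)] av that(4) S_Suc[of e] unfolding H by (intro Pbar_square[of e]) auto
    ultimately show ?thesis using tz that unfolding pt_add_vec by (simp add: add.assoc)
  qed
  have high: "tower_map es cs (z + v) = cls (pt (S e + a) (h - r ^ e) + v) \<and> pt (S e + a) (h - r ^ e) + v \<in> Pbar"
    if "lab (z + v) \<in> U" "pos es t \<le> z $ 1 + v $ 1" "z $ 1 + v $ 1 \<le> pos es (Suc t)" "r ^ e \<le> h + v $ 2" for v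
  proof -
    have av: "0 \<le> a + v $ 1" "a + v $ 1 \<le> r ^ e" using that pos_Suc[of es t] unfolding a_def e_def by auto
    have va: "valid e (cs t + lab (z + v))" using tow that(1) unfolding tower_def e_def by blast
    have "lpt e (cs t + lab (z + v)) (a + v $ 1) = pt (S e + (a + v $ 1)) (h + v $ 2 - r ^ e)"
      using lpt_high[of e "cs t + lab (z + v)" "a + v $ 1"] H that(4) by simp
    moreover have "lpt e (cs t + lab (z + v)) (a + v $ 1) \<in> Pbar" using lpt_in_Pbar[OF va av] .
    ultimately show ?thesis using tz that unfolding pt_add_vec by (simp add: algebra_simps)
  qed
  have z0: "lab (z + 0) \<in> U" "pos es t \<le> z $ 1 + 0 $ 1" "z $ 1 + 0 $ 1 \<le> pos es (Suc t)" using z by simp_all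
  \<comment> \<open>Off the top edge the radius forbids crossing it. On the top edge both copies
    represent \<open>z\<close>, each usable on its own side, so any radius works.\<close>
  define \<epsilon> where "\<epsilon> = (if h = r ^ e then 1 else \<bar>h - r ^ e\<bar>)"
  have "0 < \<epsilon>" unfolding \<epsilon>_def by simp
  moreover have "\<exists>x\<in>{pt (S e + a) h, pt (S e + a) (h - r ^ e)}. tower_map es cs z = cls x \<and> tower_map es cs (z + v) = cls (x + v) \<and> x + v \<in> Pbar"
    if v: "norm v < \<epsilon>" "lab (z + v) \<in> U" "pos es t \<le> z $ 1 + v $ 1" "z $ 1 + v $ 1 \<le> pos es (Suc t)" for v
  proof -
    have v2: "\<bar>v $ 2\<bar> < \<epsilon>" using comp_less[OF v(1)] by simp
    have "(h \<le> r ^ e \<and> h + v $ 2 \<le> r ^ e) \<or> (r ^ e \<le> h \<and> r ^ e \<le> h + v $ 2)"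
      using v2 unfolding \<epsilon>_def by (auto split: if_splits)
    then show ?thesis
      using low[OF z0] low[OF v(2-4)] high[OF z0] high[OF v(2-4)] by auto
  qed
  ultimately show ?thesis
    by (intro exI[of _ "{pt (S e + a) h, pt (S e + a) (h - r ^ e)}"] exI[of _ \<epsilon>]) blast
qed

text \<open>On the wall between two slabs the representatives from the left and from the right are
  united; \<open>0 < z $ 1\<close> provides a slab on the left.\<close>

lemma tower_map_nhd:
  assumes tow: "tower es cs U" and z: "lab z \<in> U" "0 < z $ 1" "z $ 1 < pos es T"
  shows "\<exists>F \<epsilon>. finite F \<and> 0 < \<epsilon> \<and> (\<forall>v. norm v < \<epsilon> \<and> lab (z + v) \<in> U \<longrightarrow>
      (\<exists>x\<in>F. tower_map es cs z = cls x \<and> tower_map es cs (z + v) = cls (x + v) \<and> x + v \<in> Pbar))"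
proof -
  obtain t where t: "pos es t \<le> z $ 1" "z $ 1 < pos es (Suc t)" using pos_exists[of "z $ 1" es T] z by auto
  obtain F \<epsilon> where F: "finite F" "0 < \<epsilon>" "\<And>v. norm v < \<epsilon> \<Longrightarrow> lab (z + v) \<in> U \<Longrightarrow>
      pos es t \<le> z $ 1 + v $ 1 \<Longrightarrow> z $ 1 + v $ 1 \<le> pos es (Suc t) \<Longrightarrow>
      (\<exists>x\<in>F. tower_map es cs z = cls x \<and> tower_map es cs (z + v) = cls (x + v) \<and> x + v \<in> Pbar)"
    using tower_map_slab_nhd[OF tow z(1) t(1)] t(2) by (metis less_imp_le)
  show ?thesis
  proof (cases "pos es t = z $ 1")
    case False
    define \<delta> where "\<delta> = min \<epsilon> (min (z $ 1 - pos es t) (pos es (Suc t) - z $ 1))"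
    have "0 < \<delta>" using F t False unfolding \<delta>_def by simp
    moreover have "pos es t \<le> z $ 1 + v $ 1 \<and> z $ 1 + v $ 1 \<le> pos es (Suc t) \<and> norm v < \<epsilon>" if "norm v < \<delta>" for v :: "real^2"
      using comp_less[OF that] that unfolding \<delta>_def by auto
    ultimately show ?thesis using F by (intro exI[of _ F] exI[of _ \<delta>]) blast
  next
    case True
    then obtain i where i: "t = Suc i" using z(2) by (cases t) auto
    have i': "pos es i \<le> z $ 1" "z $ 1 \<le> pos es (Suc i)" "pos es i < z $ 1"
      using True pos_Suc[of es i] rpow_pos[of "es i"] unfolding i by linarith+
    obtain F' \<epsilon>' where F': "finite F'" "0 < \<epsilon>'" "\<And>v. norm v < \<epsilon>' \<Longrightarrow> lab (z + v) \<in> U \<Longrightarrow>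
      pos es i \<le> z $ 1 + v $ 1 \<Longrightarrow> z $ 1 + v $ 1 \<le> pos es (Suc i) \<Longrightarrow>
      (\<exists>x\<in>F'. tower_map es cs z = cls x \<and> tower_map es cs (z + v) = cls (x + v) \<and> x + v \<in> Pbar)"
      using tower_map_slab_nhd[OF tow z(1) i'(1,2)] by blast
    define \<delta> where "\<delta> = min (min \<epsilon> \<epsilon>') (min (z $ 1 - pos es i) (pos es (Suc t) - z $ 1))"
    have "0 < \<delta>" using F F' t i' unfolding \<delta>_def by simp
    moreover have "(\<exists>x\<in>F \<union> F'. tower_map es cs z = cls x \<and> tower_map es cs (z + v) = cls (x + v) \<and> x + v \<in> Pbar)"
      if v: "norm v < \<delta>" "lab (z + v) \<in> U" for v
    proof -
      have d: "norm v < \<epsilon>" "norm v < \<epsilon>'" "pos es i \<le> z $ 1 + v $ 1" "z $ 1 + v $ 1 \<le> pos es (Suc t)"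
        using comp_less[OF v(1)] v(1) unfolding \<delta>_def by auto
      show ?thesis
      proof (cases "0 \<le> v $ 1")
        case True': True
        then show ?thesis using F(3)[OF d(1) v(2)] d True by auto
      next
        case False
        then show ?thesis using F'(3)[OF d(2) v(2)] d True i by auto
      qed
    qed
    ultimately show ?thesis using F(1) F'(1) by (intro exI[of _ "F \<union> F'"] exI[of _ \<delta>]) blast
  qed
qed

text \<open>Weaker than a hop so as to make sense also where \<open>D z\<close> is singular. At
  regular values it yields hops, and the finiteness of \<open>F\<close> yields continuity
  everywhere.\<close>

definition nhd :: "(real^2 \<Rightarrow> (real^2) set) \<Rightarrow> (real^2) set \<Rightarrow> real^2 \<Rightarrow> bool" where
  "nhd D U z \<longleftrightarrow> (\<exists>F \<epsilon>. finite F \<and> 0 < \<epsilon> \<and> (\<forall>v. norm v < \<epsilon> \<and> z + v \<in> U \<longrightarrow>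
      (\<exists>x\<in>F. D z = cls x \<and> D (z + v) = cls (x + v) \<and> x + v \<in> Pbar)))"

lemma nhd_hop:
  assumes "nhd D U z" "z \<in> U" "D z \<noteq> arm_sing r"
  shows "\<exists>\<epsilon>>0. \<forall>v. norm v < \<epsilon> \<and> z + v \<in> U \<longrightarrow> hop (D z) v (D (z + v))"
proof -
  obtain F \<epsilon> where F: "finite F" "0 < \<epsilon>" "\<And>v. norm v < \<epsilon> \<Longrightarrow> z + v \<in> U \<Longrightarrow>
      (\<exists>x\<in>F. D z = cls x \<and> D (z + v) = cls (x + v) \<and> x + v \<in> Pbar)"
    using assms(1) unfolding nhd_def by blast
  obtain p where p: "D z = cls p" "p \<in> Pbar" using F(3)[of 0] F(2) assms(2) by auto
  have "p \<notin> sing" using assms(3) p(1) cls_sing_iff by simp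
  then obtain \<delta> where \<delta>: "0 < \<delta>" "chart p \<delta>" using chart_exists p by blast
  have "hop (D z) v (D (z + v))" if v: "norm v < min \<epsilon> \<delta>" "z + v \<in> U" for v
  proof -
    obtain x where x: "D z = cls x" "D (z + v) = cls (x + v)" "x + v \<in> Pbar" using F(3)[of v] v by auto
    then have "x \<in> cls p" using p(1) by (simp add: mem_cls cls_eq_iff)
    then show ?thesis unfolding x(2) p(1) using hop_in_chart[OF \<delta>(2)] v x(3) by simp
  qed
  then show ?thesis using F(2) \<delta>(1) by (intro exI[of _ "min \<epsilon> \<delta>"]) simp
qed

lemma nhd_continuous:
  assumes "nhd D U z" "z \<in> U" "surf_open r W" "D z \<in> W"
  shows "\<exists>\<epsilon>>0. \<forall>v. norm v < \<epsilon> \<and> z + v \<in> U \<longrightarrow> D (z + v) \<in> W"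
proof -
  have W: "W \<subseteq> arm_X r" "openin (top_of_set Pbar) (\<Union>W)" using assms(3) unfolding surf_open_def by auto
  obtain F \<epsilon> where F: "finite F" "0 < \<epsilon>" "\<And>v. norm v < \<epsilon> \<Longrightarrow> z + v \<in> U \<Longrightarrow>
      (\<exists>x\<in>F. D z = cls x \<and> D (z + v) = cls (x + v) \<and> x + v \<in> Pbar)"
    using assms(1) unfolding nhd_def by blast
  define F' where "F' = {x \<in> F. cls x = D z}"
  have "\<exists>\<epsilon>>0. \<forall>x'\<in>Pbar. dist x' x < \<epsilon> \<longrightarrow> x' \<in> \<Union>W" if "x \<in> F'" for x
  proof -
    have "x \<in> \<Union>W" using that assms(4) Union_mem[OF W(1)] unfolding F'_def by simp
    then show ?thesis using W(2) unfolding openin_euclidean_subtopology_iff by blast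
  qed
  then obtain f where f: "\<And>x. x \<in> F' \<Longrightarrow> 0 < f x \<and> (\<forall>x'\<in>Pbar. dist x' x < f x \<longrightarrow> x' \<in> \<Union>W)" by metis
  have fin: "finite F'" using F(1) unfolding F'_def by simp
  define \<delta> where "\<delta> = Min (insert \<epsilon> (f ` F'))"
  have "0 < \<delta>" using f fin F(2) unfolding \<delta>_def by (subst Min_gr_iff) auto
  moreover have "D (z + v) \<in> W" if v: "norm v < \<delta>" "z + v \<in> U" for v
  proof -
    have "\<delta> \<le> \<epsilon>" "\<And>x. x \<in> F' \<Longrightarrow> \<delta> \<le> f x" using fin unfolding \<delta>_def by auto
    then obtain x where x: "x \<in> F" "D z = cls x" "D (z + v) = cls (x + v)" "x + v \<in> Pbar" "norm v < f x"
      using F(3)[of v] v unfolding F'_def by fastforce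
    then have "x + v \<in> \<Union>W" using f[of x] unfolding F'_def by (auto simp: dist_norm)
    then show ?thesis unfolding x(3) using Union_mem[OF W(1)] by simp
  qed
  ultimately show ?thesis by blast
qed

subsection \<open>The combinatorics of the cylinders\<close>


text \<open>These are the upper ends of the blocks \<open>[n * r ^ i, (n + 1) * r ^ i)\<close> of
  numbers with leading base-\<open>q\<close> digit \<open>n\<close> in position \<open>i\<close>.
  For \<open>i \<le> k\<close> the block is long enough to contain \<open>c - \<xi>\<close> whenever
  \<open>0 < \<xi> \<le> r ^ k\<close>.\<close>

definition grid :: "nat \<Rightarrow> real \<Rightarrow> bool" where
  "grid k c \<longleftrightarrow> (\<exists>i n. i \<le> k \<and> 1 \<le> n \<and> n < q \<and> c = real (Suc n) * r ^ i)"

lemma rpow_mult_mono: "a \<le> b \<Longrightarrow> real a * r ^ i \<le> real b * r ^ i"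
  by (intro mult_right_mono) (simp_all add: less_imp_le)

lemma rpow_le_mult: "1 \<le> p \<Longrightarrow> r ^ i \<le> real p * r ^ i"
  using rpow_mult_mono[of 1 p i] by simp

lemma rpow_mult_less: "a < b \<Longrightarrow> real a * r ^ i < real b * r ^ i"
  by (intro mult_strict_right_mono) simp_all

lemma real_q1: "real q - 1 = real (q - 1)"
  using q_ge_2 by (simp add: of_nat_diff)

lemma grid_bounds:
  assumes "grid k c"
  shows "r ^ k < c" "c \<le> real q" "2 * r ^ k \<le> c"
proof -
  obtain i n where c: "i \<le> k" "1 \<le> n" "n < q" "c = real (Suc n) * r ^ i" using assms unfolding grid_def by blast
  have "r ^ k \<le> r ^ i" using c(1) rpow_le_iff by simp
  moreover have "2 * r ^ i \<le> c" unfolding c(4) using rpow_mult_mono[of 2 "Suc n" i] c(2) by simp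
  ultimately show "2 * r ^ k \<le> c" by linarith
  then show "r ^ k < c" using rpow_pos[of k] by linarith
  have "c \<le> real q * r ^ i" unfolding c(4) using rpow_mult_mono[of "Suc n" q i] c(3) by simp
  also have "\<dots> \<le> real q * 1" using rpow_le_1[of i] by (intro mult_left_mono) auto
  finally show "c \<le> real q" by simp
qed

lemma grid_q: "grid k (real q)"
  unfolding grid_def using q_ge_2 by (intro exI[of _ 0] exI[of _ "q - 1"]) simp

lemma grid_mono: "grid k c \<Longrightarrow> k \<le> j \<Longrightarrow> grid j c"
  unfolding grid_def using le_trans by blast

text \<open>A grid point has two digit expansions: one adapted to the grid interval below it and one to the grid interval
  above it, which governs how its flow lines continue.\<close>

lemma grid_low:
  "grid k c \<longleftrightarrow> c = real q \<or> (\<exists>i p. i \<le> k \<and> 1 \<le> p \<and> p < q \<and> c = real p * r ^ i \<and> r ^ k < c)"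
proof
  assume g: "grid k c"
  then obtain i n where c: "i \<le> k" "1 \<le> n" "n < q" "c = real (Suc n) * r ^ i" unfolding grid_def by blast
  show "c = real q \<or> (\<exists>i p. i \<le> k \<and> 1 \<le> p \<and> p < q \<and> c = real p * r ^ i \<and> r ^ k < c)"
  proof (cases "Suc n < q")
    case True
    then show ?thesis using c grid_bounds(1)[OF g] by (intro disjI2 exI[of _ i] exI[of _ "Suc n"]) simp
  next
    case False
    then have n: "Suc n = q" using c by simp
    show ?thesis
    proof (cases i)
      case 0
      then show ?thesis using c n by simp
    next
      case (Suc j)
      then have "c = real 1 * r ^ j" using c n q_rpow[of j] by simp
      then show ?thesis using c Suc q_ge_2 grid_bounds(1)[OF g] by (intro disjI2 exI[of _ j] exI[of _ 1]) simp
    qed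
  qed
next
  assume "c = real q \<or> (\<exists>i p. i \<le> k \<and> 1 \<le> p \<and> p < q \<and> c = real p * r ^ i \<and> r ^ k < c)"
  then show "grid k c"
  proof
    assume "\<exists>i p. i \<le> k \<and> 1 \<le> p \<and> p < q \<and> c = real p * r ^ i \<and> r ^ k < c"
    then obtain i p where c: "i \<le> k" "1 \<le> p" "p < q" "c = real p * r ^ i" "r ^ k < c" by blast
    show "grid k c"
    proof (cases "p = 1")
      case True
      then have "i < k" using c by (simp add: rpow_less_iff)
      moreover have "c = real (Suc (q - 1)) * r ^ Suc i" using c True q_rpow[of i] q_ge_2 by simp
      ultimately show ?thesis unfolding grid_def using q_ge_2 by (intro exI[of _ "Suc i"] exI[of _ "q - 1"]) simp
    next
      case False
      then show ?thesis unfolding grid_def using c(1-4) by (intro exI[of _ i] exI[of _ "p - 1"] conjI) auto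
    qed
  qed (use grid_q in simp)
qed

text \<open>Blocks with position \<open>i\<close> fill \<open>[r ^ i, q * r ^ i)\<close>. Because
  \<open>q * r ^ Suc i = r ^ i\<close>, these ranges are disjoint for different positions.\<close>

lemma digit_unique:
  assumes "1 \<le> n" "n < q" "real n * r ^ i \<le> v" "v < real (Suc n) * r ^ i"
    and "1 \<le> n'" "n' < q" "real n' * r ^ i' \<le> v" "v < real (Suc n') * r ^ i'"
  shows "i = i' \<and> n = n'"
proof -
  have *: "\<not> i < j" if "1 \<le> n" "n < q" "real n * r ^ i \<le> v" "n' < q" "v < real (Suc n') * r ^ j" for i j n n'
  proof
    assume "i < j"
    then obtain l where l: "j = Suc l" "i \<le> l" by (cases j) auto
    have "v < real q * r ^ j" using that(5) rpow_mult_mono[of "Suc n'" q j] that(4) by linarith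
    also have "\<dots> = r ^ l" unfolding l using q_rpow by simp
    also have "\<dots> \<le> r ^ i" using l(2) rpow_le_iff by simp
    also have "\<dots> \<le> v" using rpow_le_mult[OF that(1), of i] that(3) by linarith
    finally show False by simp
  qed
  have i: "i = i'" using *[of n i n' i'] *[of n' i' n i] assms by linarith
  have "real n * r ^ i < real (Suc n') * r ^ i" "real n' * r ^ i < real (Suc n) * r ^ i"
    using assms(3,4,7,8) unfolding i[symmetric] by linarith+
  then have "real n < real (Suc n')" "real n' < real (Suc n)"
    using mult_less_cancel_right_pos[OF rpow_pos[of i]] by blast+
  then show ?thesis using i by simp
qed

definition band :: "nat \<Rightarrow> real set" where "band k = {r ^ Suc k .. r ^ k}"

lemma band_iff: "\<xi> \<in> band k \<longleftrightarrow> r ^ Suc k \<le> \<xi> \<and> \<xi> \<le> r ^ k"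
  by (simp add: band_def)

lemma band_pos: "\<xi> \<in> band k \<Longrightarrow> 0 < \<xi>"
  unfolding band_iff using rpow_pos[of "Suc k"] by linarith

text \<open>The number \<open>c - \<xi>\<close> lies in the block with upper end \<open>c\<close>,
  so its leading digit recovers \<open>c\<close>, even when \<open>k\<close> and \<open>j\<close>
  differ.\<close>

lemma grid_decomp:
  assumes "grid k c" "\<xi> \<in> band k" "grid j c'" "\<xi>' \<in> band j" "c - \<xi> = c' - \<xi>'"
  shows "c = c' \<and> \<xi> = \<xi>'"
proof -
  have *: "\<exists>i n. 1 \<le> n \<and> n < q \<and> real n * r ^ i \<le> c - \<xi> \<and> c - \<xi> < real (Suc n) * r ^ i \<and> c = real (Suc n) * r ^ i"
    if g: "grid k c" "\<xi> \<in> band k" for k c \<xi>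
  proof -
    obtain i n where c: "i \<le> k" "1 \<le> n" "n < q" "c = real (Suc n) * r ^ i" using g(1) unfolding grid_def by blast
    have "\<xi> \<le> r ^ i" using that(2) c(1) rpow_le_iff[of k i] unfolding band_iff by linarith
    moreover have "c = real n * r ^ i + r ^ i" unfolding c(4) by (simp add: algebra_simps)
    ultimately have "real n * r ^ i \<le> c - \<xi>" "c - \<xi> < c" using band_pos[OF that(2)] by linarith+
    then show ?thesis using c by blast
  qed
  obtain i n where 1: "1 \<le> n" "n < q" "real n * r ^ i \<le> c - \<xi>" "c - \<xi> < real (Suc n) * r ^ i" "c = real (Suc n) * r ^ i"
    using *[OF assms(1,2)] by blast
  obtain i' n' where 2: "1 \<le> n'" "n' < q" "real n' * r ^ i' \<le> c' - \<xi>'" "c' - \<xi>' < real (Suc n') * r ^ i'" "c' = real (Suc n') * r ^ i'"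
    using *[OF assms(3,4)] by blast
  have "i = i' \<and> n = n'" using digit_unique[OF 1(1-4)] 2 assms(5) by simp
  then show ?thesis using 1(5) 2(5) assms(5) by simp
qed

text \<open>The right-hand side is the lower end of a block, while \<open>c - \<xi>\<close> lies
  strictly inside one. Labels that run into a vertex have this form, so the lemma keeps interiors of
  cylinders regular.\<close>

lemma grid_avoid:
  assumes "grid k c" "0 < \<xi>" "\<xi> < r ^ k" "1 \<le> p" "p < q"
  shows "c - \<xi> \<noteq> real p * r ^ j"
proof
  assume eq: "c - \<xi> = real p * r ^ j"
  obtain i n where c: "i \<le> k" "1 \<le> n" "n < q" "c = real (Suc n) * r ^ i" using assms(1) unfolding grid_def by blast
  have xi: "\<xi> < r ^ i" using assms(3) c(1) rpow_le_iff[of k i] by linarith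
  have 1: "real n * r ^ i < c - \<xi>" "c - \<xi> < real (Suc n) * r ^ i" using c xi assms(2) by (simp_all add: algebra_simps)
  have 2: "real p * r ^ j \<le> c - \<xi>" "c - \<xi> < real (Suc p) * r ^ j" unfolding eq using rpow_mult_less[of p "Suc p" j] by simp_all
  have "i = j \<and> n = p"
    using digit_unique[OF c(2,3) _ 1(2) assms(4,5) 2] 1(1) by simp
  then show False using 1(1) eq by simp
qed

lemma band_exists:
  assumes "0 < \<xi>" "\<xi> \<le> 1"
  obtains k where "\<xi> \<in> band k" "r ^ Suc k < \<xi>"
proof -
  obtain n where n: "r ^ n < \<xi>" using real_arch_pow_inv[OF assms(1) r_less_1] by blast
  define i where "i = (LEAST n. r ^ n < \<xi>)"
  have i: "r ^ i < \<xi>" unfolding i_def using n by (rule LeastI)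
  have "i \<noteq> 0" using i assms(2) by (metis power_0 not_less)
  then obtain e where e: "i = Suc e" by (cases i) auto
  have "\<not> r ^ e < \<xi>" using not_less_Least[of e "\<lambda>n. r ^ n < \<xi>"] unfolding i_def[symmetric] e by simp
  then show ?thesis using that[of e] i e unfolding band_iff by simp
qed

lemma grid_cover:
  assumes "0 < v" "v < real q"
  obtains k i n \<xi> where "grid k (real (Suc n) * r ^ i)" "\<xi> \<in> band k" "v = real (Suc n) * r ^ i - \<xi>"
    "1 \<le> n" "n < q" "real n * r ^ i \<le> v" "v < real (Suc n) * r ^ i"
proof -
  obtain n where "r ^ n < v" using real_arch_pow_inv[OF assms(1) r_less_1] by blast
  then have ex: "\<exists>n. r ^ n \<le> v" using less_imp_le by blast
  define i where "i = (LEAST n. r ^ n \<le> v)"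
  have i: "r ^ i \<le> v" unfolding i_def using ex by (rule LeastI_ex)
  have i2: "v < real q * r ^ i"
  proof (cases i)
    case 0
    then show ?thesis using assms by simp
  next
    case (Suc e)
    have "\<not> r ^ e \<le> v" using not_less_Least[of e "\<lambda>n. r ^ n \<le> v"] unfolding i_def[symmetric] Suc by simp
    then show ?thesis unfolding Suc q_rpow by simp
  qed
  define n where "n = nat \<lfloor>v / r ^ i\<rfloor>"
  have fl: "1 \<le> v / r ^ i" "v / r ^ i < real q" using i i2 by (simp_all add: pos_le_divide_eq pos_divide_less_eq)
  then have f1: "1 \<le> \<lfloor>v / r ^ i\<rfloor>" "\<lfloor>v / r ^ i\<rfloor> < int q" by (simp_all add: le_floor_iff floor_less_iff)
  then have n: "1 \<le> n" "n < q" unfolding n_def by linarith+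
  have "real n \<le> v / r ^ i" "v / r ^ i < real (Suc n)" unfolding n_def using f1 by linarith+
  then have v: "real n * r ^ i \<le> v" "v < real (Suc n) * r ^ i" by (simp_all add: pos_le_divide_eq pos_divide_less_eq)
  define \<xi> where "\<xi> = real (Suc n) * r ^ i - v"
  have xi: "0 < \<xi>" "\<xi> \<le> r ^ i" using v unfolding \<xi>_def by (simp_all add: algebra_simps)
  \<comment> \<open>Strictness selects the larger of two possible indices at an end point of a band.
    Otherwise \<open>\<xi> = r ^ i\<close> could give \<open>k = i - 1\<close>, contrary to
    \<open>i \<le> k\<close>.\<close>
  obtain k where k: "\<xi> \<in> band k" "r ^ Suc k < \<xi>" using band_exists[of \<xi>] xi rpow_le_1[of i] by auto
  then have "i \<le> k" using xi(2) rpow_less_iff[of "Suc k" i] by auto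
  then have "grid k (real (Suc n) * r ^ i)" unfolding grid_def using n by blast
  then show ?thesis using that[of k n i \<xi>] k n v unfolding \<xi>_def by simp
qed

text \<open>A state \<open>(e, c)\<close> stands for the flow lines with labels \<open>c - \<xi>\<close>, \<open>\<xi> \<in> band k\<close>, passing square \<open>e\<close>;
  \<open>next_state\<close> is the square they pass next.\<close>

definition state :: "nat \<Rightarrow> nat \<Rightarrow> real \<Rightarrow> bool" where
  "state k e c \<longleftrightarrow> (0 < c \<and> grid k c \<and> c \<le> (real q - 1) * r ^ e) \<or> (c = 0 \<and> e \<le> Suc k) \<or>
     (c < 0 \<and> e = 0 \<and> grid k (c + real q))"

definition next_state :: "nat \<Rightarrow> nat \<times> real \<Rightarrow> nat \<times> real" where
  "next_state k s = (let e = fst s; c = snd s in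
     if c = 0 then (if e \<le> k then (Suc e, 0) else (0, 2 * r ^ k - real q))
     else if c < 0 then (0, c + real q)
     else if c \<le> (real q - 1) * r ^ Suc e then (Suc e, c)
     else (0, c + r ^ e - real q))"

lemma next_state_simps:
  "e \<le> k \<Longrightarrow> next_state k (e, 0) = (Suc e, 0)" "k < e \<Longrightarrow> next_state k (e, 0) = (0, 2 * r ^ k - real q)"
  "c < 0 \<Longrightarrow> next_state k (e, c) = (0, c + real q)"
  "0 < c \<Longrightarrow> c \<le> (real q - 1) * r ^ Suc e \<Longrightarrow> next_state k (e, c) = (Suc e, c)"
  "0 < c \<Longrightarrow> (real q - 1) * r ^ Suc e < c \<Longrightarrow> next_state k (e, c) = (0, c + r ^ e - real q)"
  unfolding next_state_def by simp_all

lemma state_pos: "0 < c \<Longrightarrow> state k e c \<longleftrightarrow> grid k c \<and> c \<le> (real q - 1) * r ^ e"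
  unfolding state_def by auto

lemma state_le_0: "c \<le> 0 \<Longrightarrow> state k e c \<Longrightarrow> grid k (c + real q)"
  unfolding state_def using grid_q by auto

lemma state_mono: "state k e c \<Longrightarrow> k \<le> j \<Longrightarrow> state j e c"
  unfolding state_def using grid_mono by auto

text \<open>The sign of the label tells whether the offsets are positive or not; nonpositive offsets
  become grid points after adding \<open>q\<close>, so both cases reduce to
  \<open>grid_decomp\<close>.\<close>

lemma state_decomp:
  assumes "state k e c" "\<xi> \<in> band k" "state j e c'" "\<xi>' \<in> band j" "c - \<xi> = c' - \<xi>'"
  shows "c = c' \<and> \<xi> = \<xi>'"
proof -
  have *: "0 < c - \<xi>" if "0 < c" "state k e c" "\<xi> \<in> band k" for k c \<xi>
    using that grid_bounds(1)[of k c] unfolding state_def band_iff by auto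
  show ?thesis
  proof (cases "0 < c - \<xi>")
    case True
    then have "0 < c" "0 < c'" using assms band_pos by fastforce+
    then show ?thesis using grid_decomp assms state_pos by blast
  next
    case False
    then have "c \<le> 0" "c' \<le> 0" using *[OF _ assms(1,2)] *[OF _ assms(3,4)] assms(5) by fastforce+
    then have "grid k (c + real q)" "grid j (c' + real q)" using state_le_0 assms by auto
    then show ?thesis using grid_decomp[of k "c + real q" \<xi> j "c' + real q" \<xi>'] assms by simp
  qed
qed

lemma q1_rpow_mono: "i \<le> e \<Longrightarrow> (real q - 1) * r ^ e \<le> (real q - 1) * r ^ i"
  using Q_ge_2 rpow_le_iff by (intro mult_left_mono) auto

lemma low_le_level:
  assumes "1 \<le> p" "real p * r ^ i \<le> (real q - 1) * r ^ e"
  shows "e \<le> i"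
proof (rule ccontr)
  assume "\<not> e \<le> i"
  then obtain l where l: "e = Suc l" "i \<le> l" by (cases e) auto
  have "r ^ i \<le> real p * r ^ i" using rpow_le_mult[OF assms(1)] .
  moreover have "r ^ l \<le> r ^ i" using l rpow_le_iff by simp
  ultimately have "r ^ l \<le> (real q - 1) * r ^ Suc l" using assms(2) unfolding l(1) by linarith
  then show False unfolding q1_rpow using rpow_pos[of "Suc l"] by simp
qed

lemma low_le_q1:
  assumes "p < q"
  shows "real p * r ^ i \<le> (real q - 1) * r ^ i"
  unfolding real_q1 using assms by (intro rpow_mult_mono) simp

lemma low_gt:
  assumes "1 \<le> p"
  shows "(real q - 1) * r ^ Suc i < real p * r ^ i"
  unfolding q1_rpow using rpow_le_mult[OF assms, of i] rpow_pos[of "Suc i"] by linarith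

lemma grid_less_q:
  assumes "grid k c" "c < real q"
  obtains i p where "i \<le> k" "1 \<le> p" "p < q" "c = real p * r ^ i" "r ^ k < c" "c \<le> real q - 1"
proof -
  obtain i p where c: "i \<le> k" "1 \<le> p" "p < q" "c = real p * r ^ i" "r ^ k < c"
    using assms unfolding grid_low by auto
  have "c \<le> (real q - 1) * r ^ 0" using low_le_q1[OF c(3), of i] q1_rpow_mono[of 0 i] unfolding c(4) by linarith
  then show ?thesis using that c by simp
qed

lemma grid_less_q_le: "grid k c \<Longrightarrow> c < real q \<Longrightarrow> c \<le> real q - 1"
  by (elim grid_less_q)

lemma state_pos_cases:
  assumes "0 < c" "state k e c"
  obtains i p where "i \<le> k" "1 \<le> p" "p < q" "c = real p * r ^ i" "r ^ k < c" "e \<le> i"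
proof -
  have g: "grid k c" "c \<le> (real q - 1) * r ^ e" using assms state_pos by auto
  have "(real q - 1) * r ^ e \<le> real q - 1" using q1_rpow_mono[of 0 e] by simp
  then have "c < real q" using g(2) by linarith
  then obtain i p where c: "i \<le> k" "1 \<le> p" "p < q" "c = real p * r ^ i" "r ^ k < c"
    using grid_less_q[OF g(1)] by metis
  then show ?thesis using that low_le_level[of p i e] g(2) by simp
qed

lemma state_next_state:
  assumes "state k e c"
  shows "state k (fst (next_state k (e, c))) (snd (next_state k (e, c)))"
proof -
  consider (z) "c = 0" "e \<le> k" | (z') "c = 0" "e = Suc k" | (n) "c < 0" | (p) "0 < c" "c \<le> (real q - 1) * r ^ Suc e"
    | (x) "0 < c" "(real q - 1) * r ^ Suc e < c"
    using assms unfolding state_def by linarith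
  then show ?thesis
  proof cases
    case z
    then show ?thesis unfolding next_state_def state_def by simp
  next
    case z'
    have "grid k (2 * r ^ k)" unfolding grid_def using q_ge_2 by (intro exI[of _ k] exI[of _ 1]) simp
    then show ?thesis using z' grid_bounds(2)[of k "2 * r ^ k"] unfolding next_state_def state_def by auto
  next
    case n
    then have "grid k (c + real q)" "c + real q < real q" using assms unfolding state_def by auto
    then have "c + real q \<le> real q - 1" "0 < c + real q"
      using grid_less_q_le[of k "c + real q"] grid_bounds(1)[of k "c + real q"] rpow_pos[of k] by linarith+
    then show ?thesis using n \<open>grid k (c + real q)\<close> unfolding next_state_def state_def by simp
  next
    case p
    then show ?thesis using assms unfolding next_state_def state_def by auto
  next
    case x
    obtain i p where c: "i \<le> k" "1 \<le> p" "p < q" "c = real p * r ^ i" "r ^ k < c" "e \<le> i"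
      using state_pos_cases[OF x(1) assms] .
    \<comment> \<open>The lines leave upwards exactly in square \<open>e = i\<close>, where the
      return adds \<open>r ^ i\<close>: the digit \<open>p\<close> of the offset becomes
      \<open>p + 1\<close>.\<close>
    have "\<not> Suc e \<le> i" using x(2) low_le_q1[OF c(3), of i] q1_rpow_mono[of "Suc e" i] c(4) by linarith
    then have i: "i = e" using c(6) by simp
    have g: "grid k (c + r ^ e)" unfolding grid_def c(4) i using c(1-3) i
      by (intro exI[of _ e] exI[of _ p]) (simp add: algebra_simps)
    then show ?thesis using x grid_bounds(2)[OF g] unfolding next_state_def state_def by auto
  qed
qed

lemma state_valid:
  assumes "state k e c" "\<xi> \<in> band k"
  shows "valid e (c - \<xi>)"
proof -
  have xi: "0 < \<xi>" "\<xi> \<le> r ^ k" using assms band_pos band_iff by auto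
  have q: "0 < (real q - 1) * r ^ e" "0 < real q * r ^ e" using q1_rpow_ge[of e] rpow_pos[of e] Q_ge_2 by (linarith, simp)
  consider (p) "0 < c" | (z) "c = 0" | (n) "c < 0" by linarith
  then show ?thesis
  proof cases
    case p
    then show ?thesis using assms(1) grid_bounds(1)[of k c] xi q unfolding state_pos[OF p] valid_def by linarith
  next
    case z
    then have "e \<le> Suc k" using assms(1) unfolding state_def by simp
    then have "r ^ k \<le> real q * r ^ e"
      using q_rpow[of k] mult_left_mono[of "r ^ Suc k" "r ^ e" "real q"] rpow_le_iff[of "Suc k" e] by simp
    then show ?thesis using z xi q unfolding valid_def by simp
  next
    case n
    then have "e = 0" "grid k (c + real q)" using assms(1) unfolding state_def by auto
    then show ?thesis using n xi q grid_bounds(1)[of k "c + real q"] unfolding valid_def by auto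
  qed
qed

text \<open>The branches of \<open>next_state\<close> match the three ways of leaving a square; the
  point is that the labels of a whole band lie on one side of each threshold, so the family is never
  split.\<close>

lemma state_glue:
  assumes "state k e c" "\<xi> \<in> band k"
  shows "cls (lpt e (c - \<xi>) (r ^ e)) = cls (lpt (fst (next_state k (e, c))) (snd (next_state k (e, c)) - \<xi>) 0)"
proof -
  have xi: "0 < \<xi>" "r ^ Suc k \<le> \<xi>" "\<xi> \<le> r ^ k" using assms band_pos band_iff by auto
  have va: "- (real q * r ^ e) \<le> c - \<xi>" "c - \<xi> \<le> (real q - 1) * r ^ e"
    using state_valid[OF assms] unfolding valid_def by auto
  consider (z) "c = 0" "e \<le> k" | (z') "c = 0" "e = Suc k" | (n) "c < 0" | (p) "0 < c" "c \<le> (real q - 1) * r ^ Suc e"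
    | (x) "0 < c" "(real q - 1) * r ^ Suc e < c"
    using assms(1) unfolding state_def by linarith
  then show ?thesis
  proof cases
    case z
    then have "r ^ k \<le> r ^ e" using rpow_le_iff by simp
    moreover have "0 < (real q - 1) * r ^ Suc e" using q1_rpow_ge[of "Suc e"] rpow_pos[of "Suc e"] by linarith
    ultimately have "cls (lpt e (c - \<xi>) (r ^ e)) = cls (lpt (Suc e) (c - \<xi>) 0)"
      using glue_next[of e "c - \<xi>"] z xi by simp
    then show ?thesis using z unfolding next_state_def by simp
  next
    case z'
    then have "cls (lpt e (c - \<xi>) (r ^ e)) = cls (lpt 0 (c - \<xi> + 2 * real q * r ^ e - real q) 0)"
      using glue_exit_low[OF va(1)] xi by simp
    moreover have "c - \<xi> + 2 * real q * r ^ e - real q = 2 * r ^ k - real q - \<xi>"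
      using z' q_rpow[of k] by (simp add: mult.assoc)
    ultimately have "cls (lpt e (c - \<xi>) (r ^ e)) = cls (lpt 0 (2 * r ^ k - real q - \<xi>) 0)" by simp
    then show ?thesis using z' next_state_simps(2)[of k e] by simp
  next
    case n
    then have e: "e = 0" and g: "grid k (c + real q)" using assms(1) unfolding state_def by auto
    have "c + real q \<le> real q - 1" using n grid_less_q_le[OF g] by simp
    then have "cls (lpt e (c - \<xi>) (r ^ e)) = cls (lpt 0 (c - \<xi> + 2 * real q * r ^ e - real q) 0)"
      using glue_exit_low[OF va(1)] xi e by simp
    then show ?thesis using n e unfolding next_state_def by (simp add: algebra_simps)
  next
    case p
    have "0 < c - \<xi>" using p assms(1) grid_bounds(1)[of k c] xi unfolding state_pos[OF p(1)] by linarith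
    then have "cls (lpt e (c - \<xi>) (r ^ e)) = cls (lpt (Suc e) (c - \<xi>) 0)"
      using glue_next[of e "c - \<xi>"] p xi rpow_pos[of e] by simp
    then show ?thesis using p unfolding next_state_def by simp
  next
    case x
    obtain i p where c: "i \<le> k" "1 \<le> p" "p < q" "c = real p * r ^ i" "r ^ k < c" "e \<le> i"
      using state_pos_cases[OF x(1) assms(1)] .
    have "\<not> Suc e \<le> i" using x(2) low_le_q1[OF c(3), of i] q1_rpow_mono[of "Suc e" i] c(4) by linarith
    then have i: "i = e" using c(6) by simp
    \<comment> \<open>Digit 1 is the tight case: \<open>c = r ^ e\<close> exceeds
      \<open>r ^ k\<close>, hence \<open>e < k\<close>, and \<open>\<xi>\<close> removes at most
      \<open>r ^ Suc e\<close>.\<close>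
    have "(real q - 1) * r ^ Suc e \<le> c - \<xi>"
    proof (cases "p = 1")
      case True
      then have "e < k" using c i by (simp add: rpow_less_iff)
      then have "r ^ k \<le> r ^ Suc e" using rpow_le_iff by simp
      then show ?thesis unfolding q1_rpow using c i True xi by simp
    next
      case False
      then have "2 * r ^ e \<le> c" using rpow_mult_mono[of 2 p e] c i by simp
      moreover have "r ^ k \<le> r ^ e" using c i rpow_le_iff by simp
      ultimately show ?thesis unfolding q1_rpow using xi rpow_pos[of "Suc e"] by linarith
    qed
    then have "cls (lpt e (c - \<xi>) (r ^ e)) = cls (lpt 0 (c - \<xi> + r ^ e - real q) 0)"
      using glue_exit_high va by simp
    then show ?thesis using x unfolding next_state_def by (simp add: algebra_simps)
  qed
qed

section \<open>The states of one cylinder form a single cycle\<close>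

definition orbit :: "nat \<Rightarrow> nat \<Rightarrow> nat \<times> real" where "orbit k t = (next_state k ^^ t) (0, 0)"

lemma orbit_0 [simp]: "orbit k 0 = (0, 0)" by (simp add: orbit_def)

lemma orbit_Suc: "orbit k (Suc t) = next_state k (orbit k t)" by (simp add: orbit_def)

lemma orbit_add: "orbit k (s + t) = (next_state k ^^ s) (orbit k t)" by (simp add: orbit_def funpow_add)

lemma state_orbit: "state k (fst (orbit k t)) (snd (orbit k t))"
proof (induction t)
  case 0
  then show ?case by (simp add: state_def)
next
  case (Suc t)
  then show ?case using state_next_state[OF Suc] by (simp add: orbit_Suc)
qed

definition reached :: "nat \<Rightarrow> nat \<times> real \<Rightarrow> bool" where "reached k s \<longleftrightarrow> (\<exists>t>0. orbit k t = s)"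

lemma reached_next_state: "reached k s \<Longrightarrow> reached k (next_state k s)"
  unfolding reached_def by (metis orbit_Suc zero_less_Suc)

lemma reached_start: "reached k (0, 2 * r ^ k - real q)"
proof -
  have "orbit k e = (e, 0)" if "e \<le> Suc k" for e
    using that by (induction e) (simp_all add: orbit_Suc next_state_def)
  then have "orbit k (Suc (Suc k)) = (0, 2 * r ^ k - real q)" by (simp add: orbit_Suc next_state_def)
  then show ?thesis unfolding reached_def by blast
qed

text \<open>One step of counting: after a passage of the first square that removes the shift by
  \<open>- q\<close>, the lines go through squares 0 to \<open>i\<close> with offset
  \<open>p * r ^ i\<close> and return with the next digit.\<close>

lemma reached_level:
  assumes "reached k (0, real p * r ^ i - real q)" "1 \<le> p" "p < q"
  shows "e \<le> i \<Longrightarrow> reached k (e, real p * r ^ i)" "reached k (0, real (Suc p) * r ^ i - real q)"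
proof -
  let ?c = "real p * r ^ i"
  have c0: "0 < ?c" using assms(2) by simp
  have "?c \<le> (real q - 1) * r ^ 0" using low_le_q1[OF assms(3), of i] q1_rpow_mono[of 0 i] by linarith
  then have cq: "?c < real q" by simp
  then have 0: "reached k (0, ?c)" using reached_next_state[OF assms(1)] cq by (simp add: next_state_simps(3))
  show *: "reached k (e, ?c)" if "e \<le> i" for e
    using that
  proof (induction e)
    case (Suc e)
    have "?c \<le> (real q - 1) * r ^ Suc e"
      using low_le_q1[OF assms(3), of i] q1_rpow_mono[of "Suc e" i] Suc.prems by linarith
    then show ?case using reached_next_state[OF Suc.IH] Suc.prems next_state_simps(4)[OF c0, of e k] by simp
  qed (rule 0)
  have "next_state k (i, ?c) = (0, real (Suc p) * r ^ i - real q)"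
    using next_state_simps(5)[OF c0 low_gt[OF assms(2)], of k] by (simp add: algebra_simps)
  then show "reached k (0, real (Suc p) * r ^ i - real q)" using reached_next_state[OF *[of i]] by simp
qed

text \<open>Counting starts at \<open>2 * r ^ k\<close>. When digit \<open>q\<close> is reached in
  position \<open>Suc i\<close>, the carry is digit 1 in position \<open>i\<close>; hence the
  induction on \<open>k - i\<close>.\<close>

lemma reached_grid: 
  assumes "i \<le> k" "1 \<le> n" "n < q"
  shows "reached k (0, real (Suc n) * r ^ i - real q)"
  using assms
proof (induction "k - i" arbitrary: i n)
  case 0
  then have i: "i = k" by simp
  from \<open>1 \<le> n\<close> \<open>n < q\<close> show ?case
  proof (induction n rule: dec_induct)
    case base
    then show ?case using reached_start i by simp
  next
    case (step m)
    then show ?case using reached_level(2)[of k "Suc m" i] by simp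
  qed
next
  case (Suc d)
  have "reached k (0, real (Suc (q - 1)) * r ^ Suc i - real q)"
    using Suc.hyps(1)[of "Suc i" "q - 1"] Suc.hyps(2) q_ge_2 by simp
  then have r: "reached k (0, real 1 * r ^ i - real q)" using q_rpow[of i] q_ge_2 by simp
  from \<open>1 \<le> n\<close> \<open>n < q\<close> show ?case
  proof (induction n rule: dec_induct)
    case base
    then show ?case using reached_level(2)[OF r] q_ge_2 by simp
  next
    case (step m)
    then show ?case using reached_level(2)[of k "Suc m" i] by simp
  qed
qed

lemma reached_zero: "reached k (0, 0)"
  using reached_grid[of 0 k "q - 1"] q_ge_2 by simp

text \<open>All states with the same \<open>k\<close> lie on one orbit, so each \<open>k\<close>
  gives one cylinder rather than several.\<close>

lemma reached_state:
  assumes "state k e c"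
  shows "reached k (e, c)"
proof -
  have grid: "reached k (0, c' - real q)" if "grid k c'" for c' using that reached_grid unfolding grid_def by auto
  consider (p) "0 < c" | (z) "c = 0" | (n) "c < 0" by linarith
  then show ?thesis
  proof cases
    case p
    obtain i p where c: "i \<le> k" "1 \<le> p" "p < q" "c = real p * r ^ i" "r ^ k < c" "e \<le> i"
      using state_pos_cases[OF p assms] .
    have "reached k (0, c - real q)" using assms grid state_pos[OF p] by blast
    then show ?thesis using reached_level(1)[of k p i e] c by simp
  next
    case z
    then have "e \<le> Suc k" using assms unfolding state_def by simp
    then have "reached k (e, 0)"
    proof (induction e)
      case (Suc e)
      then show ?case using reached_next_state[of k "(e, 0)"] unfolding next_state_def by simp
    qed (rule reached_zero)
    then show ?thesis using z by simp
  next
    case n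
    then show ?thesis using assms grid[of "c + real q"] unfolding state_def by simp
  qed
qed

definition period :: "nat \<Rightarrow> nat" where "period k = (LEAST n. 0 < n \<and> orbit k n = (0, 0))"

lemma period: "0 < period k" "orbit k (period k) = (0, 0)"
proof -
  have "\<exists>n. 0 < n \<and> orbit k n = (0, 0)" using reached_zero unfolding reached_def by blast
  from LeastI_ex[OF this] show "0 < period k" "orbit k (period k) = (0, 0)" unfolding period_def by auto
qed

lemma orbit_period: "orbit k (t + period k) = orbit k t"
  using orbit_add[of k t "period k"] period(2) by (simp add: orbit_def)

lemma orbit_period_mult: "orbit k (t + j * period k) = orbit k t"
proof (induction j)
  case (Suc j)
  have "t + Suc j * period k = (t + j * period k) + period k" by simp
  then show ?case using orbit_period[of k "t + j * period k"] Suc by (metis)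
qed simp

lemma orbit_mod: "orbit k (t mod period k) = orbit k t"
  using orbit_period_mult[of k "t mod period k" "t div period k"] by (simp add: add.commute mult.commute)

text \<open>Two equal states, moved forward to the end of the period, would bring back
  \<open>(0, 0)\<close> too early.\<close>

lemma orbit_inj:
  assumes "orbit k s = orbit k t" "s < period k" "t < period k"
  shows "s = t"
proof (rule ccontr)
  assume "s \<noteq> t"
  have *: False if "orbit k s = orbit k t" "s < t" "t < period k" for s t
  proof -
    have "orbit k ((period k - t) + s) = orbit k ((period k - t) + t)" unfolding orbit_add that(1) ..
    then have "orbit k (period k - t + s) = (0, 0)" using that(3) period(2) by simp
    moreover have "0 < period k - t + s" "period k - t + s < period k" using that by auto
    ultimately show False using not_less_Least[of "period k - t + s" "\<lambda>n. 0 < n \<and> orbit k n = (0, 0)"]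
      unfolding period_def[symmetric] by simp
  qed
  show False using *[of s t] *[of t s] assms \<open>s \<noteq> t\<close> by (metis nat_neq_iff)
qed

text \<open>The excluded labels are those of the spine: 0 in every square, and \<open>- q\<close> in
  the first square, which becomes 0 after one passage.\<close>

lemma label_cover:
  assumes "valid e l" "l \<noteq> 0" "\<not> (e = 0 \<and> l = - real q)"
  shows "\<exists>k c \<xi>. state k e c \<and> \<xi> \<in> band k \<and> l = c - \<xi>"
proof (cases "0 < l")
  case True
  have lu: "l < (real q - 1) * r ^ e" using assms unfolding valid_def by simp
  have "(real q - 1) * r ^ e \<le> real q - 1" using q1_rpow_mono[of 0 e] by simp
  then have "l < real q" using lu by linarith
  then obtain k i n \<xi> where c: "grid k (real (Suc n) * r ^ i)" "\<xi> \<in> band k" "l = real (Suc n) * r ^ i - \<xi>"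
    "1 \<le> n" "n < q" "real n * r ^ i \<le> l" "l < real (Suc n) * r ^ i"
    using grid_cover[OF True] by metis
  have ei: "e \<le> i" using low_le_level[of n i e] c lu by linarith
  \<comment> \<open>In position \<open>e\<close> the bound on the label leaves room for one more
    digit step; in later positions the rounded value is at most \<open>r ^ e\<close>.\<close>
  have "real (Suc n) * r ^ i \<le> (real q - 1) * r ^ e"
  proof (cases "i = e")
    case True
    then have "real n * r ^ i < real (q - 1) * r ^ i" using c(6) lu unfolding real_q1 True by linarith
    then have "real n < real (q - 1)" using mult_less_cancel_right_pos[OF rpow_pos[of i]] by blast
    then have "n < q - 1" by simp
    then show ?thesis unfolding real_q1 True by (intro rpow_mult_mono) simp
  next
    case False
    then obtain d where d: "i = Suc d" "e \<le> d" using ei by (cases i) auto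
    have "real (Suc n) * r ^ i \<le> real q * r ^ i" using c(5) by (intro rpow_mult_mono) simp
    also have "\<dots> = r ^ d" unfolding d q_rpow ..
    also have "\<dots> \<le> r ^ e" using d rpow_le_iff by simp
    also have "\<dots> \<le> (real q - 1) * r ^ e" by (rule q1_rpow_ge)
    finally show ?thesis .
  qed
  moreover have "0 < real (Suc n) * r ^ i" using True c(7) by linarith
  ultimately have "state k e (real (Suc n) * r ^ i)" using c(1) state_pos by blast
  then show ?thesis using c by blast
next
  case False
  then have l0: "l < 0" using assms by simp
  show ?thesis
  proof (cases e)
    case 0
    then have "0 < l + real q" "l + real q < real q" using assms l0 unfolding valid_def by auto
    then obtain k i n \<xi> where c: "grid k (real (Suc n) * r ^ i)" "\<xi> \<in> band k" "l + real q = real (Suc n) * r ^ i - \<xi>"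
      using grid_cover by metis
    have "real (Suc n) * r ^ i \<le> real q" using grid_bounds(2)[OF c(1)] .
    then have "state k e (real (Suc n) * r ^ i - real q)" using c(1) 0 unfolding state_def by auto
    then show ?thesis using c by (intro exI[of _ k] exI[of _ "real (Suc n) * r ^ i - real q"] exI[of _ \<xi>]) simp
  next
    case (Suc d)
    have "- l \<le> r ^ d" using assms(1) unfolding valid_def Suc q_rpow by simp
    moreover obtain k where k: "- l \<in> band k" "r ^ Suc k < - l"
      using band_exists[of "- l"] l0 \<open>- l \<le> r ^ d\<close> rpow_le_1[of d] by auto
    ultimately have "d < Suc k" using rpow_less_iff[of "Suc k" d] by linarith
    then have "state k e 0" unfolding state_def Suc by simp
    then show ?thesis using k by (intro exI[of _ k] exI[of _ 0] exI[of _ "- l"]) simp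
  qed
qed

subsection \<open>Developing the cylinders\<close>


definition fline :: "real \<Rightarrow> real \<Rightarrow> real^2" where "fline u x = pt x ((u + real q * x) / N)"

definition fvec :: "real \<Rightarrow> real^2" where "fvec a = pt a (a * real q / N)"

lemma fline_nth [simp]: "fline u x $ 1 = x" by (simp add: fline_def)

lemma fvec_nth [simp]: "fvec a $ 1 = a" by (simp add: fvec_def)

lemma lab_fline [simp]: "lab (fline u x) = u"
  using N_pos by (simp add: lab_def fline_def)

lemma lab_fvec [simp]: "lab (fvec a) = 0"
  using N_pos by (simp add: lab_def fvec_def)

lemma fline_lab: "fline (lab z) (z $ 1) = z"
proof -
  have "fline (lab z) (z $ 1) = pt (z $ 1) (z $ 2)"
    using N_pos by (simp add: lab_def fline_def)
  then show ?thesis using pt_eta[of z] by simp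
qed

lemma fline_eqI: "lab z = u \<Longrightarrow> z $ 1 = x \<Longrightarrow> z = fline u x"
  using fline_lab[of z] by simp

lemma fline_add: "fline u x + fvec a = fline u (x + a)"
  by (rule fline_eqI) (simp_all add: lab_add)

lemma fvec_add: "fvec a + fvec b = fvec (a + b)"
  by (simp add: fvec_def pt_add add_divide_distrib ring_distribs)

lemma fvec_scale: "s *\<^sub>R fvec a = fvec (s * a)"
  by (simp add: fvec_def pt_scaleR)

lemma fvec_0 [simp]: "fvec 0 = 0"
  by (simp add: fvec_def pt_zero)

definition ix :: "nat \<Rightarrow> nat \<Rightarrow> nat" where "ix k t = fst (orbit k t)"
definition off :: "nat \<Rightarrow> nat \<Rightarrow> real" where "off k t = snd (orbit k t)"

text \<open>Labels at the start \<open>(0, 0)\<close> of the orbit. There the offset is 0, so a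
  label is minus the defect; later labels are obtained by adding \<open>off\<close>.\<close>

definition labels :: "nat \<Rightarrow> real set" where "labels k = {- (r ^ k) .. - (r ^ Suc k)}"
definition labels_int :: "nat \<Rightarrow> real set" where "labels_int k = {- (r ^ k) <..< - (r ^ Suc k)}"

lemma labels_iff: "u \<in> labels k \<longleftrightarrow> - u \<in> band k"
  unfolding labels_def band_iff by auto

lemma state_ix: "state k (ix k t) (off k t)"
  unfolding ix_def off_def by (rule state_orbit)

lemma tower_cyl: "tower (ix k) (off k) (labels k)"
  unfolding tower_def
proof (intro allI ballI conjI)
  fix t u assume "u \<in> labels k"
  then have u: "- u \<in> band k" using labels_iff by simp
  show "valid (ix k t) (off k t + u)" using state_valid[OF state_ix u] by simp
  have "next_state k (ix k t, off k t) = (ix k (Suc t), off k (Suc t))"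
    unfolding ix_def off_def orbit_Suc by simp
  then show "cls (lpt (ix k t) (off k t + u) (r ^ ix k t)) = cls (lpt (ix k (Suc t)) (off k (Suc t) + u) 0)"
    using state_glue[OF state_ix u, of t] by simp
qed

lemma state_level:
  assumes "state k e c"
  shows "e \<le> Suc k"
proof -
  consider "0 < c" | "c \<le> 0" by linarith
  then show ?thesis
  proof cases
    case 1
    show ?thesis using state_pos_cases[OF 1 assms] by (metis le_SucI le_trans)
  next
    case 2
    then show ?thesis using assms unfolding state_def by auto
  qed
qed

text \<open>The orbit stays in squares up to index \<open>Suc k\<close>, so each step advances by at
  least \<open>r ^ Suc k\<close>.\<close>

lemma pos_unbounded: "\<exists>T. x < pos (ix k) T"
proof -
  have "real t * r ^ Suc k \<le> pos (ix k) t" for t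
  proof (induction t)
    case (Suc t)
    have "r ^ Suc k \<le> r ^ ix k t" using state_level[OF state_ix] rpow_le_iff by simp
    then show ?case using Suc by (simp add: pos_Suc algebra_simps)
  qed simp
  moreover obtain t where "x < real t * r ^ Suc k" using reals_Archimedean3[OF rpow_pos[of "Suc k"]] by blast
  ultimately show ?thesis by (metis order_less_le_trans)
qed

definition width :: "nat \<Rightarrow> real" where "width k = pos (ix k) (period k)"

lemma width_pos: "0 < width k"
  unfolding width_def using pos_less_iff[of "ix k" 0 "period k"] period(1) by simp

lemma pos_period: "pos (ix k) (t + period k) = pos (ix k) t + width k"
proof (induction t)
  case (Suc t)
  have "ix k (t + period k) = ix k t" unfolding ix_def orbit_period ..
  then show ?case using Suc by (simp add: pos_Suc)
qed (simp add: width_def)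

lemma tower_map_period:
  assumes "0 \<le> z $ 1"
  shows "tower_map (ix k) (off k) (z + fvec (width k)) = tower_map (ix k) (off k) z"
proof -
  obtain T where "z $ 1 < pos (ix k) T" using pos_unbounded by blast
  then obtain t where t: "pos (ix k) t \<le> z $ 1" "z $ 1 < pos (ix k) (Suc t)"
    using pos_exists[OF assms] by metis
  have "ix k (t + period k) = ix k t" "off k (t + period k) = off k t" unfolding ix_def off_def orbit_period by simp_all
  then show ?thesis
    using tower_map_eq[OF t, of "off k"] tower_map_eq[of "ix k" "t + period k" "z + fvec (width k)" "off k"] t
      pos_period[of k t] pos_period[of k "Suc t"] by (simp add: lab_add)
qed

lemma tower_map_period_nat:
  assumes "0 \<le> z $ 1"
  shows "tower_map (ix k) (off k) (z + fvec (real j * width k)) = tower_map (ix k) (off k) z"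
proof (induction j)
  case (Suc j)
  have e: "z + fvec (real (Suc j) * width k) = (z + fvec (real j * width k)) + fvec (width k)"
    unfolding add.assoc fvec_add by (simp add: algebra_simps)
  have "0 \<le> (z + fvec (real j * width k)) $ 1" using assms width_pos[of k] by simp
  then show ?case unfolding e using tower_map_period[of "z + fvec (real j * width k)" k] Suc by simp
qed simp

text \<open>The unfolding is only meaningful from abscissa 0 on. The summand 1 moves the argument
  into \<open>[width k, 2 * width k)\<close>, off the wall at 0, and makes the map periodic on the
  whole line.\<close>

definition cyl_map :: "nat \<Rightarrow> real^2 \<Rightarrow> (real^2) set" where
  "cyl_map k z = tower_map (ix k) (off k) (z + fvec (of_int (1 - \<lfloor>z $ 1 / width k\<rfloor>) * width k))"

lemma floor_width: "of_int \<lfloor>x / width k\<rfloor> * width k \<le> x" "x < of_int \<lfloor>x / width k\<rfloor> * width k + width k"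
proof -
  have "of_int \<lfloor>x / width k\<rfloor> \<le> x / width k" "x / width k < of_int \<lfloor>x / width k\<rfloor> + 1" by linarith+
  then show "of_int \<lfloor>x / width k\<rfloor> * width k \<le> x" "x < of_int \<lfloor>x / width k\<rfloor> * width k + width k"
    using width_pos[of k] by (simp_all only: pos_le_divide_eq pos_divide_less_eq) (simp add: algebra_simps)
qed

lemma cyl_map_eq:
  assumes "0 \<le> z $ 1 + of_int j * width k"
  shows "cyl_map k z = tower_map (ix k) (off k) (z + fvec (of_int j * width k))"
proof -
  have *: "tower_map (ix k) (off k) (z + fvec (of_int i * width k)) = tower_map (ix k) (off k) (z + fvec (of_int j * width k))"
    if "0 \<le> z $ 1 + of_int i * width k" "i \<le> j" for i j
  proof -
    have "of_int j * width k = of_int i * width k + real (nat (j - i)) * width k"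
      using that(2) by (simp add: algebra_simps)
    then have e: "z + fvec (of_int j * width k) = (z + fvec (of_int i * width k)) + fvec (real (nat (j - i)) * width k)"
      by (simp add: add.assoc fvec_add)
    show ?thesis unfolding e using tower_map_period_nat[of "z + fvec (of_int i * width k)" k "nat (j - i)"] that(1) by simp
  qed
  define i where "i = 1 - \<lfloor>z $ 1 / width k\<rfloor>"
  have i: "0 \<le> z $ 1 + of_int i * width k"
    using floor_width(1)[where x = "z $ 1" and k = k] width_pos[of k] unfolding i_def by (simp add: algebra_simps)
  have "tower_map (ix k) (off k) (z + fvec (of_int i * width k)) = tower_map (ix k) (off k) (z + fvec (of_int j * width k))"
    using *[OF i, of j] *[OF assms, of i] linear[of i j] by metis
  then show ?thesis unfolding cyl_map_def i_def .
qed

lemma width_reach: "\<exists>j::int. b < x + of_int j * width k"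
proof -
  have "x + of_int (1 - \<lfloor>(x - b) / width k\<rfloor>) * width k > b"
    using floor_width(1)[where x = "x - b" and k = k] width_pos[of k] by (simp add: algebra_simps)
  then show ?thesis by blast
qed

lemma cyl_map_shift: "cyl_map k (z + fvec (of_int j * width k)) = cyl_map k z"
proof -
  obtain i where i: "0 < (z + fvec (of_int j * width k)) $ 1 + of_int i * width k" using width_reach by blast
  have "z + fvec (of_int j * width k) + fvec (of_int i * width k) = z + fvec (of_int (j + i) * width k)"
    by (simp add: add.assoc fvec_add algebra_simps)
  then show ?thesis
    using cyl_map_eq[of "z + fvec (of_int j * width k)" i k] cyl_map_eq[of z "j + i" k] i by (simp add: algebra_simps)
qed

definition strip :: "nat \<Rightarrow> (real^2) set" where "strip k = {z. lab z \<in> labels k}"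
definition strip_int :: "nat \<Rightarrow> (real^2) set" where "strip_int k = {z. lab z \<in> labels_int k}"

lemma strip_iff: "z \<in> strip k \<longleftrightarrow> - lab z \<in> band k"
  unfolding strip_def labels_iff by simp

lemma strip_bounds: "z \<in> strip k \<longleftrightarrow> - (r ^ k) \<le> lab z \<and> lab z \<le> - (r ^ Suc k)"
  unfolding strip_def labels_def by simp

lemma strip_int_bounds: "z \<in> strip_int k \<longleftrightarrow> - (r ^ k) < lab z \<and> lab z < - (r ^ Suc k)"
  unfolding strip_int_def labels_int_def by simp

lemma strip_int_strip: "z \<in> strip_int k \<Longrightarrow> z \<in> strip k"
  unfolding strip_int_bounds strip_bounds by simp

lemma cyl_map_nhd:
  assumes "z \<in> strip k"
  shows "nhd (cyl_map k) (strip k) z"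
proof -
  obtain j where j: "0 < z $ 1 + of_int j * width k" using width_reach by blast
  define z' where "z' = z + fvec (of_int j * width k)"
  have z': "lab z' \<in> labels k" "0 < z' $ 1" using assms j unfolding z'_def strip_def by (simp_all add: lab_add)
  obtain T where T: "z' $ 1 < pos (ix k) T" using pos_unbounded by blast
  obtain F \<epsilon> where F: "finite F" "0 < \<epsilon>" "\<And>v. norm v < \<epsilon> \<Longrightarrow> lab (z' + v) \<in> labels k \<Longrightarrow>
      (\<exists>x\<in>F. tower_map (ix k) (off k) z' = cls x \<and> tower_map (ix k) (off k) (z' + v) = cls (x + v) \<and> x + v \<in> Pbar)"
    using tower_map_nhd[OF tower_cyl z' T] by blast
  have "\<exists>x\<in>F. cyl_map k z = cls x \<and> cyl_map k (z + v) = cls (x + v) \<and> x + v \<in> Pbar"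
    if v: "norm v < min \<epsilon> (z' $ 1)" "z + v \<in> strip k" for v
  proof -
    have "z' + v = z + v + fvec (of_int j * width k)" unfolding z'_def by simp
    moreover have "0 \<le> (z + v) $ 1 + of_int j * width k" using comp_less[OF v(1)] unfolding z'_def by auto
    ultimately have "cyl_map k (z + v) = tower_map (ix k) (off k) (z' + v)" using cyl_map_eq[of "z + v" j k] by metis
    moreover have "cyl_map k z = tower_map (ix k) (off k) z'" unfolding z'_def using j by (intro cyl_map_eq) simp
    moreover have "lab (z' + v) \<in> labels k" using v(2) unfolding strip_def z'_def by (simp add: lab_add)
    ultimately show ?thesis using F(3)[of v] v(1) by simp
  qed
  then show ?thesis unfolding nhd_def using F z' by (intro exI[of _ F] exI[of _ "min \<epsilon> (z' $ 1)"]) simp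
qed

lemma cyl_map_devel: "devel (cyl_map k) {z \<in> strip k. cyl_map k z \<noteq> arm_sing r}"
  unfolding devel_def
proof
  fix z assume "z \<in> {z \<in> strip k. cyl_map k z \<noteq> arm_sing r}"
  then show "\<exists>\<epsilon>>0. \<forall>v. norm v < \<epsilon> \<and> z + v \<in> {z \<in> strip k. cyl_map k z \<noteq> arm_sing r} \<longrightarrow> hop (cyl_map k z) v (cyl_map k (z + v))"
    using nhd_hop[OF cyl_map_nhd, of z k] by auto
qed

lemma cyl_map_rep:
  assumes "z \<in> strip k"
  shows "\<exists>t x. t < period k \<and> pos (ix k) t \<le> x \<and> x < pos (ix k) (Suc t) \<and>
    cyl_map k z = cls (lpt (ix k t) (off k t + lab z) (x - pos (ix k) t)) \<and> (\<exists>j::int. x = z $ 1 + of_int j * width k)"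
proof -
  let ?j = "- \<lfloor>z $ 1 / width k\<rfloor>"
  define x where "x = z $ 1 + of_int ?j * width k"
  have x: "0 \<le> x" "x < pos (ix k) (period k)"
    using floor_width[where x = "z $ 1" and k = k] unfolding x_def width_def[symmetric] by simp_all
  obtain t where t: "pos (ix k) t \<le> x" "x < pos (ix k) (Suc t)" "t < period k" using pos_exists[OF x] .
  have "cyl_map k z = tower_map (ix k) (off k) (z + fvec (of_int ?j * width k))" using x(1) unfolding x_def by (rule cyl_map_eq)
  then have "cyl_map k z = cls (lpt (ix k t) (off k t + lab z) (x - pos (ix k) t))"
    using tower_map_eq[of "ix k" t "z + fvec (of_int ?j * width k)" "off k"] t unfolding x_def by (simp add: lab_add)
  then show ?thesis using t x_def by blast
qed

lemma cyl_map_label: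
  assumes "z \<in> strip k"
  shows "\<exists>e c a. state k e c \<and> 0 \<le> a \<and> a < r ^ e \<and> valid e (c + lab z) \<and> cyl_map k z = cls (lpt e (c + lab z) a)"
proof -
  obtain t x where t: "pos (ix k) t \<le> x" "x < pos (ix k) (Suc t)"
    "cyl_map k z = cls (lpt (ix k t) (off k t + lab z) (x - pos (ix k) t))"
    using cyl_map_rep[OF assms] by blast
  moreover have "valid (ix k t) (off k t + lab z)" using tower_cyl assms unfolding tower_def strip_def by blast
  ultimately show ?thesis using state_ix[of k t] pos_Suc[of "ix k" t]
    by (intro exI[of _ "ix k t"] exI[of _ "off k t"] exI[of _ "x - pos (ix k) t"]) simp
qed

text \<open>A regular class determines its square and label, \<open>state_decomp\<close> splits the
  label into offset and strip coordinate, and a state occurs once per period.\<close>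

lemma cyl_map_inj:
  assumes "z \<in> strip k" "z' \<in> strip k" "cyl_map k z = cyl_map k z'" "cyl_map k z \<noteq> arm_sing r"
  shows "lab z = lab z' \<and> (\<exists>j::int. z' $ 1 = z $ 1 + of_int j * width k)"
proof -
  obtain t x j where t: "t < period k" "pos (ix k) t \<le> x" "x < pos (ix k) (Suc t)"
    "cyl_map k z = cls (lpt (ix k t) (off k t + lab z) (x - pos (ix k) t))" "x = z $ 1 + of_int j * width k"
    using cyl_map_rep[OF assms(1)] by blast
  obtain t' x' j' where t': "t' < period k" "pos (ix k) t' \<le> x'" "x' < pos (ix k) (Suc t')"
    "cyl_map k z' = cls (lpt (ix k t') (off k t' + lab z') (x' - pos (ix k) t'))" "x' = z' $ 1 + of_int j' * width k"
    using cyl_map_rep[OF assms(2)] by blast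
  have va: "valid (ix k t) (off k t + lab z)" "valid (ix k t') (off k t' + lab z')"
    using tower_cyl assms(1,2) unfolding tower_def strip_def by blast+
  have "ix k t = ix k t' \<and> off k t + lab z = off k t' + lab z' \<and> x - pos (ix k) t = x' - pos (ix k) t'"
    using label_unique[OF va(1) _ _ va(2), of "x - pos (ix k) t" "x' - pos (ix k) t'"] t t' assms(3,4)
    by (simp add: pos_Suc)
  then have eq: "ix k t = ix k t'" "off k t + lab z = off k t' + lab z'" "x - pos (ix k) t = x' - pos (ix k) t'" by auto
  have "state k (ix k t) (off k t')" using state_ix[of k t'] eq(1) by simp
  then have c: "off k t = off k t' \<and> - lab z = - lab z'"
    using state_decomp[OF state_ix[of k t], of "- lab z" k "off k t'" "- lab z'"] assms(1,2) eq(2) unfolding strip_iff by simp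
  then have "orbit k t = orbit k t'" using eq(1) unfolding ix_def off_def by (simp add: prod_eq_iff)
  then have "t = t'" using orbit_inj t t' by blast
  then have "z' $ 1 = z $ 1 + of_int (j - j') * width k" using eq(3) t(5) t'(5) by (simp add: algebra_simps)
  then show ?thesis using c by (intro conjI exI[of _ "j - j'"]) simp_all
qed

lemma state_in_image:
  assumes "state k e c" "\<xi> \<in> band k" "0 \<le> a" "a \<le> r ^ e"
  shows "\<exists>x. cyl_map k (fline (- \<xi>) x) = cls (lpt e (c - \<xi>) a) \<and> fline (- \<xi>) x \<in> strip k"
proof -
  obtain t where t: "orbit k t = (e, c)" using reached_state[OF assms(1)] unfolding reached_def by blast
  let ?z = "fline (- \<xi>) (pos (ix k) t + a)"
  have z: "lab ?z \<in> labels k" using assms(2) unfolding labels_iff by simp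
  have "ix k t = e" "off k t = c" using t unfolding ix_def off_def by auto
  then have "tower_map (ix k) (off k) ?z = cls (lpt e (c - \<xi>) a)"
    using tower_map_slab[OF tower_cyl z, of t] assms pos_Suc[of "ix k" t] by simp
  moreover have "cyl_map k ?z = tower_map (ix k) (off k) ?z"
    using cyl_map_eq[of ?z 0 k] assms(3) pos_nonneg[of "ix k" t] by simp
  ultimately show ?thesis using z unfolding strip_def by auto
qed

text \<open>Of the two labels that end in a vertex, the positive one is the lower end of a block,
  and so is \<open>q - 1\<close>, the other one for \<open>e = 0\<close> shifted by
  \<open>q\<close>. Thus only the offset 0 can meet a vertex.\<close>

lemma state_nonsing:
  assumes "state k e c" "0 < \<xi>" "\<xi> < r ^ k"
  shows "c - \<xi> \<noteq> (real q - 1) * r ^ Suc e" "c - \<xi> = - (r ^ e) \<Longrightarrow> c = 0 \<and> \<xi> = r ^ e"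
proof -
  have q1: "1 \<le> q - 1" "q - 1 < q" using q_ge_2 by auto
  show "c - \<xi> \<noteq> (real q - 1) * r ^ Suc e"
  proof (cases "0 < c")
    case True
    then have "grid k c" using assms(1) state_pos by blast
    then show ?thesis unfolding real_q1 using grid_avoid[OF _ assms(2,3) q1] by blast
  next
    case False
    moreover have "0 < (real q - 1) * r ^ Suc e" using q1_rpow_ge[of "Suc e"] rpow_pos[of "Suc e"] by linarith
    ultimately show ?thesis using assms(2) by linarith
  qed
  assume eq: "c - \<xi> = - (r ^ e)"
  consider "0 < c" | "c = 0" | "c < 0" by linarith
  then show "c = 0 \<and> \<xi> = r ^ e"
  proof cases
    case 1
    then have "r ^ k < c" using assms(1) state_pos grid_bounds(1) by blast
    then show ?thesis using eq assms(3) rpow_pos[of e] by linarith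
  next
    case 3
    then have "e = 0" "grid k (c + real q)" using assms(1) unfolding state_def by auto
    then have "c + real q - \<xi> \<noteq> real (q - 1) * r ^ 0" using grid_avoid[OF _ assms(2,3) q1] by blast
    then show ?thesis using eq \<open>e = 0\<close> q_ge_2 by (simp add: of_nat_diff)
  qed (use eq in simp)
qed

text \<open>Strictly between the two vertical sides of a square every flow point is regular, so a
  singular value sits on a wall, where it is read as the right end of the preceding slab; hence
  \<open>Suc i\<close>.\<close>

lemma cyl_map_sing_slab:
  assumes "z \<in> strip k" "cyl_map k z = arm_sing r"
  shows "\<exists>i. (\<exists>j::int. z $ 1 = pos (ix k) (Suc i) + of_int j * width k) \<and>
    (off k i + lab z = - (r ^ ix k i) \<or> off k i + lab z = (real q - 1) * r ^ Suc (ix k i))"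
proof -
  obtain j where j: "0 < z $ 1 + of_int j * width k" using width_reach by blast
  define x where "x = z $ 1 + of_int j * width k"
  obtain T where "x < pos (ix k) T" using pos_unbounded by blast
  then obtain t where t: "pos (ix k) t \<le> x" "x < pos (ix k) (Suc t)"
    using pos_exists[of x "ix k" T] j unfolding x_def by auto
  have CDz: "cyl_map k z = tower_map (ix k) (off k) (z + fvec (of_int j * width k))" using j by (intro cyl_map_eq) simp
  have va: "valid (ix k i) (off k i + lab z)" for i using tower_cyl assms(1) unfolding tower_def strip_def by blast
  have slab: "cyl_map k z = cls (lpt (ix k i) (off k i + lab z) (x - pos (ix k) i))"
    if "pos (ix k) i \<le> x" "x \<le> pos (ix k) (Suc i)" for i
    unfolding CDz using tower_map_slab[OF tower_cyl, of "z + fvec (of_int j * width k)" k i] assms(1) that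
    unfolding x_def strip_def by (simp add: lab_add)
  have "x = pos (ix k) t"
  proof (rule ccontr)
    assume "x \<noteq> pos (ix k) t"
    then have "lpt (ix k t) (off k t + lab z) (x - pos (ix k) t) \<notin> sing"
      using lpt_inner_nonsing[of "x - pos (ix k) t" "ix k t"] t pos_Suc[of "ix k" t] by simp
    moreover have "cls (lpt (ix k t) (off k t + lab z) (x - pos (ix k) t)) = arm_sing r"
      using slab[of t] t assms(2) by simp
    ultimately show False using cls_sing_iff by blast
  qed
  then obtain i where i: "t = Suc i" using j unfolding x_def by (cases t) auto
  have "pos (ix k) i \<le> x" "x \<le> pos (ix k) (Suc i)" "x - pos (ix k) i = r ^ ix k i"
    using \<open>x = pos (ix k) t\<close> rpow_pos[of "ix k i"] pos_Suc[of "ix k" i] unfolding i by linarith+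
  then have "lpt (ix k i) (off k i + lab z) (r ^ ix k i) \<in> sing"
    using slab[of i] assms(2) cls_sing_iff by metis
  then have "off k i + lab z = - (r ^ ix k i) \<or> off k i + lab z = (real q - 1) * r ^ Suc (ix k i)"
    using lpt_right_nonsing[OF va] by blast
  moreover have "z $ 1 = pos (ix k) (Suc i) + of_int (- j) * width k"
    using \<open>x = pos (ix k) t\<close> unfolding x_def i by simp
  ultimately show ?thesis by blast
qed

lemma cyl_map_strip_int_nonsing:
  assumes "z \<in> strip_int k"
  shows "cyl_map k z \<noteq> arm_sing r"
proof
  assume "cyl_map k z = arm_sing r"
  then obtain i where i: "off k i + lab z = - (r ^ ix k i) \<or> off k i + lab z = (real q - 1) * r ^ Suc (ix k i)"
    using cyl_map_sing_slab[OF strip_int_strip[OF assms]] by blast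
  have xi: "r ^ Suc k < - lab z" "- lab z < r ^ k" using assms unfolding strip_int_bounds by auto
  then have "0 < - lab z" using rpow_pos[of "Suc k"] by linarith
  then have "- lab z = r ^ ix k i"
    using state_nonsing[OF state_ix[of k i], of "- lab z"] xi(2) i by auto
  then show False using xi rpow_not_between[of k "ix k i"] by simp
qed

text \<open>With \<open>\<xi> = r ^ Suc k\<close> the remaining case \<open>\<xi> = r ^ e\<close> of
  \<open>state_nonsing\<close> fixes the square \<open>Suc k\<close>.\<close>

lemma cyl_map_top_sing:
  assumes "lab z = - (r ^ Suc k)" "cyl_map k z = arm_sing r"
  shows "\<exists>i. orbit k i = (Suc k, 0) \<and> (\<exists>j::int. z $ 1 = pos (ix k) (Suc i) + of_int j * width k)"
proof -
  have "z \<in> strip k" using assms(1) rpow_Suc_less[of k] unfolding strip_bounds by simp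
  then obtain i j where i: "off k i + lab z = - (r ^ ix k i) \<or> off k i + lab z = (real q - 1) * r ^ Suc (ix k i)"
    "z $ 1 = pos (ix k) (Suc i) + of_int j * width k"
    using cyl_map_sing_slab assms(2) by blast
  then have "off k i = 0 \<and> - lab z = r ^ ix k i"
    using state_nonsing[OF state_ix[of k i], of "- lab z"] assms(1) rpow_Suc_less[of k] by auto
  then have "off k i = 0" "ix k i = Suc k" using assms(1) rpow_eq_iff[of "Suc k" "ix k i"] by auto
  then have "orbit k i = (Suc k, 0)" unfolding ix_def off_def by (simp add: prod_eq_iff)
  then show ?thesis using i(2) by blast
qed

text \<open>The state \<open>(Suc k, 0)\<close> occurs once per period, so the upper boundary of a
  cylinder is one saddle connection; the lower boundary has no such property here.\<close>

lemma cyl_map_top_sing_unique: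
  assumes "lab z = - (r ^ Suc k)" "cyl_map k z = arm_sing r" "lab z' = - (r ^ Suc k)" "cyl_map k z' = arm_sing r"
  shows "\<exists>j::int. z' $ 1 = z $ 1 + of_int j * width k"
proof -
  obtain i j where i: "orbit k i = (Suc k, 0)" "z $ 1 = pos (ix k) (Suc i) + of_int j * width k"
    using cyl_map_top_sing[OF assms(1,2)] by blast
  obtain i' j' where i': "orbit k i' = (Suc k, 0)" "z' $ 1 = pos (ix k) (Suc i') + of_int j' * width k"
    using cyl_map_top_sing[OF assms(3,4)] by blast
  have m: "\<exists>l::int. pos (ix k) (Suc i) = pos (ix k) (Suc (i mod period k)) + of_int l * width k" for i
  proof -
    have "pos (ix k) (t + n * period k) = pos (ix k) t + real n * width k" for t n
    proof (induction n)
      case (Suc n)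
      have "t + Suc n * period k = (t + n * period k) + period k" by simp
      then show ?case using pos_period[of k "t + n * period k"] Suc by (simp add: algebra_simps)
    qed simp
    from this[of "Suc (i mod period k)" "i div period k"]
    have "pos (ix k) (Suc i) = pos (ix k) (Suc (i mod period k)) + real (i div period k) * width k"
      by (simp add: add.commute mult.commute)
    then show ?thesis by (intro exI[of _ "int (i div period k)"]) simp
  qed
  have "i mod period k = i' mod period k"
    using orbit_inj[of k "i mod period k" "i' mod period k"] orbit_mod i i' period(1)[of k] by simp
  then obtain l l' where "pos (ix k) (Suc i) = pos (ix k) (Suc (i mod period k)) + of_int l * width k"
    "pos (ix k) (Suc i') = pos (ix k) (Suc (i mod period k)) + of_int l' * width k" using m by metis
  then have "z' $ 1 = z $ 1 + of_int (l' + j' - l - j) * width k" using i(2) i'(2) by (simp add: algebra_simps)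
  then show ?thesis by blast
qed

lemma state_0: "e \<le> Suc k \<Longrightarrow> state k e 0" unfolding state_def by simp

lemma cyl_map_sing_exists:
  shows "\<exists>x. cyl_map k (fline (- (r ^ k)) x) = arm_sing r" "\<exists>x. cyl_map k (fline (- (r ^ Suc k)) x) = arm_sing r"
proof -
  have *: "\<exists>x. cyl_map k (fline (- (r ^ e)) x) = arm_sing r" if "e = k \<or> e = Suc k" for e
  proof -
    have "state k e 0" using that state_0 by auto
    moreover have "r ^ e \<in> band k" using that rpow_Suc_less[of k] unfolding band_iff by auto
    ultimately obtain x where "cyl_map k (fline (- (r ^ e)) x) = cls (lpt e (0 - r ^ e) (r ^ e))"
      using state_in_image[of k e 0 "r ^ e" "r ^ e"] less_imp_le[OF rpow_pos[of e]] by blast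
    then show ?thesis using lpt_right_sing(1)[of e] cls_sing_iff by (metis diff_0)
  qed
  show "\<exists>x. cyl_map k (fline (- (r ^ k)) x) = arm_sing r" "\<exists>x. cyl_map k (fline (- (r ^ Suc k)) x) = arm_sing r"
    using *[of k] *[of "Suc k"] by auto
qed

subsection \<open>Topology of the cylinders\<close>


definition cyl :: "nat \<Rightarrow> (real^2) set set" where "cyl k = cyl_map k ` strip k"
definition cyl_int :: "nat \<Rightarrow> (real^2) set set" where "cyl_int k = cyl_map k ` strip_int k"

lemma cyl_int_sub_cyl: "cyl_int k \<subseteq> cyl k"
  unfolding cyl_int_def cyl_def using strip_int_strip by auto

lemma cyl_map_in_X: "z \<in> strip k \<Longrightarrow> cyl_map k z \<in> arm_X r"
  using cyl_map_label[of z k] lpt_in_Pbar cls_in_X_iff by fastforce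

lemma cyl_sub_X: "cyl k \<subseteq> arm_X r"
  unfolding cyl_def using cyl_map_in_X by auto

lemma cyl_iff: "p \<in> cyl k \<longleftrightarrow> (\<exists>e c \<xi> a. state k e c \<and> \<xi> \<in> band k \<and> 0 \<le> a \<and> a \<le> r ^ e \<and> p = cls (lpt e (c - \<xi>) a))"
proof
  assume "p \<in> cyl k"
  then obtain z where z: "z \<in> strip k" "p = cyl_map k z" unfolding cyl_def by auto
  then obtain e c a where "state k e c" "0 \<le> a" "a < r ^ e" "p = cls (lpt e (c + lab z) a)"
    using cyl_map_label[OF z(1)] by auto
  then show "\<exists>e c \<xi> a. state k e c \<and> \<xi> \<in> band k \<and> 0 \<le> a \<and> a \<le> r ^ e \<and> p = cls (lpt e (c - \<xi>) a)"
    using z(1) unfolding strip_iff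
    by (intro exI[of _ e] exI[of _ c] exI[of _ "- lab z"] exI[of _ a]) simp
next
  assume "\<exists>e c \<xi> a. state k e c \<and> \<xi> \<in> band k \<and> 0 \<le> a \<and> a \<le> r ^ e \<and> p = cls (lpt e (c - \<xi>) a)"
  then show "p \<in> cyl k" unfolding cyl_def using state_in_image by (metis imageI)
qed

lemma cyl_label:
  assumes "cls (lpt e l a) \<in> cyl k" "valid e l" "0 \<le> a" "a < r ^ e" "cls (lpt e l a) \<noteq> arm_sing r"
  shows "\<exists>c. state k e c \<and> c - l \<in> band k"
proof -
  obtain z where z: "z \<in> strip k" "cls (lpt e l a) = cyl_map k z" using assms(1) unfolding cyl_def by auto
  then obtain e' c a' where *: "state k e' c" "0 \<le> a'" "a' < r ^ e'" "valid e' (c + lab z)"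
    "cls (lpt e l a) = cls (lpt e' (c + lab z) a')"
    using cyl_map_label[OF z(1)] by auto
  then have "e = e' \<and> l = c + lab z" using label_unique[OF assms(2-4) *(4,2,3,5) assms(5)] by blast
  then show ?thesis using *(1) z(1) unfolding strip_iff by auto
qed

lemma sing_in_cyl: "arm_sing r \<in> cyl k"
proof -
  obtain x where "cyl_map k (fline (- (r ^ k)) x) = arm_sing r" using cyl_map_sing_exists(1) by blast
  moreover have "fline (- (r ^ k)) x \<in> strip k" unfolding strip_bounds using rpow_Suc_less[of k] by simp
  ultimately show ?thesis unfolding cyl_def by (metis imageI)
qed

text \<open>The part of the cylinder in one square, described by weak inequalities so that it is
  visibly closed. The two alternatives are points before and after the line passes the top edge,
  whose labels differ by \<open>N * r ^ e\<close>.\<close>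

definition slab :: "nat \<Rightarrow> nat \<Rightarrow> (real^2) set" where
  "slab k t = {p. S (ix k t) \<le> p $ 1 \<and> p $ 1 \<le> S (Suc (ix k t)) \<and> 0 \<le> p $ 2 \<and> p $ 2 \<le> r ^ ix k t} \<inter>
     ({p. - (r ^ k) \<le> N * p $ 2 - real q * (p $ 1 - S (ix k t)) - real q * r ^ ix k t - off k t} \<inter>
      {p. N * p $ 2 - real q * (p $ 1 - S (ix k t)) - real q * r ^ ix k t - off k t \<le> - (r ^ Suc k)} \<union>
      {p. - (r ^ k) \<le> N * p $ 2 - real q * (p $ 1 - S (ix k t)) - real q * r ^ ix k t - off k t + N * r ^ ix k t} \<inter>
      {p. N * p $ 2 - real q * (p $ 1 - S (ix k t)) - real q * r ^ ix k t - off k t + N * r ^ ix k t \<le> - (r ^ Suc k)})"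

lemma closed_slab: "closed (slab k t)"
  unfolding slab_def
  by (intro closed_Int closed_Un closed_Collect_conj closed_Collect_le continuous_intros)

lemma slab_sub: "slab k t \<subseteq> Pbar"
proof
  fix p assume p: "p \<in> slab k t"
  have "pt (p $ 1) (p $ 2) \<in> Pbar" using p unfolding slab_def by (intro Pbar_square[of "ix k t"]) auto
  then show "p \<in> Pbar" using pt_eta[of p] by simp
qed

lemma slab_cyl: "cls ` slab k t \<subseteq> cyl k"
proof
  fix c assume "c \<in> cls ` slab k t"
  then obtain p where p: "p \<in> slab k t" "c = cls p" by auto
  let ?e = "ix k t" and ?c = "off k t"
  define a where "a = p $ 1 - S ?e"
  have a: "0 \<le> a" "a \<le> r ^ ?e" and y: "0 \<le> p $ 2" "p $ 2 \<le> r ^ ?e"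
    using p(1) S_Suc[of ?e] unfolding slab_def a_def by auto
  define u where "u = N * p $ 2 - real q * a - real q * r ^ ?e - ?c"
  have pe: "p = pt (S ?e + a) (p $ 2)" using pt_eta[of p] unfolding a_def by simp
  consider (l) "- u \<in> band k" | (h) "- (u + N * r ^ ?e) \<in> band k"
    using p(1) unfolding slab_def band_iff u_def a_def by auto
  then show "c \<in> cyl k"
  proof cases
    case l
    have "hgt ?e (?c + u) a = p $ 2" unfolding hgt_def u_def using N_pos by simp
    then have "c = cls (lpt ?e (?c - (- u)) a)" using lpt_low[of ?e "?c + u" a] y(2) a p(2) pe by simp
    then show ?thesis unfolding cyl_iff using state_ix[of k t] l a by blast
  next
    case h
    have "hgt ?e (?c + (u + N * r ^ ?e)) a = p $ 2 + r ^ ?e" unfolding hgt_def u_def using N_pos by (simp add: field_simps)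
    then have "c = cls (lpt ?e (?c - (- (u + N * r ^ ?e))) a)"
      unfolding diff_minus_eq_add using lpt_high[of ?e "?c + (u + N * r ^ ?e)" a] y(1) p(2) pe by simp
    then show ?thesis unfolding cyl_iff using state_ix[of k t] h a by blast
  qed
qed

lemma cyl_sub_slab: "cyl k \<subseteq> (\<Union>t<period k. cls ` slab k t)"
proof
  fix c assume "c \<in> cyl k"
  then obtain z where z: "z \<in> strip k" "c = cyl_map k z" unfolding cyl_def by auto
  obtain t x where t: "t < period k" "pos (ix k) t \<le> x" "x < pos (ix k) (Suc t)"
    "cyl_map k z = cls (lpt (ix k t) (off k t + lab z) (x - pos (ix k) t))"
    using cyl_map_rep[OF z(1)] by blast
  let ?e = "ix k t" and ?c = "off k t"
  define a where "a = x - pos (ix k) t"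
  have a: "0 \<le> a" "a \<le> r ^ ?e" using t pos_Suc[of "ix k" t] unfolding a_def by auto
  have va: "valid ?e (?c + lab z)" using tower_cyl z(1) unfolding tower_def strip_def by blast
  define h where "h = hgt ?e (?c + lab z) a"
  have h: "0 \<le> h" "h < 2 * r ^ ?e" using hgt_nonneg[OF va a(1)] hgt_less[OF va a(2)] unfolding h_def by auto
  have Nh: "N * h = ?c + lab z + real q * r ^ ?e + real q * a" unfolding h_def hgt_def using N_pos by simp
  have zb: "- (r ^ k) \<le> lab z" "lab z \<le> - (r ^ Suc k)" using z(1) unfolding strip_bounds by auto
  have "lpt ?e (?c + lab z) a \<in> slab k t"
  proof (cases "h < r ^ ?e")
    case True
    then have "lpt ?e (?c + lab z) a = pt (S ?e + a) h" unfolding lpt_def h_def by simp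
    then show ?thesis unfolding slab_def using a h True Nh zb S_Suc[of ?e] by simp
  next
    case False
    then have "lpt ?e (?c + lab z) a = pt (S ?e + a) (h - r ^ ?e)" unfolding lpt_def h_def by simp
    moreover have "N * (h - r ^ ?e) = N * h - N * r ^ ?e" by (simp add: algebra_simps)
    ultimately show ?thesis unfolding slab_def using a h False Nh zb S_Suc[of ?e] by simp
  qed
  then show "c \<in> (\<Union>t<period k. cls ` slab k t)" using t z(2) unfolding a_def by auto
qed

text \<open>One period consists of finitely many closed slabs, and the singular class is among their
  points, as \<open>surf_closed_image\<close> demands.\<close>

lemma cyl_closed: "surf_closed r (cyl k)"
proof -
  have eq: "cyl k = cls ` (\<Union>t<period k. slab k t)"
    unfolding image_UN by (rule antisym[OF cyl_sub_slab UN_least[OF slab_cyl]])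
  have "closed (\<Union>t<period k. slab k t)" using closed_slab by (intro closed_UN) auto
  moreover have "(\<Union>t<period k. slab k t) \<subseteq> Pbar" using slab_sub by blast
  ultimately have "surf_closed r (cls ` (\<Union>t<period k. slab k t))"
    by (rule surf_closed_image) (use sing_in_cyl[of k] eq in metis)
  then show ?thesis unfolding eq .
qed

lemma surf_open_Diff:
  assumes "surf_closed r B"
  shows "surf_open r (arm_X r - B)"
proof -
  have B: "B \<subseteq> arm_X r" "closedin (top_of_set Pbar) (\<Union>B)" using assms unfolding surf_closed_def by auto
  have "\<Union>(arm_X r - B) = Pbar - \<Union>B"
  proof (intro set_eqI)
    fix p
    have "p \<in> \<Union>(arm_X r - B) \<longleftrightarrow> cls p \<in> arm_X r - B" by (rule Union_mem) auto
    then show "p \<in> \<Union>(arm_X r - B) \<longleftrightarrow> p \<in> Pbar - \<Union>B" using Union_mem[OF B(1)] cls_in_X_iff by auto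
  qed
  moreover have "openin (top_of_set Pbar) (Pbar - \<Union>B)" using B(2) by (metis openin_diff openin_subtopology_self)
  ultimately show ?thesis unfolding surf_open_def by auto
qed

lemma surf_closed_Diff:
  assumes "surf_open r B"
  shows "surf_closed r (arm_X r - B)"
proof -
  have B: "B \<subseteq> arm_X r" "openin (top_of_set Pbar) (\<Union>B)" using assms unfolding surf_open_def by auto
  have "\<Union>(arm_X r - B) = Pbar - \<Union>B"
  proof (intro set_eqI)
    fix p
    have "p \<in> \<Union>(arm_X r - B) \<longleftrightarrow> cls p \<in> arm_X r - B" by (rule Union_mem) auto
    then show "p \<in> \<Union>(arm_X r - B) \<longleftrightarrow> p \<in> Pbar - \<Union>B" using Union_mem[OF B(1)] cls_in_X_iff by auto
  qed
  moreover have "closedin (top_of_set Pbar) (Pbar - \<Union>B)" using B(2) by (metis closedin_diff closedin_subtopology_refl topspace_euclidean_subtopology closedin_topspace)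
  ultimately show ?thesis unfolding surf_closed_def by auto
qed

lemma X_closed: "surf_closed r (arm_X r)"
  using surf_closed_Diff[of "{}"] unfolding surf_open_def by simp

lemma surf_closure_least: "surf_closed r B \<Longrightarrow> A \<subseteq> B \<Longrightarrow> surf_closure r A \<subseteq> B"
  unfolding surf_closure_def by blast

lemma cyl_map_limit:
  assumes "surf_open r U" "z \<in> strip k" "cyl_map k z \<in> U"
  shows "U \<inter> cyl_int k \<noteq> {}"
proof -
  obtain \<epsilon> where \<epsilon>: "0 < \<epsilon>" "\<And>v. norm v < \<epsilon> \<Longrightarrow> z + v \<in> strip k \<Longrightarrow> cyl_map k (z + v) \<in> U"
    using nhd_continuous[OF cyl_map_nhd[OF assms(2)] assms(2,1,3)] by blast
  \<comment> \<open>The label difference to the middle line of the strip; any small step towards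
    that line enters the interior.\<close>
  define m where "m = (- (r ^ k) - r ^ Suc k) / 2 - lab z"
  define v where "v = pt 0 (m / N)"
  obtain \<delta> where \<delta>: "0 < \<delta>" "\<And>s. \<bar>s\<bar> < \<delta> \<Longrightarrow> norm (s *\<^sub>R v) < \<epsilon>" using small_scale[OF \<epsilon>(1), of v] by blast
  define s where "s = min (\<delta> / 2) (1 / 2)"
  have s: "0 < s" "s < \<delta>" "s < 1" using \<delta>(1) unfolding s_def by auto
  have lv: "lab v = m" unfolding v_def lab_def using N_pos by simp
  have l: "lab (z + s *\<^sub>R v) = (1 - s) * lab z + s * ((- (r ^ k) - r ^ Suc k) / 2)"
    unfolding lab_add lab_scale lv m_def by (simp add: algebra_simps)
  have zb: "- (r ^ k) \<le> lab z" "lab z \<le> - (r ^ Suc k)" using assms(2) unfolding strip_bounds by auto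
  have "(1 - s) * (- (r ^ k)) \<le> (1 - s) * lab z" "(1 - s) * lab z \<le> (1 - s) * (- (r ^ Suc k))"
    using mult_left_mono[OF zb(1), of "1 - s"] mult_left_mono[OF zb(2), of "1 - s"] s by simp_all
  moreover have "s * (- (r ^ k)) < s * ((- (r ^ k) - r ^ Suc k) / 2)" "s * ((- (r ^ k) - r ^ Suc k) / 2) < s * (- (r ^ Suc k))"
    using s(1) rpow_Suc_less[of k] by (intro mult_strict_left_mono; simp)+
  moreover have "x = (1 - s) * x + s * x" for x :: real by (simp add: algebra_simps)
  ultimately have zo: "z + s *\<^sub>R v \<in> strip_int k" unfolding strip_int_bounds l by (smt (verit))
  then have "cyl_map k (z + s *\<^sub>R v) \<in> U" using \<epsilon>(2)[OF \<delta>(2) strip_int_strip] s by simp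
  then show ?thesis using zo unfolding cyl_int_def by blast
qed

lemma closure_cyl_int: "surf_closure r (cyl_int k) = cyl k"
proof
  show "surf_closure r (cyl_int k) \<subseteq> cyl k" by (rule surf_closure_least[OF cyl_closed cyl_int_sub_cyl])
  have "cyl k \<subseteq> B" if B: "surf_closed r B" "cyl_int k \<subseteq> B" for B
  proof
    fix c assume "c \<in> cyl k"
    then obtain z where z: "z \<in> strip k" "c = cyl_map k z" unfolding cyl_def by auto
    show "c \<in> B"
    proof (rule ccontr)
      assume "c \<notin> B"
      then have "cyl_map k z \<in> arm_X r - B" using z cyl_map_in_X by auto
      from cyl_map_limit[OF surf_open_Diff[OF B(1)] z(1) this] show False using B(2) by blast
    qed
  qed
  then show "cyl k \<subseteq> surf_closure r (cyl_int k)" unfolding surf_closure_def by blast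
qed

lemma cyl_int_open: "surf_open r (cyl_int k)"
proof -
  have "devel (cyl_map k) (strip_int k)"
    unfolding devel_def
  proof
    fix z assume z: "z \<in> strip_int k"
    then have "z \<in> {z \<in> strip k. cyl_map k z \<noteq> arm_sing r}" using strip_int_strip cyl_map_strip_int_nonsing by blast
    then show "\<exists>\<epsilon>>0. \<forall>v. norm v < \<epsilon> \<and> z + v \<in> strip_int k \<longrightarrow> hop (cyl_map k z) v (cyl_map k (z + v))"
      using cyl_map_devel[of k] strip_int_strip cyl_map_strip_int_nonsing unfolding devel_def by (metis (mono_tags, lifting) mem_Collect_eq)
  qed
  moreover have "open (strip_int k)"
    unfolding strip_int_bounds[abs_def] strip_int_def labels_int_def lab_def greaterThanLessThan_iff mem_Collect_eq
    by (auto intro!: open_Collect_conj open_Collect_less continuous_intros)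
  ultimately show ?thesis unfolding cyl_int_def by (rule devel_image_open)
qed

text \<open>The strip coordinate of a regular point does not depend on the cylinder, because
  \<open>state_decomp\<close> compares states of different indices.\<close>

lemma cyl_meet:
  assumes "z \<in> strip k" "z' \<in> strip j" "cyl_map k z = cyl_map j z'" "cyl_map k z \<noteq> arm_sing r"
  shows "lab z = lab z'"
proof -
  obtain e c a where 1: "state k e c" "0 \<le> a" "a < r ^ e" "valid e (c + lab z)" "cyl_map k z = cls (lpt e (c + lab z) a)"
    using cyl_map_label[OF assms(1)] by blast
  obtain e' c' a' where 2: "state j e' c'" "0 \<le> a'" "a' < r ^ e'" "valid e' (c' + lab z')" "cyl_map j z' = cls (lpt e' (c' + lab z') a')"
    using cyl_map_label[OF assms(2)] by blast
  have "e = e' \<and> c + lab z = c' + lab z'"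
    using label_unique[OF 1(4,2,3) 2(4,2,3)] 1(5) 2(5) assms(3,4) by simp
  then show ?thesis using state_decomp[OF 1(1), of "- lab z" j c' "- lab z'"] 2(1) assms(1,2) unfolding strip_iff by simp
qed

lemma band_overlap: "\<xi> \<in> band k \<Longrightarrow> \<xi> \<in> band j \<Longrightarrow> k < j \<Longrightarrow> j = Suc k \<and> \<xi> = r ^ Suc k"
proof -
  assume a: "\<xi> \<in> band k" "\<xi> \<in> band j" "k < j"
  then have "r ^ j \<le> r ^ Suc k" "r ^ Suc k \<le> r ^ j" using rpow_le_iff[of j "Suc k"] unfolding band_iff by auto
  then have "r ^ j = r ^ Suc k" by simp
  then show ?thesis using rpow_eq_iff[of j "Suc k"] a unfolding band_iff by auto
qed

lemma cyl_int_cyl_disjoint: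
  assumes "k \<noteq> j"
  shows "cyl_int k \<inter> cyl j = {}"
proof (rule ccontr)
  assume "cyl_int k \<inter> cyl j \<noteq> {}"
  then obtain z z' where z: "z \<in> strip_int k" "z' \<in> strip j" "cyl_map k z = cyl_map j z'" unfolding cyl_int_def cyl_def by auto
  then have l: "lab z = lab z'" using cyl_meet[OF strip_int_strip] cyl_map_strip_int_nonsing by blast
  have "- lab z \<in> band k" "- lab z \<in> band j" using strip_int_strip[OF z(1)] z(2) l unfolding strip_iff by auto
  then have "- lab z = r ^ Suc k \<or> - lab z = r ^ k"
    using band_overlap[of "- lab z" k j] band_overlap[of "- lab z" j k] assms by (metis nat_neq_iff)
  then show False using z(1) unfolding strip_int_bounds by auto
qed

lemma cyl_meet_adjacent:
  assumes "k < j" "p \<in> cyl k" "p \<in> cyl j" "p \<noteq> arm_sing r"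
  shows "j = Suc k \<and> (\<exists>x. p = cyl_map k (fline (- (r ^ Suc k)) x))"
proof -
  obtain z z' where z: "z \<in> strip k" "z' \<in> strip j" "p = cyl_map k z" "p = cyl_map j z'" using assms(2,3) unfolding cyl_def by auto
  then have l: "lab z = lab z'" using cyl_meet assms(4) by metis
  then have "j = Suc k \<and> - lab z = r ^ Suc k" using band_overlap[of "- lab z" k j] assms(1) z unfolding strip_iff by simp
  then show ?thesis using z(3) fline_lab[of z] by (metis add.inverse_inverse)
qed

text \<open>States for \<open>k\<close> are also states for \<open>Suc k\<close>, and
  \<open>r ^ Suc k\<close> belongs to both bands.\<close>

lemma top_in_next:
  assumes "lab z = - (r ^ Suc k)"
  shows "cyl_map k z \<in> cyl (Suc k)"
proof -
  have "z \<in> strip k" using assms rpow_Suc_less[of k] unfolding strip_bounds by simp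
  then obtain e c a where "state k e c" "0 \<le> a" "a < r ^ e" "cyl_map k z = cls (lpt e (c - r ^ Suc k) a)"
    using cyl_map_label[of z k] assms by auto
  moreover have "r ^ Suc k \<in> band (Suc k)" using rpow_Suc_less[of "Suc k"] unfolding band_iff by simp
  ultimately show ?thesis unfolding cyl_iff using state_mono[of k e c "Suc k"] by (metis le_SucI less_imp_le order_refl)
qed

subsection \<open>Interiors and boundary saddle connections\<close>


lemma norm_pt_le: "norm (pt a b) \<le> \<bar>a\<bar> + \<bar>b\<bar>"
  using norm_le_l1_cart[of "pt a b"] by (simp add: sum_2)

text \<open>The representative is taken at positive height at most \<open>r ^ e\<close>, so lowering
  the label slightly moves it down inside the same square. This finds nearby points outside a
  cylinder or inside one.\<close>

lemma lpt_below:
  assumes "0 < hgt e l a" "hgt e l a \<le> 2 * r ^ e" "0 \<le> a" "a \<le> r ^ e" "surf_open r U" "cls (lpt e l a) \<in> U"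
  shows "\<exists>\<delta>>0. \<forall>\<eta>. 0 < \<eta> \<and> \<eta> < \<delta> \<longrightarrow> cls (lpt e (l - \<eta>) a) \<in> U"
proof -
  have U: "U \<subseteq> arm_X r" "openin (top_of_set Pbar) (\<Union>U)" using assms(5) unfolding surf_open_def by auto
  define y where "y = (if hgt e l a \<le> r ^ e then hgt e l a else hgt e l a - r ^ e)"
  have y: "0 < y" "y \<le> r ^ e" using assms(1,2) unfolding y_def by auto
  have "cls (pt (S e + a) y) = cls (lpt e l a)"
    using lpt_low[of e l a] lpt_high[of e l a] assms unfolding y_def by (auto simp: not_le)
  then have "pt (S e + a) y \<in> \<Union>U" using assms(6) Union_mem[OF U(1)] by simp
  then obtain \<epsilon> where \<epsilon>: "\<epsilon> > 0" "\<And>x'. x' \<in> Pbar \<Longrightarrow> dist x' (pt (S e + a) y) < \<epsilon> \<Longrightarrow> x' \<in> \<Union>U"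
    using U(2) unfolding openin_euclidean_subtopology_iff by blast
  have "cls (lpt e (l - \<eta>) a) \<in> U" if \<eta>: "0 < \<eta>" "\<eta> < N * min \<epsilon> y" for \<eta>
  proof -
    have "N * min \<epsilon> y \<le> N * \<epsilon>" "N * min \<epsilon> y \<le> N * y" using N_pos by simp_all
    then have "\<eta> < \<epsilon> * N" "\<eta> < y * N" using \<eta> by (simp_all add: mult.commute)
    then have d: "0 < \<eta> / N" "\<eta> / N < \<epsilon>" "\<eta> / N < y" using \<eta>(1) N_pos by (simp_all add: pos_divide_less_eq)
    have "hgt e (l - \<eta>) a = hgt e l a - \<eta> / N" unfolding hgt_def by (simp add: diff_divide_distrib add_divide_distrib)
    then have P: "lpt e (l - \<eta>) a = pt (S e + a) (y - \<eta> / N)"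
      using d y(2) unfolding lpt_def y_def by auto
    have "lpt e (l - \<eta>) a \<in> Pbar" unfolding P using d y assms(3,4) S_Suc[of e] by (intro Pbar_square[of e]) auto
    moreover have "dist (lpt e (l - \<eta>) a) (pt (S e + a) y) < \<epsilon>"
    proof -
      have "lpt e (l - \<eta>) a - pt (S e + a) y = pt 0 (- (\<eta> / N))" unfolding P by (simp add: vec_eq_iff forall_2)
      then show ?thesis using norm_pt_le[of 0 "- (\<eta> / N)"] d by (simp add: dist_norm)
    qed
    ultimately show ?thesis using \<epsilon>(2) Union_mem[OF U(1)] by blast
  qed
  then show ?thesis using \<epsilon>(1) y(1) N_pos by (intro exI[of _ "N * min \<epsilon> y"]) simp
qed

lemma rpow_multiple: "i \<le> k \<Longrightarrow> r ^ i = real (q ^ (k - i)) * r ^ k"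
proof (induction "k - i" arbitrary: i)
  case (Suc d)
  then have "k - i = Suc (k - Suc i)" by simp
  then have "real (q ^ (k - i)) = real q * real (q ^ (k - Suc i))" by (simp add: power_Suc)
  moreover have "r ^ Suc i = real (q ^ (k - Suc i)) * r ^ k"
    using Suc.hyps Suc.prems by (intro Suc.hyps(1)) auto
  ultimately show ?case using q_rpow[of i] by (simp only: mult.assoc)
qed simp

lemma state_multiple:
  assumes "state k e c"
  shows "\<exists>m::int. c = of_int m * r ^ k"
proof -
  have q: "real q = of_int (int (q ^ Suc k)) * r ^ k"
    using rpow_multiple[of 0 k] by (simp add: power_Suc)
  have grid: "\<exists>m::int. c = of_int m * r ^ k" if "grid k c" for c
  proof -
    obtain i n where "i \<le> k" "c = real (Suc n) * r ^ i" using \<open>grid k c\<close> unfolding grid_def by blast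
    then have "c = of_int (int (Suc n * q ^ (k - i))) * r ^ k"
      using rpow_multiple[of i k] by (simp only: of_nat_mult of_int_mult of_int_of_nat_eq mult.assoc)
    then show ?thesis by blast
  qed
  consider "0 < c" | "c = 0" | "c < 0" by linarith
  then show ?thesis
  proof cases
    case 1
    then show ?thesis using assms grid state_pos by blast
  next
    case 3
    then obtain m :: int where "c + real q = of_int m * r ^ k" using assms grid unfolding state_def by auto
    then have "c = of_int m * r ^ k - of_int (int (q ^ Suc k)) * r ^ k" unfolding q[symmetric] by simp
    then have "c = of_int (m - int (q ^ Suc k)) * r ^ k" by (simp only: of_int_diff left_diff_distrib)
    then show ?thesis by blast
  qed (auto intro: exI[of _ 0])
qed

text \<open>Every neighbourhood of the singularity contains arbitrarily small squares near the limit
  point of the tail, whereas the cylinder visits only squares up to index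
  \<open>Suc k\<close>.\<close>

lemma sing_not_interior:
  assumes "surf_open r U" "U \<subseteq> cyl k"
  shows "arm_sing r \<notin> U"
proof
  assume s: "arm_sing r \<in> U"
  have U: "U \<subseteq> arm_X r" "openin (top_of_set Pbar) (\<Union>U)" using assms unfolding surf_open_def by auto
  have "pt Sinf 0 \<in> sing" unfolding sing_def by simp
  then have "pt Sinf 0 \<in> \<Union>U" using s cls_sing_iff Union_mem[OF U(1)] by metis
  then obtain \<epsilon> where \<epsilon>: "\<epsilon> > 0" "\<And>x'. x' \<in> Pbar \<Longrightarrow> dist x' (pt Sinf 0) < \<epsilon> \<Longrightarrow> x' \<in> \<Union>U"
    using U(2) unfolding openin_euclidean_subtopology_iff by blast
  have "0 < \<epsilon> / (Sinf + 1)" using \<epsilon>(1) Sinf_pos by simp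
  then obtain n where n: "r ^ n < \<epsilon> / (Sinf + 1)" using real_arch_pow_inv r_less_1 by blast
  define e where "e = max n (k + 2)"
  have "r ^ e \<le> r ^ n" using rpow_le_iff unfolding e_def by simp
  then have e: "r ^ e * (Sinf + 1) < \<epsilon>" using n Sinf_pos by (simp add: pos_less_divide_eq) (smt (verit) mult_right_mono)
  define p where "p = pt (S e + r ^ e / 2) (r ^ e / 2)"
  have x: "S e < S e + r ^ e / 2" "S e + r ^ e / 2 < S (Suc e)" using S_Suc[of e] by simp_all
  have pP: "p \<in> Pbar" unfolding p_def Pbar_between[OF x] using less_imp_le[OF rpow_pos[of e]] by simp
  have pn: "p \<notin> sing" unfolding p_def using sing_between[OF x] .
  have "p - pt Sinf 0 = pt (r ^ e / 2 - r ^ e * Sinf) (r ^ e / 2)"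
    unfolding p_def S_closed by (simp add: vec_eq_iff forall_2 algebra_simps)
  moreover have "\<bar>r ^ e / 2 - r ^ e * Sinf\<bar> + \<bar>r ^ e / 2\<bar> \<le> r ^ e * (Sinf + 1)"
    unfolding ring_distribs using rpow_pos[of e] mult_pos_pos[OF rpow_pos[of e] Sinf_pos] by linarith
  ultimately have "dist p (pt Sinf 0) < \<epsilon>"
    using norm_pt_le[of "r ^ e / 2 - r ^ e * Sinf" "r ^ e / 2"] e by (simp add: dist_norm)
  then have "cls p \<in> cyl k" using \<epsilon>(2) pP Union_mem[OF U(1)] assms(2) by blast
  moreover obtain u a where ua: "valid e u" "0 \<le> a" "a < r ^ e" "p = lpt e u a"
    using label_exists_half_open[of e "S e + r ^ e / 2" "r ^ e / 2"] x rpow_pos[of e] unfolding p_def by auto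
  ultimately have "\<exists>c. state k e c \<and> c - u \<in> band k" using cyl_label[of e u a k] pn cls_sing_iff by auto
  then have "e \<le> Suc k" using state_level by blast
  then show False unfolding e_def by simp
qed

text \<open>The two labels differ by one turn, so they describe the same line from both ends of the
  valid range. The upper one is itself excluded from \<open>valid\<close> but is approached by valid
  labels from below.\<close>

lemma lpt_wrap:
  assumes "0 < a" "a < r ^ e"
  shows "0 < hgt e (- (real q * r ^ e)) a" "hgt e (- (real q * r ^ e)) a < r ^ e"
    "hgt e ((real q - 1) * r ^ e) a = hgt e (- (real q * r ^ e)) a + r ^ e"
    "lpt e ((real q - 1) * r ^ e) a = lpt e (- (real q * r ^ e)) a"
proof -
  have "real q * a < N * r ^ e"
    using mult_strict_mono'[of "real q" N a "r ^ e"] assms q_ge_2 unfolding N_def by simp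
  then show h0: "0 < hgt e (- (real q * r ^ e)) a" "hgt e (- (real q * r ^ e)) a < r ^ e"
    unfolding hgt_def using assms N_pos q_ge_2 by (simp_all add: pos_divide_less_eq mult.commute)
  have "(real q - 1) * r ^ e + real q * r ^ e + real q * a = real q * a + N * r ^ e"
    unfolding N_def by (simp add: algebra_simps)
  then show h: "hgt e ((real q - 1) * r ^ e) a = hgt e (- (real q * r ^ e)) a + r ^ e"
    unfolding hgt_def using N_pos by (simp add: add_divide_distrib)
  show "lpt e ((real q - 1) * r ^ e) a = lpt e (- (real q * r ^ e)) a"
    unfolding lpt_def h using h0 by simp
qed

text \<open>The points just below the lower boundary lie outside the cylinder because all offsets of states are multiples
  of \<open>r ^ k\<close>, whereas the bands are shorter than that.\<close>

lemma cyl_interior: "surf_interior r (cyl k) = cyl_int k"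
proof
  show "cyl_int k \<subseteq> surf_interior r (cyl k)" unfolding surf_interior_def using cyl_int_open cyl_int_sub_cyl by blast
  show "surf_interior r (cyl k) \<subseteq> cyl_int k"
  proof
    fix p assume "p \<in> surf_interior r (cyl k)"
    then obtain U where U: "surf_open r U" "U \<subseteq> cyl k" "p \<in> U" unfolding surf_interior_def by blast
    then obtain z where z: "z \<in> strip k" "p = cyl_map k z" unfolding cyl_def by auto
    have ns: "arm_sing r \<notin> U" using sing_not_interior[OF U(1,2)] .
    \<comment> \<open>Upper boundary points also belong to the next cylinder and are limits of its
      interior.\<close>
    have nt: "lab z \<noteq> - (r ^ Suc k)"
    proof
      assume "lab z = - (r ^ Suc k)"
      then obtain z' where z': "z' \<in> strip (Suc k)" "p = cyl_map (Suc k) z'" using top_in_next[of z k] z(2) unfolding cyl_def by auto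
      then have "U \<inter> cyl_int (Suc k) \<noteq> {}" using cyl_map_limit[OF U(1)] U(3) by blast
      then show False using cyl_int_cyl_disjoint[of "Suc k" k, OF n_not_Suc_n[symmetric]] U(2) by blast
    qed
    have nb: "lab z \<noteq> - (r ^ k)"
    proof
      assume lz: "lab z = - (r ^ k)"
      obtain e c a where eca: "state k e c" "0 \<le> a" "a < r ^ e" "valid e (c - r ^ k)" "p = cls (lpt e (c - r ^ k) a)"
        using cyl_map_label[OF z(1)] z(2) lz by auto
      have contra: False if l: "0 < hgt e l a" "hgt e l a \<le> 2 * r ^ e" "cls (lpt e l a) = p"
        "l \<le> (real q - 1) * r ^ e" "- (real q * r ^ e) < l"
        "\<And>\<eta> c'. 0 < \<eta> \<Longrightarrow> \<eta> < r ^ Suc k \<Longrightarrow> state k e c' \<Longrightarrow> c' - (l - \<eta>) \<in> band k \<Longrightarrow> False" for l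
      proof -
        obtain \<delta> where \<delta>: "\<delta> > 0" "\<And>\<eta>. 0 < \<eta> \<Longrightarrow> \<eta> < \<delta> \<Longrightarrow> cls (lpt e (l - \<eta>) a) \<in> U"
          using lpt_below[OF l(1,2) eca(2) less_imp_le[OF eca(3)] U(1)] l(3) U(3) by blast
        define \<eta> where "\<eta> = min (\<delta> / 2) (min (r ^ Suc k / 2) (l + real q * r ^ e))"
        have "0 < \<eta>" using \<delta>(1) l(5) unfolding \<eta>_def by simp
        moreover have "\<eta> \<le> \<delta> / 2" unfolding \<eta>_def by (rule min.cobounded1)
        moreover have "\<eta> \<le> r ^ Suc k / 2" unfolding \<eta>_def by (intro min.coboundedI2 min.cobounded1)
        moreover have "\<eta> \<le> l + real q * r ^ e" unfolding \<eta>_def by (intro min.coboundedI2 min.cobounded2)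
        ultimately have \<eta>: "0 < \<eta>" "\<eta> < \<delta>" "\<eta> < r ^ Suc k" "\<eta> \<le> l + real q * r ^ e"
          using \<delta>(1) rpow_pos[of "Suc k"] by linarith+
        have "cls (lpt e (l - \<eta>) a) \<in> U" using \<delta>(2) \<eta> by blast
        moreover from this have "cls (lpt e (l - \<eta>) a) \<noteq> arm_sing r" using ns by metis
        moreover have "valid e (l - \<eta>)" using \<eta> l(4) unfolding valid_def by auto
        ultimately obtain c' where "state k e c'" "c' - (l - \<eta>) \<in> band k" using cyl_label[of e "l - \<eta>" a k] eca(2,3) U(2) by blast
        then show False using l(6) \<eta> by blast
      qed
      show False
      proof (cases "- (real q * r ^ e) < c - r ^ k")
        case True
        have "0 < c - r ^ k + real q * r ^ e + real q * a" using True eca(2) by (simp add: add_pos_nonneg)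
        then have "0 < hgt e (c - r ^ k) a" unfolding hgt_def using N_pos by simp
        then show False
        proof (rule contra[of "c - r ^ k"])
          show "hgt e (c - r ^ k) a \<le> 2 * r ^ e" using hgt_less[OF eca(4)] eca(3) by (simp add: less_imp_le)
          show "c - r ^ k \<le> (real q - 1) * r ^ e" using eca(4) unfolding valid_def by simp
          fix \<eta> c' assume \<eta>: "0 < \<eta>" "\<eta> < r ^ Suc k" "state k e c'" "c' - (c - r ^ k - \<eta>) \<in> band k"
          then have d: "- (r ^ k) < c' - c" "c' - c < 0" unfolding band_iff by auto
          obtain m m' :: int where "c = of_int m * r ^ k" "c' = of_int m' * r ^ k"
            using state_multiple[OF eca(1)] state_multiple[OF \<eta>(3)] by blast
          then have "c' - c = of_int (m' - m) * r ^ k" by (simp add: algebra_simps)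
          then have "of_int (-1) * r ^ k < of_int (m' - m) * r ^ k" "of_int (m' - m) * r ^ k < of_int 0 * r ^ k"
            using d by simp_all
          then have "of_int (-1) < (of_int (m' - m) :: real)" "(of_int (m' - m) :: real) < of_int 0"
            using mult_less_cancel_right_pos[OF rpow_pos[of k]] by blast+
          then show False unfolding of_int_less_iff by simp
        qed (use eca True in auto)
      next
        case False
        \<comment> \<open>No valid label lies below this one, so points under the line are reached
          from the equivalent label \<open>(q - 1) * r ^ e\<close> instead.\<close>
        then have l: "c - r ^ k = - (real q * r ^ e)" using eca(4) unfolding valid_def by simp
        have "pt (S e) 0 \<in> sing" unfolding sing_iff by blast
        moreover have "lpt e (c - r ^ k) 0 = pt (S e) 0" unfolding l lpt_def hgt_def by simp
        ultimately have "a \<noteq> 0" using ns U(3) eca(5) cls_sing_iff by metis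
        then have a: "0 < a" using eca(2) by simp
        let ?l = "(real q - 1) * r ^ e"
        note w = lpt_wrap[OF a eca(3)]
        have "0 < hgt e ?l a" using w rpow_pos[of e] by linarith
        then show False
        proof (rule contra[of ?l])
          show "hgt e ?l a \<le> 2 * r ^ e" using w by simp
          show "cls (lpt e ?l a) = p" unfolding eca(5) l w(4) ..
          show "- (real q * r ^ e) < ?l" using q1_rpow_ge[of e] rpow_pos[of e] Q_ge_2
            by (smt (verit) mult_pos_pos)
          fix \<eta> c' assume \<eta>: "0 < \<eta>" "\<eta> < r ^ Suc k" "state k e c'" "c' - (?l - \<eta>) \<in> band k"
          have "?l < c'" using \<eta> unfolding band_iff by linarith
          moreover have "0 \<le> ?l" using q1_rpow_ge[of e] rpow_pos[of e] by linarith
          ultimately show False using \<eta>(3) state_pos[of c' k e] by simp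
        qed simp
      qed
    qed
    have "z \<in> strip_int k" using z(1) nt nb unfolding strip_int_bounds strip_bounds by linarith
    then show "p \<in> cyl_int k" unfolding cyl_int_def z(2) by blast
  qed
qed

lemma cpath_rescale:
  assumes "cpath c w I"
  shows "cpath (\<lambda>t. c (a + t * s)) (s *\<^sub>R w) {t. a + t * s \<in> I}"
  unfolding cpath_def
proof
  fix t assume t: "t \<in> {t. a + t * s \<in> I}"
  then obtain \<epsilon> where \<epsilon>: "0 < \<epsilon>" "\<And>\<sigma>. \<bar>\<sigma>\<bar> < \<epsilon> \<Longrightarrow> a + t * s + \<sigma> \<in> I \<Longrightarrow> hop (c (a + t * s)) (\<sigma> *\<^sub>R w) (c (a + t * s + \<sigma>))"
    using assms unfolding cpath_def by blast
  have s1: "0 < \<bar>s\<bar> + 1" by simp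
  show "\<exists>\<epsilon>>0. \<forall>\<sigma>. \<bar>\<sigma>\<bar> < \<epsilon> \<and> t + \<sigma> \<in> {t. a + t * s \<in> I} \<longrightarrow>
      hop (c (a + t * s)) (\<sigma> *\<^sub>R s *\<^sub>R w) (c (a + (t + \<sigma>) * s))"
  proof (intro exI[of _ "\<epsilon> / (\<bar>s\<bar> + 1)"] conjI allI impI)
    fix \<sigma> assume \<sigma>: "\<bar>\<sigma>\<bar> < \<epsilon> / (\<bar>s\<bar> + 1) \<and> t + \<sigma> \<in> {t. a + t * s \<in> I}"
    then have "\<bar>\<sigma>\<bar> * \<bar>s\<bar> + \<bar>\<sigma>\<bar> < \<epsilon>" using s1 by (simp add: pos_less_divide_eq algebra_simps)
    then have "\<bar>\<sigma> * s\<bar> < \<epsilon>" unfolding abs_mult using abs_ge_zero[of \<sigma>] by linarith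
    moreover have "a + (t + \<sigma>) * s = a + t * s + \<sigma> * s" by (simp add: algebra_simps)
    ultimately show "hop (c (a + t * s)) (\<sigma> *\<^sub>R s *\<^sub>R w) (c (a + (t + \<sigma>) * s))"
      using \<epsilon>(2)[of "\<sigma> * s"] \<sigma> unfolding scaleR_scaleR by (metis mem_Collect_eq)
  qed (use \<epsilon>(1) s1 in simp)
qed

lemma saddle_connI:
  assumes "a < b" "w \<noteq> 0" "cpath c w {a<..<b}" "c a = arm_sing r" "c b = arm_sing r"
    "\<And>U. surf_open r U \<Longrightarrow> arm_sing r \<in> U \<Longrightarrow> \<exists>e>0. \<forall>t. 0 < t \<and> t < e \<longrightarrow> c (a + t) \<in> U \<and> c (b - t) \<in> U"
  shows "saddle_conn r (c ` {a..b})"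
  unfolding saddle_conn_def
proof (intro exI conjI)
  let ?c = "\<lambda>t. c (a + t * (b - a))" and ?w = "(b - a) *\<^sub>R w"
  show "?w \<noteq> 0" using assms(1,2) by simp
  have cp: "cpath ?c ?w {t. a + t * (b - a) \<in> {a<..<b}}" using cpath_rescale[OF assms(3)] .
  show "straight_open r ?c ?w 0 1"
    unfolding straight_open_def
  proof (intro allI impI)
    fix a' b' :: real assume ab: "0 < a' \<and> a' < b' \<and> b' < 1"
    have "t * (b - a) < b - a" if "t < 1" for t
      using that assms(1) mult_strict_right_mono[of t 1 "b - a"] by simp
    then have "{a'..b'} \<subseteq> {t. a + t * (b - a) \<in> {a<..<b}}" using ab assms(1) by (auto simp: algebra_simps)
    from cpath_subset[OF cp this] show "lchain r ?c ?w a' b'" using cpath_lchain ab by blast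
  qed
  show "?c 0 = arm_sing r" "?c 1 = arm_sing r" using assms(4,5) by simp_all
  show "\<forall>U. surf_open r U \<and> arm_sing r \<in> U \<longrightarrow> (\<exists>e>0. \<forall>t. 0 < t \<and> t < e \<longrightarrow> ?c t \<in> U \<and> ?c (1 - t) \<in> U)"
  proof (intro allI impI)
    fix U assume "surf_open r U \<and> arm_sing r \<in> U"
    then obtain e where e: "e > 0" "\<And>t. 0 < t \<Longrightarrow> t < e \<Longrightarrow> c (a + t) \<in> U \<and> c (b - t) \<in> U" using assms(6) by blast
    have "?c t \<in> U \<and> ?c (1 - t) \<in> U" if "0 < t" "t < e / (b - a)" for t
    proof -
      have "0 < t * (b - a)" "t * (b - a) < e" using that assms(1) by (simp_all add: pos_less_divide_eq)
      moreover have "a + (1 - t) * (b - a) = b - t * (b - a)" by (simp add: algebra_simps)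
      ultimately show ?thesis using e(2) by simp
    qed
    then show "\<exists>e>0. \<forall>t. 0 < t \<and> t < e \<longrightarrow> ?c t \<in> U \<and> ?c (1 - t) \<in> U"
      using e(1) assms(1) by (intro exI[of _ "e / (b - a)"]) simp
  qed
  show "c ` {a..b} = ?c ` {0..1}"
  proof -
    have "(\<lambda>t. a + t * (b - a)) ` {0..1} = {a..b}"
    proof (intro set_eqI iffI)
      fix x assume "x \<in> {a..b}"
      then have "(x - a) / (b - a) \<in> {0..1}" "x = a + (x - a) / (b - a) * (b - a)" using assms(1) by simp_all
      then show "x \<in> (\<lambda>t. a + t * (b - a)) ` {0..1}" by blast
    next
      fix x assume "x \<in> (\<lambda>t. a + t * (b - a)) ` {0..1}"
      then obtain t where t: "0 \<le> t" "t \<le> 1" "x = a + t * (b - a)" by auto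
      then have "0 \<le> t * (b - a)" "t * (b - a) \<le> 1 * (b - a)" using assms(1) by (auto intro!: mult_right_mono)
      then show "x \<in> {a..b}" using t by simp
    qed
    then show ?thesis by (metis image_image)
  qed
qed

lemma fline_scale: "fline u a + t *\<^sub>R fvec 1 = fline u (a + t)"
  by (simp add: fvec_scale fline_add)

lemma fvec_nonzero: "a \<noteq> 0 \<Longrightarrow> fvec a \<noteq> 0"
  by (metis fvec_nth zero_index)

lemma fline_cpath:
  assumes "u \<in> labels k" "\<And>x. x \<in> I \<Longrightarrow> cyl_map k (fline u x) \<noteq> arm_sing r"
  shows "cpath (\<lambda>x. cyl_map k (fline u x)) (fvec 1) I"
proof -
  have "cpath (\<lambda>t. cyl_map k (fline u 0 + t *\<^sub>R fvec 1)) (fvec 1) I"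
    by (rule devel_path[OF cyl_map_devel]) (use assms in \<open>simp add: fline_scale strip_def\<close>)
  then show ?thesis by (simp add: fline_scale)
qed

lemma saddle_on_fline:
  assumes "u \<in> labels k" "a < b" "cyl_map k (fline u a) = arm_sing r" "cyl_map k (fline u b) = arm_sing r"
    "\<And>x. a < x \<Longrightarrow> x < b \<Longrightarrow> cyl_map k (fline u x) \<noteq> arm_sing r"
  shows "saddle_conn r ((\<lambda>x. cyl_map k (fline u x)) ` {a..b})"
proof (rule saddle_connI[OF assms(2) fvec_nonzero[of 1]])
  show "cpath (\<lambda>x. cyl_map k (fline u x)) (fvec 1) {a<..<b}"
    by (rule fline_cpath) (use assms in auto)
  fix U assume U: "surf_open r U" "arm_sing r \<in> U"
  have near: "\<exists>e>0. \<forall>t. \<bar>t\<bar> < e \<longrightarrow> cyl_map k (fline u (x + t)) \<in> U" if sx: "cyl_map k (fline u x) = arm_sing r" for x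
  proof -
    have z: "fline u x \<in> strip k" using assms(1) unfolding strip_def by simp
    obtain \<epsilon> where \<epsilon>: "0 < \<epsilon>" "\<And>v. norm v < \<epsilon> \<Longrightarrow> fline u x + v \<in> strip k \<Longrightarrow> cyl_map k (fline u x + v) \<in> U"
      using nhd_continuous[OF cyl_map_nhd[OF z] z U(1)] sx U(2) by auto
    obtain \<delta> where \<delta>: "0 < \<delta>" "\<And>s. \<bar>s\<bar> < \<delta> \<Longrightarrow> norm (s *\<^sub>R fvec 1) < \<epsilon>" using small_scale[OF \<epsilon>(1), of "fvec 1"] by blast
    have "cyl_map k (fline u (x + t)) \<in> U" if "\<bar>t\<bar> < \<delta>" for t
      using \<epsilon>(2)[OF \<delta>(2)[OF that]] assms(1) unfolding fline_scale strip_def by simp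
    then show ?thesis using \<delta>(1) by blast
  qed
  obtain e1 e2 where "e1 > 0" "\<forall>t. \<bar>t\<bar> < e1 \<longrightarrow> cyl_map k (fline u (a + t)) \<in> U"
    "e2 > 0" "\<forall>t. \<bar>t\<bar> < e2 \<longrightarrow> cyl_map k (fline u (b + t)) \<in> U" using near assms(3,4) by metis
  then show "\<exists>e>0. \<forall>t. 0 < t \<and> t < e \<longrightarrow> cyl_map k (fline u (a + t)) \<in> U \<and> cyl_map k (fline u (b - t)) \<in> U"
    by (intro exI[of _ "min e1 e2"]) (auto simp: diff_conv_add_uminus simp del: add_uminus_conv_diff)
qed (use assms in simp_all)

lemma fline_period: "cyl_map k (fline u (x + of_int j * width k)) = cyl_map k (fline u x)"
  using cyl_map_shift[of k "fline u x" j] by (simp add: fline_add)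

text \<open>The singular parameters form a closed set, unbounded in both directions by periodicity;
  the nearest ones on either side of a regular parameter bound the saddle connection.\<close>

lemma fline_saddle_exists:
  assumes "u \<in> labels k" "cyl_map k (fline u x0) = arm_sing r" "cyl_map k (fline u x) \<noteq> arm_sing r"
  shows "\<exists>a b. a < x \<and> x < b \<and> cyl_map k (fline u a) = arm_sing r \<and> cyl_map k (fline u b) = arm_sing r \<and>
    (\<forall>y. a < y \<and> y < b \<longrightarrow> cyl_map k (fline u y) \<noteq> arm_sing r)"
proof -
  define Z where "Z = {y. cyl_map k (fline u y) = arm_sing r}"
  have "open (- Z)"
    unfolding open_contains_ball
  proof
    fix y assume "y \<in> - Z"
    then have y: "cyl_map k (fline u y) \<noteq> arm_sing r" unfolding Z_def by simp
    have z: "fline u y \<in> strip k" using assms(1) unfolding strip_def by simp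
    obtain \<epsilon> where \<epsilon>: "0 < \<epsilon>" "\<And>v. norm v < \<epsilon> \<Longrightarrow> fline u y + v \<in> strip k \<Longrightarrow> hop (cyl_map k (fline u y)) v (cyl_map k (fline u y + v))"
      using nhd_hop[OF cyl_map_nhd[OF z] z y] by blast
    obtain \<delta> where \<delta>: "0 < \<delta>" "\<And>s. \<bar>s\<bar> < \<delta> \<Longrightarrow> norm (s *\<^sub>R fvec 1) < \<epsilon>" using small_scale[OF \<epsilon>(1), of "fvec 1"] by blast
    have "cyl_map k (fline u (y + t)) \<noteq> arm_sing r" if "\<bar>t\<bar> < \<delta>" for t
    proof -
      have "hop (cyl_map k (fline u y)) (t *\<^sub>R fvec 1) (cyl_map k (fline u (y + t)))"
        using \<epsilon>(2)[OF \<delta>(2)[OF that]] assms(1) unfolding fline_scale strip_def by simp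
      then obtain p where p: "cyl_map k (fline u (y + t)) = cls (p + t *\<^sub>R fvec 1)"
        "\<forall>s\<in>{0..1}. p + s *\<^sub>R t *\<^sub>R fvec 1 \<in> Pbar - sing"
        unfolding hop_def by blast
      from p(2)[rule_format, of 1] show ?thesis unfolding p(1) cls_sing_iff by simp
    qed
    from this[of "t - y" for t] have "t \<in> - Z" if "\<bar>t - y\<bar> < \<delta>" for t using that unfolding Z_def by simp
    then show "\<exists>e>0. ball y e \<subseteq> - Z" using \<delta>(1)
      by (intro exI[of _ \<delta>]) (auto simp: dist_real_def abs_minus_commute)
  qed
  then have cl: "closed Z" by (simp add: closed_def)
  have x: "x \<notin> Z" using assms(3) unfolding Z_def by simp
  have period: "x0 + of_int j * width k \<in> Z" for j :: int using fline_period assms(2) unfolding Z_def by simp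
  obtain j where j: "x < x0 + of_int j * width k" using width_reach by blast
  obtain i where "- x < - x0 + of_int i * width k" using width_reach by blast
  then have i: "x0 + of_int (- i) * width k < x" by simp
  define a where "a = Sup (Z \<inter> {..x})"
  define b where "b = Inf (Z \<inter> {x..})"
  have ne: "Z \<inter> {..x} \<noteq> {}" "Z \<inter> {x..} \<noteq> {}" using period[of "- i"] i period[of j] j by (auto intro: less_imp_le)
  have bd: "bdd_above (Z \<inter> {..x})" "bdd_below (Z \<inter> {x..})" by auto
  have a: "a \<in> Z \<inter> {..x}" unfolding a_def by (rule closed_contains_Sup[OF ne(1) bd(1)]) (use cl in auto)
  have b: "b \<in> Z \<inter> {x..}" unfolding b_def by (rule closed_contains_Inf[OF ne(2) bd(2)]) (use cl in auto)
  have "y \<notin> Z" if "a < y" "y < b" for y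
  proof
    assume y: "y \<in> Z"
    show False
    proof (cases "y \<le> x")
      case True
      then have "y \<le> a" unfolding a_def using y bd(1) by (intro cSup_upper) auto
      then show False using that by simp
    next
      case False
      then have "b \<le> y" unfolding b_def using y bd(2) by (intro cInf_lower) auto
      then show False using that by simp
    qed
  qed
  moreover have "a < x" "x < b" using a b x by (auto simp: less_le)
  ultimately show ?thesis using a b unfolding Z_def by blast
qed

lemma boundary_fline:
  assumes "u = - (r ^ k) \<or> u = - (r ^ Suc k)"
  shows "u \<in> labels k" "cyl_map k (fline u x) \<notin> cyl_int k" "cyl_map k (fline u x) \<in> cyl k"
proof -
  show u: "u \<in> labels k" using assms rpow_Suc_less[of k] unfolding labels_def by auto
  show "cyl_map k (fline u x) \<in> cyl k" unfolding cyl_def using u by (intro imageI) (simp add: strip_def)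
  show "cyl_map k (fline u x) \<notin> cyl_int k"
  proof
    assume "cyl_map k (fline u x) \<in> cyl_int k"
    then obtain z where z: "z \<in> strip_int k" "cyl_map k z = cyl_map k (fline u x)" unfolding cyl_int_def by auto
    then have "lab z = u" using cyl_map_inj[OF strip_int_strip[OF z(1)], of "fline u x"] cyl_map_strip_int_nonsing[OF z(1)] u unfolding strip_def by simp
    then show False using z(1) assms unfolding strip_int_bounds by auto
  qed
qed

lemma boundary_saddles: "cyl k - cyl_int k = \<Union>{S. saddle_conn r S \<and> S \<subseteq> cyl k - cyl_int k}"
proof
  show "cyl k - cyl_int k \<subseteq> \<Union>{S. saddle_conn r S \<and> S \<subseteq> cyl k - cyl_int k}"
  proof
    fix p assume p: "p \<in> cyl k - cyl_int k"
    then obtain z where z: "z \<in> strip k" "p = cyl_map k z" unfolding cyl_def by auto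
    have "z \<notin> strip_int k" using p z(2) unfolding cyl_int_def by blast
    then have l: "lab z = - (r ^ k) \<or> lab z = - (r ^ Suc k)" using z(1) unfolding strip_bounds strip_int_bounds by auto
    define u where "u = lab z"
    note b = boundary_fline[OF l[folded u_def]]
    have zl: "p = cyl_map k (fline u (z $ 1))" using z(2) fline_lab[of z] unfolding u_def by simp
    obtain x0 where x0: "cyl_map k (fline u x0) = arm_sing r" using cyl_map_sing_exists l unfolding u_def by metis
    have saddle: "saddle_conn r ((\<lambda>x. cyl_map k (fline u x)) ` {a..b}) \<and> (\<lambda>x. cyl_map k (fline u x)) ` {a..b} \<subseteq> cyl k - cyl_int k"
      if "a < b" "cyl_map k (fline u a) = arm_sing r" "cyl_map k (fline u b) = arm_sing r"
        "\<forall>y. a < y \<and> y < b \<longrightarrow> cyl_map k (fline u y) \<noteq> arm_sing r" for a b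
      using saddle_on_fline[OF b(1) that(1-3)] that(4) b(2,3) by auto
    obtain x a b where ab: "a < x" "x < b" "cyl_map k (fline u a) = arm_sing r" "cyl_map k (fline u b) = arm_sing r"
      "\<forall>y. a < y \<and> y < b \<longrightarrow> cyl_map k (fline u y) \<noteq> arm_sing r" "p \<in> (\<lambda>x. cyl_map k (fline u x)) ` {a..b}"
    proof (cases "p = arm_sing r")
      case False
      then obtain a b where "a < z $ 1" "z $ 1 < b" "cyl_map k (fline u a) = arm_sing r" "cyl_map k (fline u b) = arm_sing r"
        "\<forall>y. a < y \<and> y < b \<longrightarrow> cyl_map k (fline u y) \<noteq> arm_sing r"
        using fline_saddle_exists[OF b(1) x0] zl by metis
      then show ?thesis using that[of a "z $ 1" b] zl by auto
    next
      case True
      \<comment> \<open>The singularity itself is covered by the saddle connection through any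
        regular point of its boundary line; midpoints of squares are regular.\<close>
      have "\<exists>x. cyl_map k (fline u x) \<noteq> arm_sing r"
      proof (rule ccontr)
        assume "\<not> ?thesis"
        then have all: "cyl_map k (fline u x) = arm_sing r" for x by simp
        obtain e c a where "state k e c" "- u \<in> band k" using cyl_map_label[OF z(1)] z(1) unfolding strip_iff u_def by blast
        then obtain x where "cyl_map k (fline u x) = cls (lpt e (c + u) (r ^ e / 2))"
          using state_in_image[of k e c "- u" "r ^ e / 2"] rpow_pos[of e] by auto
        then have "lpt e (c + u) (r ^ e / 2) \<in> sing" using all cls_sing_iff by metis
        then show False using lpt_inner_nonsing[of "r ^ e / 2" e] by simp
      qed
      then obtain x where "cyl_map k (fline u x) \<noteq> arm_sing r" by blast
      from fline_saddle_exists[OF b(1) x0 this] obtain a b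
        where *: "a < x" "x < b" "cyl_map k (fline u a) = arm_sing r" "cyl_map k (fline u b) = arm_sing r"
        "\<forall>y. a < y \<and> y < b \<longrightarrow> cyl_map k (fline u y) \<noteq> arm_sing r"
        by blast
      moreover have "p \<in> (\<lambda>x. cyl_map k (fline u x)) ` {a..b}"
        using * True by (intro image_eqI[of _ _ a]) auto
      ultimately show ?thesis using that by blast
    qed
    then show "p \<in> \<Union>{S. saddle_conn r S \<and> S \<subseteq> cyl k - cyl_int k}" using saddle[of a b] by auto
  qed
qed blast

subsection \<open>The cylinder decomposition and its spine\<close>


lemma rpow_nonneg [simp]: "0 \<le> r ^ e"
  using rpow_pos[of e] by linarith

lemma norm_pt: "norm (pt a b) = sqrt (a\<^sup>2 + b\<^sup>2)"
  by (simp add: norm_vec_def L2_set_def sum_2)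

text \<open>Coordinates are arc length along the unit flow vector and distance from the lower
  boundary. With \<open>R\<close> the norm of \<open>(N, q)\<close>, a unit step along the normal
  raises the label by \<open>R\<close> and a unit step along the flow advances the abscissa by
  \<open>N / R\<close>; this gives \<open>h\<close> and \<open>circ\<close>.\<close>

lemma cyl_is_cyl: "is_cyl r (cyl k) (pt N (real q))"
  unfolding is_cyl_def cyl_interior
proof (intro conjI)
  show "cyl k \<subseteq> arm_X r" by (rule cyl_sub_X)
  show "surf_closed r (cyl k)" by (rule cyl_closed)
  show "cyl k - cyl_int k = \<Union>{S. saddle_conn r S \<and> S \<subseteq> cyl k - cyl_int k}" by (rule boundary_saddles)
  define R where "R = sqrt (N\<^sup>2 + (real q)\<^sup>2)"
  have sq: "0 < N\<^sup>2 + (real q)\<^sup>2" using N_pos by (simp add: add_pos_nonneg)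
  then have R: "0 < R" "R * R = N * N + real q * real q"
    unfolding R_def by (simp_all add: power2_eq_square[symmetric])
  define u where "u = (1 / R) *\<^sub>R pt N (real q)"
  define n where "n = (1 / R) *\<^sub>R pt (- real q) N"
  define circ where "circ = width k * R / N"
  define h where "h = (r ^ k - r ^ Suc k) / R"
  define P where "P s t = fline (- (r ^ k)) 0 + s *\<^sub>R u + t *\<^sub>R n" for s t
  have lu: "lab u = 0" unfolding u_def lab_scale by (simp add: lab_def)
  have ln: "lab n = R" unfolding n_def lab_scale using R by (simp add: lab_def field_simps)
  have u1: "u $ 1 = N / R" and n1: "n $ 1 = - real q / R" unfolding u_def n_def by simp_all
  have Plab: "lab (P s t) = - (r ^ k) + t * R" for s t unfolding P_def lab_add lab_scale lu ln by simp
  have P1: "P s t $ 1 = s * N / R - t * real q / R" for s t unfolding P_def using u1 n1 by simp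
  have strip_int: "P s t \<in> strip_int k \<longleftrightarrow> t \<in> {0<..<h}" for s t
  proof -
    have "t < h \<longleftrightarrow> t * R < r ^ k - r ^ Suc k" unfolding h_def by (rule pos_less_divide_eq[OF R(1)])
    moreover have "0 < t \<longleftrightarrow> 0 < t * R" using R(1) by (simp add: zero_less_mult_iff)
    ultimately show ?thesis unfolding strip_int_bounds Plab greaterThanLessThan_iff by linarith
  qed
  have "circ > 0" "h > 0" unfolding circ_def h_def using width_pos[of k] R N_pos rpow_Suc_less[of k] by simp_all
  have cu: "circ *\<^sub>R u = fvec (width k)"
    unfolding circ_def u_def fvec_def scaleR_scaleR pt_scaleR using R N_pos by (simp add: field_simps)
  have Pc: "P (s + circ * of_int j) t = P s t + fvec (of_int j * width k)" for s t j
  proof -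
    have "(circ * of_int j) *\<^sub>R u = fvec (of_int j * width k)"
      using arg_cong[OF cu, of "\<lambda>x. of_int j *\<^sub>R x"] by (simp add: fvec_scale mult.commute)
    then show ?thesis unfolding P_def by (simp add: scaleR_left_distrib)
  qed
  have surj: "\<exists>s\<in>{0..<circ}. \<exists>t\<in>{0<..<h}. cyl_map k z = cyl_map k (P s t)" if "z \<in> strip_int k" for z
  proof -
    define t where "t = (lab z + r ^ k) / R"
    define s where "s = (z $ 1 + t * real q / R) * R / N"
    have "lab (P s t) = lab z" "P s t $ 1 = z $ 1" unfolding Plab P1 s_def t_def using R(1) N_pos by simp_all
    then have zP: "P s t = z" using fline_lab by metis
    define j where "j = \<lfloor>s / circ\<rfloor>"
    have "of_int j \<le> s / circ" "s / circ < of_int j + 1" unfolding j_def by linarith+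
    then have "circ * of_int j \<le> s" "s < circ * of_int j + circ"
      using \<open>circ > 0\<close> by (simp_all add: field_simps)
    then have "s + circ * of_int (- j) \<in> {0..<circ}" by simp
    moreover have "cyl_map k (P (s + circ * of_int (- j)) t) = cyl_map k z" unfolding Pc cyl_map_shift zP ..
    moreover have "t \<in> {0<..<h}" using strip_int[of s t] that zP by simp
    ultimately show ?thesis by metis
  qed
  have img: "cyl_int k = (\<lambda>(s, t). cyl_map k (P s t)) ` ({0..<circ} \<times> {0<..<h})"
  proof
    show "cyl_int k \<subseteq> (\<lambda>(s, t). cyl_map k (P s t)) ` ({0..<circ} \<times> {0<..<h})"
      unfolding cyl_int_def using surj by force
    show "(\<lambda>(s, t). cyl_map k (P s t)) ` ({0..<circ} \<times> {0<..<h}) \<subseteq> cyl_int k"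
      unfolding cyl_int_def using strip_int by auto
  qed
  have dev: "devel (cyl_map k) {z \<in> strip k. cyl_map k z \<noteq> arm_sing r}" by (rule cyl_map_devel)
  have inU: "P s t \<in> {z \<in> strip k. cyl_map k z \<noteq> arm_sing r}" if "t \<in> {0<..<h}" for s t
    using strip_int[of s t] that strip_int_strip cyl_map_strip_int_nonsing by simp
  show "\<exists>u n circ h F. norm u = 1 \<and> (\<exists>m. u = m *\<^sub>R pt N (real q)) \<and> norm n = 1 \<and> inner u n = 0 \<and>
        circ > 0 \<and> h > 0 \<and> (\<forall>s. \<forall>t\<in>{0<..<h}. F (s + circ) t = F s t) \<and>
        inj_on (\<lambda>(s, t). F s t) ({0..<circ} \<times> {0<..<h}) \<and>
        (\<forall>t\<in>{0<..<h}. \<forall>a b. a < b \<longrightarrow> lchain r (\<lambda>s. F s t) u a b) \<and>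
        (\<forall>s a b. 0 < a \<and> a < b \<and> b < h \<longrightarrow> lchain r (\<lambda>t. F s t) n a b) \<and>
        cyl_int k = (\<lambda>(s, t). F s t) ` ({0..<circ} \<times> {0<..<h}) \<and>
        cyl k = surf_closure r ((\<lambda>(s, t). F s t) ` ({0..<circ} \<times> {0<..<h}))"
  proof (intro exI conjI)
    show "norm u = 1" unfolding u_def norm_scaleR norm_pt R_def[symmetric] using R(1) by simp
    show "u = (1 / R) *\<^sub>R pt N (real q)" by (rule u_def)
    have "norm (pt (- real q) N) = R" unfolding norm_pt R_def by (simp add: add.commute)
    then show "norm n = 1" unfolding n_def norm_scaleR using R(1) by simp
    show "inner u n = 0" unfolding u_def n_def by (simp add: inner_pt)
    show "circ > 0" "h > 0" by fact+
    show "\<forall>s. \<forall>t\<in>{0<..<h}. cyl_map k (P (s + circ) t) = cyl_map k (P s t)"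
      using Pc[of _ 1] cyl_map_shift[of k _ 1] by simp
    show "inj_on (\<lambda>(s, t). cyl_map k (P s t)) ({0..<circ} \<times> {0<..<h})"
    proof (rule inj_onI, clarify)
      fix s t s' t' assume st: "s \<in> {0..<circ}" "t \<in> {0<..<h}" "s' \<in> {0..<circ}" "t' \<in> {0<..<h}"
        "cyl_map k (P s t) = cyl_map k (P s' t')"
      have PS: "P s t \<in> strip_int k" "P s' t' \<in> strip_int k" using strip_int st by auto
      obtain j :: int where j: "lab (P s t) = lab (P s' t')" "P s' t' $ 1 = P s t $ 1 + of_int j * width k"
        using cyl_map_inj[OF strip_int_strip[OF PS(1)] strip_int_strip[OF PS(2)] st(5) cyl_map_strip_int_nonsing[OF PS(1)]] by blast
      have t: "t = t'" using j(1) R(1) unfolding Plab by simp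
      have "(s' - s) * N / R = of_int j * width k" using j(2) unfolding P1 t by (simp add: diff_divide_distrib left_diff_distrib)
      then have sj: "s' - s = of_int j * circ" unfolding circ_def using R(1) N_pos by (simp add: field_simps)
      have "\<bar>s' - s\<bar> < circ" using st by auto
      then have "\<bar>of_int j\<bar> * circ < 1 * circ" unfolding sj abs_mult using \<open>circ > 0\<close> by simp
      then have "\<bar>of_int j :: real\<bar> < 1" using \<open>circ > 0\<close> mult_less_cancel_right_pos by blast
      then have "j = 0" by linarith
      then show "s = s' \<and> t = t'" using sj t by simp
    qed
    show "\<forall>t\<in>{0<..<h}. \<forall>a b. a < b \<longrightarrow> lchain r (\<lambda>s. cyl_map k (P s t)) u a b"
    proof (intro ballI allI impI)
      fix t a b :: real assume t: "t \<in> {0<..<h}" "a < b"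
      have P: "P s t = (fline (- (r ^ k)) 0 + t *\<^sub>R n) + s *\<^sub>R u" for s unfolding P_def by simp
      have "cpath (\<lambda>s. cyl_map k ((fline (- (r ^ k)) 0 + t *\<^sub>R n) + s *\<^sub>R u)) u {a..b}"
        by (rule devel_path[OF dev]) (use inU[OF t(1)] P in simp)
      then show "lchain r (\<lambda>s. cyl_map k (P s t)) u a b" unfolding P using cpath_lchain t(2) by blast
    qed
    show "\<forall>s a b. 0 < a \<and> a < b \<and> b < h \<longrightarrow> lchain r (\<lambda>t. cyl_map k (P s t)) n a b"
    proof (intro allI impI)
      fix s a b :: real assume ab: "0 < a \<and> a < b \<and> b < h"
      have "cpath (\<lambda>t. cyl_map k ((fline (- (r ^ k)) 0 + s *\<^sub>R u) + t *\<^sub>R n)) n {a..b}"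
        by (rule devel_path[OF dev]) (use inU[of _ s] ab in \<open>simp add: P_def\<close>)
      then show "lchain r (\<lambda>t. cyl_map k (P s t)) n a b" unfolding P_def using cpath_lchain ab by blast
    qed
    show "cyl_int k = (\<lambda>(s, t). cyl_map k (P s t)) ` ({0..<circ} \<times> {0<..<h})" by (rule img)
    show "cyl k = surf_closure r ((\<lambda>(s, t). cyl_map k (P s t)) ` ({0..<circ} \<times> {0<..<h}))"
      unfolding img[symmetric] closure_cyl_int ..
  qed
qed

lemma label_in_cyl:
  assumes "valid e l" "0 \<le> a" "a \<le> r ^ e" "l \<noteq> 0" "\<not> (e = 0 \<and> l = - real q)"
  shows "\<exists>k. cls (lpt e l a) \<in> cyl k"
proof -
  obtain k c \<xi> where "state k e c" "\<xi> \<in> band k" "l = c - \<xi>" using label_cover assms by blast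
  then have "cls (lpt e l a) \<in> cyl k" unfolding cyl_iff using assms(2,3) by blast
  then show ?thesis by blast
qed

text \<open>A regular point outside all cylinders has one of the two exceptional labels of
  \<open>label_cover\<close>, and labels slightly below those are covered.\<close>

lemma closure_Union_cyl: "surf_closure r (\<Union>(range cyl)) = arm_X r"
proof
  show "surf_closure r (\<Union>(range cyl)) \<subseteq> arm_X r"
    by (rule surf_closure_least[OF X_closed]) (use cyl_sub_X in blast)
  have "arm_X r \<subseteq> B" if B: "surf_closed r B" "\<Union>(range cyl) \<subseteq> B" for B
  proof
    fix p assume p: "p \<in> arm_X r"
    show "p \<in> B"
    proof (rule ccontr)
      assume pB: "p \<notin> B"
      have U: "surf_open r (arm_X r - B)" using surf_open_Diff[OF B(1)] .
      have nC: "c \<in> cyl k \<Longrightarrow> c \<in> B" for c k using B(2) by blast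
      then have ns: "p \<noteq> arm_sing r" using sing_in_cyl pB by blast
      obtain x where x: "p = cls x" "x \<in> Pbar" using p by (rule X_cases)
      then have "x \<notin> sing" using ns cls_sing_iff by simp
      then obtain e l a where l: "valid e l" "0 \<le> a" "a < r ^ e" "p = cls (lpt e l a)" using label_exists x by metis
      have contra: False if l': "0 < hgt e l' a" "hgt e l' a \<le> 2 * r ^ e" "cls (lpt e l' a) = p" "0 < \<eta>0"
        "\<And>\<eta>. 0 < \<eta> \<Longrightarrow> \<eta> < \<eta>0 \<Longrightarrow> valid e (l' - \<eta>) \<and> l' - \<eta> \<noteq> 0 \<and> l' - \<eta> \<noteq> - real q" for l' \<eta>0
      proof -
        obtain \<delta> where \<delta>: "\<delta> > 0" "\<And>\<eta>. 0 < \<eta> \<Longrightarrow> \<eta> < \<delta> \<Longrightarrow> cls (lpt e (l' - \<eta>) a) \<in> arm_X r - B"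
          using lpt_below[OF l'(1,2) l(2) less_imp_le[OF l(3)] U] l'(3) p pB by blast
        define \<eta> where "\<eta> = min (\<delta> / 2) (\<eta>0 / 2)"
        have \<eta>: "0 < \<eta>" "\<eta> < \<delta>" "\<eta> < \<eta>0" using \<delta>(1) l'(4) unfolding \<eta>_def by auto
        then have "\<exists>k. cls (lpt e (l' - \<eta>) a) \<in> cyl k" using label_in_cyl[of e "l' - \<eta>" a] l'(5)[of \<eta>] l(2,3) by auto
        then show False using \<delta>(2) \<eta> nC by blast
      qed
      have "\<not> (\<exists>k. cls (lpt e l a) \<in> cyl k)" using l(4) pB nC by blast
      then consider "l = 0" | "e = 0" "l = - real q" using label_in_cyl[of e l a] l by auto
      then show False
      proof cases
        case 1
        have q1: "0 < real q * r ^ e" "1 * r ^ e \<le> real q * r ^ e" "real q * r ^ e \<le> real q * 1"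
          using q_ge_2 rpow_le_1[of e] by (simp, intro mult_right_mono, simp_all)
        show False
        proof (rule contra[of 0 "r ^ e"])
          show "0 < hgt e 0 a" unfolding hgt_def using N_pos q1 l(2) by (simp add: add_pos_nonneg)
          show "hgt e 0 a \<le> 2 * r ^ e" using hgt_less[OF l(1)] l(3) 1 by (simp add: less_imp_le)
          show "cls (lpt e 0 a) = p" using l 1 by simp
          fix \<eta> assume \<eta>: "0 < \<eta>" "\<eta> < r ^ e"
          have "- (real q * r ^ e) \<le> 0 - \<eta>" "0 - \<eta> \<noteq> - real q" using \<eta> q1 by linarith+
          then show "valid e (0 - \<eta>) \<and> 0 - \<eta> \<noteq> 0 \<and> 0 - \<eta> \<noteq> - real q"
            using \<eta> l(1) 1 unfolding valid_def by auto
        qed simp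
      next
        case 2
        have "lpt 0 (- real q) 0 = pt 0 0" unfolding lpt_def hgt_def by simp
        then have "a \<noteq> 0" using ns l(4) 2 cls_sing_iff zero_sing pt_zero by auto
        then have a: "0 < a" "a < r ^ e" using l by auto
        \<comment> \<open>The label \<open>- q\<close> is the bottom of the valid range; the points
          below its line have labels just under the equivalent value \<open>q - 1\<close>.\<close>
        have w: "0 < hgt 0 (- real q) a" "hgt 0 (- real q) a < 1"
          "hgt 0 (real q - 1) a = hgt 0 (- real q) a + 1" "lpt 0 (real q - 1) a = lpt 0 (- real q) a"
          using lpt_wrap[of a 0] a 2 by simp_all
        show False
        proof (rule contra[of "real q - 1" 1])
          show "0 < hgt e (real q - 1) a" "hgt e (real q - 1) a \<le> 2 * r ^ e" "cls (lpt e (real q - 1) a) = p"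
            using w 2 l(4) by simp_all
          fix \<eta> :: real assume "0 < \<eta>" "\<eta> < 1"
          then show "valid e (real q - 1 - \<eta>) \<and> real q - 1 - \<eta> \<noteq> 0 \<and> real q - 1 - \<eta> \<noteq> - real q"
            unfolding valid_def 2 using Q_ge_2 by auto
        qed simp
      qed
    qed
  qed
  then show "arm_X r \<subseteq> surf_closure r (\<Union>(range cyl))" unfolding surf_closure_def by blast
qed

lemma cyl_inj:
  assumes eq: "cyl k = cyl j"
  shows "k = j"
proof -
  have "cyl_int k \<noteq> {}"
  proof -
    have "fline ((- (r ^ k) - r ^ Suc k) / 2) 0 \<in> strip_int k" unfolding strip_int_bounds using rpow_Suc_less[of k] by simp
    then show ?thesis unfolding cyl_int_def by blast
  qed
  then show "k = j" using cyl_int_cyl_disjoint[of k j] cyl_int_sub_cyl[of k] eq by blast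
qed

lemma cyl_cyl_decomp: "cyl_decomp r (range cyl) (pt N (real q))"
  unfolding cyl_decomp_def
proof (intro conjI ballI impI)
  show "is_cyl r c (pt N (real q))" if "c \<in> range cyl" for c using that cyl_is_cyl by auto
  show "surf_closure r (\<Union>(range cyl)) = arm_X r" by (rule closure_Union_cyl)
  fix C1 C2 assume "C1 \<in> range cyl" "C2 \<in> range cyl" "C1 \<noteq> C2"
  then obtain k j where kj: "C1 = cyl k" "C2 = cyl j" "k \<noteq> j" by auto
  show "C1 \<inter> C2 \<subseteq> (C1 - surf_interior r C1) \<inter> (C2 - surf_interior r C2)"
    unfolding kj cyl_interior using cyl_int_cyl_disjoint[of k j] cyl_int_cyl_disjoint[of j k] kj(3) by blast
qed

section \<open>The rigid spine\<close>

text \<open>Subtraction is truncated, so the first square occurs twice: the line starts at the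
  vertex 0 with label \<open>- q\<close>, returns to the left edge with label 0, and then runs
  through all squares.\<close>

definition spine_ix :: "nat \<Rightarrow> nat" where "spine_ix t = t - 1"
definition spine_off :: "nat \<Rightarrow> real" where "spine_off t = (if t = 0 then - real q else 0)"

lemma tower_spine: "tower spine_ix spine_off {0}"
  unfolding tower_def
proof (intro allI ballI)
  fix t :: nat and u :: real assume "u \<in> {0}"
  then have u: "u = 0" by simp
  have q1: "0 < (real q - 1) * r ^ e" for e using q1_rpow_ge[of e] rpow_pos[of e] by linarith
  show "valid (spine_ix t) (spine_off t + u) \<and> cls (lpt (spine_ix t) (spine_off t + u) (r ^ spine_ix t)) = cls (lpt (spine_ix (Suc t)) (spine_off (Suc t) + u) 0)"
  proof (cases t)
    case 0
    have "cls (lpt 0 (- real q) (r ^ 0)) = cls (lpt 0 (- real q + 2 * real q * r ^ 0 - real q) 0)"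
      by (rule glue_exit_low) (use Q_ge_2 in simp_all)
    then show ?thesis using 0 u Q_ge_2 unfolding spine_ix_def spine_off_def valid_def by simp
  next
    case (Suc i)
    have "cls (lpt i 0 (r ^ i)) = cls (lpt (Suc i) 0 0)"
      by (rule glue_next) (use rpow_pos[of i] q1[of "Suc i"] in linarith)+
    then show ?thesis using Suc u q1[of i] unfolding spine_ix_def spine_off_def valid_def by simp
  qed
qed

lemma pos_spine: "pos spine_ix (Suc i) = 1 + S i"
proof (induction i)
  case 0
  have "spine_ix 0 = 0" by (simp add: spine_ix_def)
  then show ?case by (simp add: pos_Suc)
next
  case (Suc i)
  have "spine_ix (Suc i) = i" by (simp add: spine_ix_def)
  then show ?case using Suc pos_Suc[of spine_ix "Suc i"] by (simp add: S_Suc)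
qed

lemma S_approaches: 
  assumes "x < Sinf"
  shows "\<exists>i. x < S i"
proof -
  have "0 < (Sinf - x) / Sinf" using assms Sinf_pos by simp
  then obtain n where "r ^ n < (Sinf - x) / Sinf" using real_arch_pow_inv r_less_1 by blast
  then have "r ^ n * Sinf < Sinf - x" using Sinf_pos by (simp add: pos_less_divide_eq)
  then have "x < S n" unfolding S_closed by (simp add: algebra_simps)
  then show ?thesis by blast
qed

lemma spine_pos: "x < 1 + Sinf \<Longrightarrow> \<exists>T. x < pos spine_ix T"
  using S_approaches[of "x - 1"] pos_spine by (metis diff_less_eq add.commute)

text \<open>The unfolding covers abscissas below \<open>1 + Sinf\<close> only; the end point is the
  limit point of the tail and is added by hand.\<close>

definition spine :: "real \<Rightarrow> (real^2) set" where
  "spine x = (if x < 1 + Sinf then tower_map spine_ix spine_off (fline 0 x) else arm_sing r)"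

lemma spine_slab:
  assumes "pos spine_ix t \<le> x" "x \<le> pos spine_ix (Suc t)"
  shows "spine x = cls (lpt (spine_ix t) (spine_off t) (x - pos spine_ix t))"
proof -
  have "x < 1 + Sinf" using assms(2) S_less_Sinf[of t] unfolding pos_spine by linarith
  then show ?thesis unfolding spine_def using tower_map_slab[OF tower_spine, of "fline 0 x" t] assms by simp
qed

lemma spine_off_nonsing: "spine_off t \<noteq> - (r ^ spine_ix t)" "spine_off t \<noteq> (real q - 1) * r ^ Suc (spine_ix t)"
proof -
  have "0 < (real q - 1) * r ^ Suc (spine_ix t)" using q1_rpow_ge[of "Suc (spine_ix t)"] rpow_pos[of "Suc (spine_ix t)"] by linarith
  moreover have "spine_off t \<le> 0" using Q_ge_2 unfolding spine_off_def by simp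
  ultimately show "spine_off t \<noteq> (real q - 1) * r ^ Suc (spine_ix t)" by linarith
  show "spine_off t \<noteq> - (r ^ spine_ix t)"
  proof (cases "t = 0")
    case True
    then show ?thesis using q_ge_2 unfolding spine_off_def spine_ix_def by simp
  next
    case False
    then have "spine_off t = 0" unfolding spine_off_def by simp
    then show ?thesis using rpow_pos[of "spine_ix t"] by linarith
  qed
qed

lemma spine_nonsing:
  assumes "0 < x" "x < 1 + Sinf"
  shows "spine x \<noteq> arm_sing r"
proof -
  obtain T where T: "x < pos spine_ix T" using spine_pos assms by blast
  obtain t where t: "pos spine_ix t \<le> x" "x < pos spine_ix (Suc t)" using pos_exists[of x spine_ix T] T assms(1) by auto
  show ?thesis
  proof (cases "x = pos spine_ix t")
    case False
    then have "lpt (spine_ix t) (spine_off t) (x - pos spine_ix t) \<notin> sing"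
      using lpt_inner_nonsing[of "x - pos spine_ix t" "spine_ix t" "spine_off t"] t pos_Suc[of spine_ix t] by simp
    then show ?thesis using spine_slab[of t x] t cls_sing_iff by simp
  next
    case True
    then obtain i where i: "t = Suc i" using assms(1) by (cases t) auto
    have x: "pos spine_ix i \<le> x" "x \<le> pos spine_ix (Suc i)" "x - pos spine_ix i = r ^ spine_ix i"
      using True i pos_Suc[of spine_ix i] rpow_pos[of "spine_ix i"] by auto
    have "valid (spine_ix i) (spine_off i)" using tower_spine unfolding tower_def by simp
    then have "lpt (spine_ix i) (spine_off i) (r ^ spine_ix i) \<notin> sing" using lpt_right_nonsing spine_off_nonsing by blast
    then show ?thesis using spine_slab[OF x(1,2)] x(3) cls_sing_iff by simp
  qed
qed

lemma spine_cpath: "cpath spine (fvec 1) {0<..<1 + Sinf}"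
proof -
  let ?U = "{z. lab z = 0 \<and> 0 < z $ 1 \<and> z $ 1 < 1 + Sinf}"
  have "devel (tower_map spine_ix spine_off) ?U"
    unfolding devel_def
  proof
    fix z assume z: "z \<in> ?U"
    obtain T where T: "z $ 1 < pos spine_ix T" using spine_pos z by blast
    have z': "lab z \<in> {0}" "0 < z $ 1" using z by auto
    from tower_map_nhd[OF tower_spine z' T] obtain F \<epsilon> where F: "finite F" "0 < \<epsilon>"
      "\<And>v. norm v < \<epsilon> \<Longrightarrow> lab (z + v) \<in> {0} \<Longrightarrow>
        \<exists>x\<in>F. tower_map spine_ix spine_off z = cls x \<and> tower_map spine_ix spine_off (z + v) = cls (x + v) \<and> x + v \<in> Pbar"
      by blast
    have n: "nhd (tower_map spine_ix spine_off) ?U z"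
      unfolding nhd_def using F by (intro exI[of _ F] exI[of _ \<epsilon>]) simp
    have "tower_map spine_ix spine_off z = spine (z $ 1)" using z fline_lab[of z] unfolding spine_def by simp
    then have "tower_map spine_ix spine_off z \<noteq> arm_sing r" using spine_nonsing z by auto
    then show "\<exists>\<epsilon>>0. \<forall>v. norm v < \<epsilon> \<and> z + v \<in> ?U \<longrightarrow> hop (tower_map spine_ix spine_off z) v (tower_map spine_ix spine_off (z + v))"
      using nhd_hop[OF n z] by blast
  qed
  then have "cpath (\<lambda>t. tower_map spine_ix spine_off (fline 0 0 + t *\<^sub>R fvec 1)) (fvec 1) {0<..<1 + Sinf}"
    by (rule devel_path) (simp add: fline_scale)
  then show ?thesis unfolding cpath_def fline_scale spine_def by simp
qed

lemma spine_ends: "spine 0 = arm_sing r" "spine (1 + Sinf) = arm_sing r"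
proof -
  have "spine 0 = cls (lpt 0 (- real q) 0)" using spine_slab[of 0 0] pos_spine[of 0] by (simp add: spine_ix_def spine_off_def)
  moreover have "lpt 0 (- real q) 0 = 0" unfolding lpt_def hgt_def by (simp add: pt_zero)
  ultimately show "spine 0 = arm_sing r" unfolding arm_sing_def by simp
  show "spine (1 + Sinf) = arm_sing r" unfolding spine_def by simp
qed

lemma spine_near_end:
  assumes "surf_open r U" "arm_sing r \<in> U"
  shows "\<exists>e>0. \<forall>t. 0 < t \<and> t < e \<longrightarrow> spine (1 + Sinf - t) \<in> U"
proof -
  have U: "U \<subseteq> arm_X r" "openin (top_of_set Pbar) (\<Union>U)" using assms unfolding surf_open_def by auto
  have "pt Sinf 0 \<in> sing" unfolding sing_def by simp
  then have "pt Sinf 0 \<in> \<Union>U" using assms(2) cls_sing_iff Union_mem[OF U(1)] by metis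
  then obtain \<epsilon> where \<epsilon>: "\<epsilon> > 0" "\<And>x'. x' \<in> Pbar \<Longrightarrow> dist x' (pt Sinf 0) < \<epsilon> \<Longrightarrow> x' \<in> \<Union>U"
    using U(2) unfolding openin_euclidean_subtopology_iff by blast
  \<comment> \<open>From square \<open>m\<close> on, the horizontal distance to the limit point is
    at most \<open>r ^ m * Sinf\<close> and the height at most \<open>r ^ m\<close>; hence the
    factor \<open>Sinf + 1\<close>.\<close>
  have "0 < \<epsilon> / (Sinf + 1)" using \<epsilon>(1) Sinf_pos by simp
  then obtain n where n: "r ^ n < \<epsilon> / (Sinf + 1)" using real_arch_pow_inv r_less_1 by blast
  have "spine (1 + Sinf - t) \<in> U" if t: "0 < t" "t < Sinf - S n" for t
  proof -
    define x where "x = 1 + Sinf - t"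
    have x: "1 + S n < x" "x < 1 + Sinf" using t unfolding x_def by auto
    obtain T where T: "x < pos spine_ix T" using spine_pos x by blast
    have "0 \<le> x" using x S_nonneg[of n] by linarith
    then obtain i where i: "pos spine_ix i \<le> x" "x < pos spine_ix (Suc i)" using pos_exists[of x spine_ix T] T by auto
    have "pos spine_ix (Suc n) < pos spine_ix (Suc i)" using i x unfolding pos_spine by linarith
    then have ni: "n < i" unfolding pos_less_iff by simp
    then obtain m where m: "i = Suc m" "n \<le> m" by (cases i) auto
    define a where "a = x - pos spine_ix i"
    have a: "0 \<le> a" "a \<le> r ^ m" using i pos_Suc[of spine_ix i] unfolding a_def m spine_ix_def by auto
    have sx: "spine x = cls (lpt m 0 a)" using spine_slab[of i x] i unfolding a_def m spine_ix_def spine_off_def by simp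
    have v: "valid m 0" using tower_spine unfolding tower_def using m by (auto simp: spine_ix_def spine_off_def dest: spec[of _ i])
    define y where "y = (if hgt m 0 a < r ^ m then hgt m 0 a else hgt m 0 a - r ^ m)"
    have y: "0 \<le> y" "y \<le> r ^ m" using hgt_nonneg[OF v a(1)] hgt_less[OF v a(2)] unfolding y_def by auto
    have P: "lpt m 0 a = pt (S m + a) y" unfolding lpt_def y_def ..
    have "r ^ m \<le> r ^ n" using m rpow_le_iff by simp
    then have "r ^ m < \<epsilon> / (Sinf + 1)" using n by linarith
    then have rm: "r ^ m * (Sinf + 1) < \<epsilon>" using Sinf_pos by (simp add: pos_less_divide_eq)
    have "S m + a \<le> Sinf" using a S_Suc[of m] S_less_Sinf[of "Suc m"] by linarith
    then have "\<bar>S m + a - Sinf\<bar> \<le> r ^ m * Sinf" using a(1) S_closed[of m] by (simp add: algebra_simps)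
    then have "\<bar>S m + a - Sinf\<bar> + \<bar>y\<bar> \<le> r ^ m * (Sinf + 1)" using y by (simp add: algebra_simps)
    moreover have "lpt m 0 a - pt Sinf 0 = pt (S m + a - Sinf) y" unfolding P by (simp add: vec_eq_iff forall_2)
    ultimately have "dist (lpt m 0 a) (pt Sinf 0) < \<epsilon>" using norm_pt_le[of "S m + a - Sinf" y] rm by (simp add: dist_norm)
    then have "lpt m 0 a \<in> \<Union>U" using \<epsilon>(2) lpt_in_Pbar[OF v a] by blast
    then show ?thesis using Union_mem[OF U(1)] sx unfolding x_def by simp
  qed
  then show ?thesis using S_less_Sinf[of n] by (intro exI[of _ "Sinf - S n"]) simp
qed

lemma spine_near_start:
  assumes "surf_open r U" "arm_sing r \<in> U"
  shows "\<exists>e>0. \<forall>t. 0 < t \<and> t < e \<longrightarrow> spine t \<in> U"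
proof -
  let ?U = "{z. lab z = 0 \<and> 0 \<le> z $ 1 \<and> z $ 1 \<le> 1}"
  have p1: "pos spine_ix (Suc 0) = 1" by (simp add: pos_spine)
  have z: "fline 0 0 \<in> ?U" by simp
  have z': "lab (fline 0 0) \<in> {0}" "pos spine_ix 0 \<le> fline 0 0 $ 1" "fline 0 0 $ 1 \<le> pos spine_ix (Suc 0)" using p1 by auto
  from tower_map_slab_nhd[OF tower_spine z'] obtain F \<epsilon>' where F: "finite F" "0 < \<epsilon>'"
    "\<And>v. norm v < \<epsilon>' \<Longrightarrow> lab (fline 0 0 + v) \<in> {0} \<Longrightarrow> pos spine_ix 0 \<le> fline 0 0 $ 1 + v $ 1 \<Longrightarrow>
       fline 0 0 $ 1 + v $ 1 \<le> pos spine_ix (Suc 0) \<Longrightarrow>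
      \<exists>x\<in>F. tower_map spine_ix spine_off (fline 0 0) = cls x \<and> tower_map spine_ix spine_off (fline 0 0 + v) = cls (x + v) \<and> x + v \<in> Pbar"
    by blast
  have "nhd (tower_map spine_ix spine_off) ?U (fline 0 0)"
    unfolding nhd_def using F p1 by (intro exI[of _ F] exI[of _ \<epsilon>']) simp
  moreover have "tower_map spine_ix spine_off (fline 0 0) \<in> U" using spine_ends(1) assms(2) Sinf_pos unfolding spine_def by simp
  ultimately obtain \<epsilon> where \<epsilon>: "0 < \<epsilon>" "\<And>v. norm v < \<epsilon> \<Longrightarrow> fline 0 0 + v \<in> ?U \<Longrightarrow> tower_map spine_ix spine_off (fline 0 0 + v) \<in> U"
    using nhd_continuous[OF _ z assms(1)] by blast
  obtain \<delta> where \<delta>: "0 < \<delta>" "\<And>s. \<bar>s\<bar> < \<delta> \<Longrightarrow> norm (s *\<^sub>R fvec 1) < \<epsilon>" using small_scale[OF \<epsilon>(1), of "fvec 1"] by blast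
  have "spine t \<in> U" if "0 < t" "t < min \<delta> 1" for t
    using \<epsilon>(2)[OF \<delta>(2), of t] that Sinf_pos unfolding spine_def fline_scale by simp
  then show ?thesis using \<delta>(1) by (intro exI[of _ "min \<delta> 1"]) simp
qed

text \<open>Membership would make an offset, or an offset plus \<open>q\<close>, equal to a defect,
  which is at most \<open>r ^ k\<close>; grid points for \<open>k\<close> are larger than
  \<open>r ^ k\<close>.\<close>

lemma spine_not_in_cyl:
  assumes "0 < x" "x < 1 + Sinf"
  shows "spine x \<notin> cyl k"
proof
  assume c: "spine x \<in> cyl k"
  obtain T where T: "x < pos spine_ix T" using spine_pos assms by blast
  obtain t where t: "pos spine_ix t \<le> x" "x < pos spine_ix (Suc t)" using pos_exists[of x spine_ix T] T assms(1) by auto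
  have s: "spine x = cls (lpt (spine_ix t) (spine_off t) (x - pos spine_ix t))" using spine_slab t by simp
  have "valid (spine_ix t) (spine_off t)" using tower_spine unfolding tower_def by simp
  then obtain c' where c': "state k (spine_ix t) c'" "c' - spine_off t \<in> band k"
    using cyl_label[of "spine_ix t" "spine_off t" "x - pos spine_ix t" k] c t pos_Suc[of spine_ix t] spine_nonsing[OF assms] unfolding s by auto
  have j: "0 < c' - spine_off t" "c' - spine_off t \<le> r ^ k" using band_pos[OF c'(2)] c'(2)[unfolded band_iff] by blast+
  show False
  proof (cases "t = 0")
    case False
    then have "0 < c'" "c' \<le> r ^ k" using j unfolding spine_off_def by auto
    then show False using c'(1) state_pos grid_bounds(1) by fastforce
  next
    case True
    then have "c' + real q \<le> r ^ k" using j unfolding spine_off_def by simp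
    moreover have "c' < 0" using calculation rpow_le_1[of k] Q_ge_2 by linarith
    then have "grid k (c' + real q)" using c'(1) unfolding state_def by simp
    ultimately show False using grid_bounds(1) by fastforce
  qed
qed

lemma cyl_rigid_spine: "has_rigid_spine r (range cyl)"
  unfolding has_rigid_spine_def closure_Union_cyl
proof (intro exI conjI)
  have L: "0 < 1 + Sinf" using Sinf_pos by simp
  show "saddle_conn r (spine ` {0..1 + Sinf})"
  proof (rule saddle_connI[OF L fvec_nonzero[of 1] spine_cpath spine_ends])
    fix U assume U: "surf_open r U" "arm_sing r \<in> U"
    obtain e1 e2 where "e1 > 0" "\<forall>t. 0 < t \<and> t < e1 \<longrightarrow> spine t \<in> U" "e2 > 0" "\<forall>t. 0 < t \<and> t < e2 \<longrightarrow> spine (1 + Sinf - t) \<in> U"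
      using spine_near_start[OF U] spine_near_end[OF U] by blast
    then show "\<exists>e>0. \<forall>t. 0 < t \<and> t < e \<longrightarrow> spine (0 + t) \<in> U \<and> spine (1 + Sinf - t) \<in> U"
      by (intro exI[of _ "min e1 e2"]) simp
  qed simp
  show "spine ` {0..1 + Sinf} \<subseteq> arm_X r"
  proof
    fix p assume "p \<in> spine ` {0..1 + Sinf}"
    then obtain x where x: "0 \<le> x" "x \<le> 1 + Sinf" "p = spine x" by auto
    show "p \<in> arm_X r"
    proof (cases "0 < x \<and> x < 1 + Sinf")
      case True
      then show ?thesis using cpath_in_Xo[OF spine_cpath, of x] x(3) unfolding arm_Xo_def by simp
    next
      case False
      then have "x = 0 \<or> x = 1 + Sinf" using x by linarith
      then show ?thesis using x(3) spine_ends sing_in_X by auto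
    qed
  qed
  show "(spine ` {0..1 + Sinf} - {arm_sing r}) \<inter> \<Union>(range cyl) = {}"
  proof -
    have "spine x \<notin> cyl k" if "0 \<le> x" "x \<le> 1 + Sinf" "spine x \<noteq> arm_sing r" for x k
      using that spine_ends spine_not_in_cyl[of x k] by (cases "x = 0"; cases "x = 1 + Sinf") auto
    then show ?thesis by (intro equals0I) (elim IntE DiffE imageE UnionE rangeE, force)
  qed
qed

subsection \<open>No parabolic affine diffeomorphism\<close>


definition open_square :: "(real^2) set" where
  "open_square = {p. 0 < p $ 1 \<and> p $ 1 < 1 \<and> 0 < p $ 2 \<and> p $ 2 < 1}"

text \<open>Classes in the open first square have one representative, so planar coordinates can be
  read off there without ambiguity.\<close>

lemma open_square_facts:
  assumes "p \<in> open_square"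
  shows "p \<in> Pbar - sing" "cls x = cls p \<Longrightarrow> x = p"
proof -
  obtain a b where p: "p = pt a b" by (rule pt_cases)
  have ab: "0 < a" "a < 1" "0 < b" "b < 1" using assms unfolding open_square_def p by auto
  have S1: "S (Suc 0) = 1" by (simp add: S_Suc)
  show "p \<in> Pbar - sing" unfolding p using Pbar_between[of 0 a b] sing_between[of 0 a b] ab S1 by simp
  have "key p = p" unfolding p using key_between[of 0 a b] ab S1 by simp
  then show "cls x = cls p \<Longrightarrow> x = p" unfolding cls_eq_iff using key_preimage_pos[of x a b] ab p by simp
qed

lemma convex_open_square: "convex open_square"
proof -
  have eq: "open_square = {p. 0 < p $ 1} \<inter> {p. p $ 1 < 1} \<inter> {p. 0 < p $ 2} \<inter> {p. p $ 2 < 1}"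
    unfolding open_square_def by auto
  have "convex {p::real^2. 0 < p $ i}" "convex {p::real^2. p $ i < 1}" for i
    by (auto simp: convex_def intro: convex_bound_lt add_pos_nonneg add_nonneg_pos)
      (smt (verit) mult_nonneg_nonneg mult_pos_pos)+
  then show ?thesis unfolding eq by (intro convex_Int)
qed

lemma open_square_cpath:
  assumes "\<And>s. s \<in> I \<Longrightarrow> p + s *\<^sub>R w \<in> open_square"
  shows "cpath (\<lambda>s. cls (p + s *\<^sub>R w)) w I"
  unfolding cpath_def
proof
  fix t assume t: "t \<in> I"
  have "hop (cls (p + t *\<^sub>R w)) (\<sigma> *\<^sub>R w) (cls (p + (t + \<sigma>) *\<^sub>R w))" if "t + \<sigma> \<in> I" for \<sigma>
  proof -
    have e: "p + (t + \<sigma>) *\<^sub>R w = p + t *\<^sub>R w + \<sigma> *\<^sub>R w" by (simp add: algebra_simps)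
    show ?thesis unfolding e
    proof (rule hopI)
      fix s :: real assume s: "0 \<le> s" "s \<le> 1"
      have "p + t *\<^sub>R w + s *\<^sub>R \<sigma> *\<^sub>R w = (1 - s) *\<^sub>R (p + t *\<^sub>R w) + s *\<^sub>R (p + (t + \<sigma>) *\<^sub>R w)"
        by (simp add: algebra_simps)
      also have "\<dots> \<in> open_square"
        using convex_open_square assms[OF t] assms[OF that] s by (intro convexD) auto
      finally show "p + t *\<^sub>R w + s *\<^sub>R \<sigma> *\<^sub>R w \<in> Pbar - sing" by (rule open_square_facts(1))
    qed
  qed
  then show "\<exists>\<epsilon>>0. \<forall>\<sigma>. \<bar>\<sigma>\<bar> < \<epsilon> \<and> t + \<sigma> \<in> I \<longrightarrow> hop (cls (p + t *\<^sub>R w)) (\<sigma> *\<^sub>R w) (cls (p + (t + \<sigma>) *\<^sub>R w))"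
    by (intro exI[of _ 1]) simp
qed

section \<open>The common edges of consecutive cylinders\<close>

text \<open>The upper boundary of cylinder \<open>k\<close> without the singularity. As an
  intersection it is transported by every injective map that permutes the punctured
  cylinders.\<close>

definition edge :: "nat \<Rightarrow> (real^2) set set" where "edge k = (cyl k - {arm_sing r}) \<inter> (cyl (Suc k) - {arm_sing r})"

lemma edge_iff: "p \<in> edge k \<longleftrightarrow> p \<noteq> arm_sing r \<and> (\<exists>x. p = cyl_map k (fline (- (r ^ Suc k)) x))"
proof
  assume "p \<in> edge k"
  then show "p \<noteq> arm_sing r \<and> (\<exists>x. p = cyl_map k (fline (- (r ^ Suc k)) x))"
    unfolding edge_def using cyl_meet_adjacent[of k "Suc k" p] by auto
next
  assume "p \<noteq> arm_sing r \<and> (\<exists>x. p = cyl_map k (fline (- (r ^ Suc k)) x))"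
  then show "p \<in> edge k" unfolding edge_def using boundary_fline(3)[of "- (r ^ Suc k)" k] top_in_next[of _ k] by auto
qed

text \<open>Offsets of states are multiples of \<open>r ^ k\<close> and the defect is fixed on the
  edge, so labels on it are separated by at least \<open>r ^ k\<close>.\<close>

lemma edge_label:
  assumes "cls (lpt e l a) \<in> edge k" "valid e l" "0 \<le> a" "a < r ^ e"
  shows "\<exists>m::int. l = of_int m * r ^ k - r ^ Suc k"
proof -
  obtain x where x: "cls (lpt e l a) \<noteq> arm_sing r" "cls (lpt e l a) = cyl_map k (fline (- (r ^ Suc k)) x)"
    using assms(1) unfolding edge_iff by blast
  have "fline (- (r ^ Suc k)) x \<in> strip k" using rpow_Suc_less[of k] unfolding strip_bounds by simp
  from cyl_map_label[OF this] obtain e' c a' where *: "state k e' c" "0 \<le> a'" "a' < r ^ e'" "valid e' (c + - (r ^ Suc k))"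
    "cyl_map k (fline (- (r ^ Suc k)) x) = cls (lpt e' (c + - (r ^ Suc k)) a')" by auto
  then have "l = c - r ^ Suc k" using label_unique[OF assms(2-4) *(4,2,3)] x by simp
  then show ?thesis using state_multiple[OF *(1)] by auto
qed

text \<open>A point on the flow line of label \<open>- (r ^ Suc k)\<close> in the first square. At
  abscissa \<open>1/4\<close> the height lies between \<open>1/2\<close> and \<open>5/6\<close>,
  which leaves a margin of \<open>1/6\<close> in the open square; the common abscissa makes
  consecutive points vertical neighbours.\<close>

definition edge_pt :: "nat \<Rightarrow> real^2" where "edge_pt k = pt (1/4) ((real q + real q / 4 - r ^ Suc k) / N)"

lemma edge_pt_facts:
  shows "1 / 2 < edge_pt k $ 2" "edge_pt k $ 2 < 5 / 6" "lab (edge_pt k) = real q - r ^ Suc k"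
    "cls (edge_pt k) = cls (lpt 0 (- (r ^ Suc k)) (1/4))"
proof -
  have r1: "r ^ Suc k \<le> r ^ 1" using rpow_le_iff[of "Suc k" 1] by simp
  have r2: "r ^ Suc k \<le> 1 / 2" using r1 r_le_half by simp
  have 1: "1 / 2 * N < real q + real q / 4 - r ^ Suc k" unfolding N_def using r2 Q_ge_2 by (simp add: algebra_simps)
  then show "1 / 2 < edge_pt k $ 2" unfolding edge_pt_def using N_pos by (simp add: pos_less_divide_eq)
  have "5 / 6 * N = 5 / 3 * real q - 5 / 6" unfolding N_def by simp
  then have 2: "real q + real q / 4 - r ^ Suc k < 5 / 6 * N" using rpow_pos[of "Suc k"] Q_ge_2 by linarith
  then show q56: "edge_pt k $ 2 < 5 / 6" unfolding edge_pt_def using N_pos by (simp add: pos_divide_less_eq)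
  show "lab (edge_pt k) = real q - r ^ Suc k" unfolding lab_def edge_pt_def using N_pos by simp
  have h: "hgt 0 (- (r ^ Suc k)) (1/4) = edge_pt k $ 2" unfolding hgt_def edge_pt_def by (simp add: algebra_simps)
  have "edge_pt k = pt (S 0 + 1/4) (edge_pt k $ 2)" unfolding edge_pt_def by simp
  then show "cls (edge_pt k) = cls (lpt 0 (- (r ^ Suc k)) (1/4))" using lpt_low[of 0 "- (r ^ Suc k)" "1/4"] h q56 by simp
qed

lemma edge_pt_open_square: "edge_pt k \<in> open_square"
proof -
  have "edge_pt k $ 1 = 1 / 4" by (simp add: edge_pt_def)
  then show ?thesis unfolding open_square_def using edge_pt_facts(1,2)[of k] by simp
qed

lemma edge_pt_edge: "cls (edge_pt k) \<in> edge k"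
proof -
  have "state k 0 0" by (simp add: state_0)
  moreover have "r ^ Suc k \<in> band k" unfolding band_iff using rpow_Suc_less[of k] by simp
  ultimately obtain x where "cyl_map k (fline (- (r ^ Suc k)) x) = cls (lpt 0 (0 - r ^ Suc k) (1/4))"
    using state_in_image[of k 0 0 "r ^ Suc k" "1/4"] by auto
  moreover have "cls (edge_pt k) \<noteq> arm_sing r" using open_square_facts(1)[OF edge_pt_open_square] cls_sing_iff by simp
  ultimately show ?thesis unfolding edge_iff using edge_pt_facts(4)[of k] by auto
qed

text \<open>Singular parameters on the upper boundary line are whole periods apart, so the edge is
  parametrised injectively by an open interval of length \<open>width k\<close>.\<close>

lemma edge_param:
  obtains x0 where "edge k = (\<lambda>x. cyl_map k (fline (- (r ^ Suc k)) x)) ` {x0<..<x0 + width k}"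
    "inj_on (\<lambda>x. cyl_map k (fline (- (r ^ Suc k)) x)) {x0<..<x0 + width k}"
    "cpath (\<lambda>x. cyl_map k (fline (- (r ^ Suc k)) x)) (fvec 1) {x0<..<x0 + width k}"
proof -
  let ?u = "- (r ^ Suc k)"
  have u: "?u \<in> labels k" using boundary_fline(1) by blast
  obtain x0 where x0: "cyl_map k (fline ?u x0) = arm_sing r" using cyl_map_sing_exists(2) by blast
  have ns: "cyl_map k (fline ?u x) \<noteq> arm_sing r" if "x0 < x" "x < x0 + width k" for x
  proof
    assume "cyl_map k (fline ?u x) = arm_sing r"
    then obtain j :: int where j: "x = x0 + of_int j * width k"
      using cyl_map_top_sing_unique[of "fline ?u x0" k "fline ?u x"] x0 by auto
    then have "j = 0" using that width_pos[of k] by (intro int_multiple_zero[OF width_pos[of k]]) linarith+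
    then show False using j that by simp
  qed
  have "edge k = (\<lambda>x. cyl_map k (fline ?u x)) ` {x0<..<x0 + width k}"
  proof
    show "(\<lambda>x. cyl_map k (fline ?u x)) ` {x0<..<x0 + width k} \<subseteq> edge k" using ns unfolding edge_iff[abs_def] subset_iff edge_iff by auto
    show "edge k \<subseteq> (\<lambda>x. cyl_map k (fline ?u x)) ` {x0<..<x0 + width k}"
    proof
      fix p assume "p \<in> edge k"
      then obtain x where x: "p \<noteq> arm_sing r" "p = cyl_map k (fline ?u x)" unfolding edge_iff by blast
      define y where "y = x + of_int (- \<lfloor>(x - x0) / width k\<rfloor>) * width k"
      have y: "cyl_map k (fline ?u y) = p" unfolding y_def fline_period x(2) ..
      have "x0 \<le> y" "y < x0 + width k" using floor_width[where x = "x - x0" and k = k] unfolding y_def by simp_all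
      moreover have "y \<noteq> x0" using y x(1) x0 by auto
      ultimately show "p \<in> (\<lambda>x. cyl_map k (fline ?u x)) ` {x0<..<x0 + width k}" using y by (intro image_eqI[of _ _ y]) auto
    qed
  qed
  moreover have "inj_on (\<lambda>x. cyl_map k (fline ?u x)) {x0<..<x0 + width k}"
  proof (rule inj_onI)
    fix x y assume xy: "x \<in> {x0<..<x0 + width k}" "y \<in> {x0<..<x0 + width k}" "cyl_map k (fline ?u x) = cyl_map k (fline ?u y)"
    have "fline ?u x \<in> strip k" "fline ?u y \<in> strip k" using u unfolding strip_def by simp_all
    then obtain j :: int where j: "y = x + of_int j * width k" using cyl_map_inj[OF _ _ xy(3)] ns xy(1) by auto
    moreover have "x0 < x" "x < x0 + width k" "x0 < y" "y < x0 + width k" using xy(1,2) by auto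
    ultimately have "- width k < of_int j * width k" "of_int j * width k < width k" by linarith+
    then have "j = 0" by (rule int_multiple_zero[OF width_pos[of k]])
    then show "x = y" using j by simp
  qed
  moreover have "cpath (\<lambda>x. cyl_map k (fline ?u x)) (fvec 1) {x0<..<x0 + width k}"
    by (rule fline_cpath[OF u]) (use ns in auto)
  ultimately show ?thesis by (rule that)
qed

lemma lab_zero_fvec: "lab v = 0 \<Longrightarrow> v = v $ 1 *\<^sub>R fvec 1"
  using fline_lab[of v] fline_scale[of 0 0 "v $ 1"] by (simp add: fline_def pt_zero)

text \<open>The labels of the common edge that occur near a point form a discrete set, so the image direction is again
  the flow direction; then the map acts on the open edge as a locally constant shift, which must be zero because the
  edge has finite length.\<close>

lemma translation_edge:
  assumes aff: "affine_diffeo r \<psi> B" and B: "det B = 1" "trace B = 2" and im: "\<psi> ` edge k = edge k"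
  shows "B *v fvec 1 = fvec 1 \<and> (\<forall>p\<in>edge k. \<psi> p = p)"
proof -
  obtain x0 where par: "edge k = (\<lambda>x. cyl_map k (fline (- (r ^ Suc k)) x)) ` {x0<..<x0 + width k}"
    "inj_on (\<lambda>x. cyl_map k (fline (- (r ^ Suc k)) x)) {x0<..<x0 + width k}"
    "cpath (\<lambda>x. cyl_map k (fline (- (r ^ Suc k)) x)) (fvec 1) {x0<..<x0 + width k}"
    by (rule edge_param)
  define g where "g x = cyl_map k (fline (- (r ^ Suc k)) x)" for x
  define I where "I = {x0<..<x0 + width k}"
  have g: "edge k = g ` I" "inj_on g I" "cpath g (fvec 1) I" using par unfolding g_def I_def by auto
  have pg: "cpath (\<lambda>t. \<psi> (g t)) (B *v fvec 1) I" using affine_cpath[OF aff g(3)] .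
  define w where "w = B *v fvec 1"
  have "cls (edge_pt k) \<in> \<psi> ` (g ` I)" using edge_pt_edge[of k] im unfolding g(1) by simp
  then obtain t where t: "t \<in> I" "\<psi> (g t) = cls (edge_pt k)" by auto
  have "lab w = 0"
  proof (rule ccontr)
    assume lw: "lab w \<noteq> 0"
    obtain \<epsilon> where \<epsilon>: "0 < \<epsilon>" "\<And>\<sigma>. \<bar>\<sigma>\<bar> < \<epsilon> \<Longrightarrow> t + \<sigma> \<in> I \<Longrightarrow> hop (\<psi> (g t)) (\<sigma> *\<^sub>R w) (\<psi> (g (t + \<sigma>)))"
      using pg t(1) unfolding cpath_def w_def by blast
    obtain \<delta> where \<delta>: "0 < \<delta>" "\<And>s. \<bar>s\<bar> < \<delta> \<Longrightarrow> norm (s *\<^sub>R w) < 1 / 6" using small_scale[of "1/6" w] by auto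
    \<comment> \<open>The four bounds keep the hop valid, keep its end in the open square, keep the
      parameter in \<open>I\<close>, and change the label by at most half of
      \<open>r ^ Suc k\<close>, which is less than the spacing \<open>r ^ k\<close>.\<close>
    define \<sigma> where "\<sigma> = Min {\<epsilon> / 2, \<delta> / 2, (x0 + width k - t) / 2, r ^ Suc k / (2 * \<bar>lab w\<bar>)}"
    have pos: "0 < \<epsilon> / 2" "0 < \<delta> / 2" "0 < (x0 + width k - t) / 2" "0 < r ^ Suc k / (2 * \<bar>lab w\<bar>)"
      using \<epsilon> \<delta> t(1) lw unfolding I_def by simp_all
    have s0: "0 < \<sigma>" unfolding \<sigma>_def using pos by simp
    have "\<sigma> \<le> \<epsilon> / 2" "\<sigma> \<le> \<delta> / 2" "\<sigma> \<le> (x0 + width k - t) / 2" "\<sigma> \<le> r ^ Suc k / (2 * \<bar>lab w\<bar>)" 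
      unfolding \<sigma>_def by (rule Min_le, simp, simp)+
    then have s: "\<bar>\<sigma>\<bar> < \<epsilon>" "\<bar>\<sigma>\<bar> < \<delta>" "t + \<sigma> \<in> I" "\<sigma> * \<bar>lab w\<bar> \<le> r ^ Suc k / 2"
      using s0 pos t(1) lw unfolding I_def by (auto simp: field_simps)
    obtain x where x: "cls (edge_pt k) = cls x" "\<psi> (g (t + \<sigma>)) = cls (x + \<sigma> *\<^sub>R w)"
      using \<epsilon>(2)[OF s(1,3)] unfolding t(2) hop_def by blast
    have xq: "x = edge_pt k" using open_square_facts(2)[OF edge_pt_open_square, of x] x(1) by simp
    define p where "p = edge_pt k + \<sigma> *\<^sub>R w"
    have "\<psi> (g (t + \<sigma>)) \<in> \<psi> ` (g ` I)" using s(3) by blast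
    then have "\<psi> (g (t + \<sigma>)) \<in> edge k" using im g(1) by simp
    then have pd: "cls p \<in> edge k" using x(2) unfolding xq p_def by simp
    have comp: "\<bar>(\<sigma> *\<^sub>R w) $ 1\<bar> < 1 / 6" "\<bar>(\<sigma> *\<^sub>R w) $ 2\<bar> < 1 / 6" using comp_less[OF \<delta>(2)[OF s(2)]] by auto
    have q1: "edge_pt k $ 1 = 1 / 4" unfolding edge_pt_def by simp
    have p12: "p $ 1 = 1 / 4 + (\<sigma> *\<^sub>R w) $ 1" "p $ 2 = edge_pt k $ 2 + (\<sigma> *\<^sub>R w) $ 2" unfolding p_def q1[symmetric] by simp_all
    have pb: "0 < p $ 1" "p $ 1 < 1" "0 < p $ 2" "p $ 2 < 1"
      using comp edge_pt_facts(1,2)[of k] unfolding p12 by linarith+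
    have lp: "lab p = real q - r ^ Suc k + \<sigma> * lab w" unfolding p_def lab_add lab_scale edge_pt_facts(3) ..
    have "\<bar>\<sigma> * lab w\<bar> \<le> r ^ Suc k / 2" using s(4) s0 by (simp add: abs_mult)
    then have sl: "- (r ^ Suc k / 2) \<le> \<sigma> * lab w" "\<sigma> * lab w \<le> r ^ Suc k / 2" by linarith+
    have h: "hgt 0 (lab p - real q) (p $ 1) = p $ 2" unfolding hgt_def lab_def using N_pos by simp
    have "p = pt (S 0 + p $ 1) (p $ 2)" using pt_eta[of p] by simp
    then have "lpt 0 (lab p - real q) (p $ 1) = p" unfolding lpt_def h using pb by simp
    moreover have "valid 0 (lab p - real q)"
      unfolding valid_def lp using sl rpow_pos[of "Suc k"] rpow_le_1[of "Suc k"] Q_ge_2 by simp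
    ultimately obtain m :: int where m: "lab p - real q = of_int m * r ^ k - r ^ Suc k"
      using edge_label[of 0 "lab p - real q" "p $ 1" k] pd pb by auto
    then have "\<sigma> * lab w = of_int m * r ^ k" unfolding lp by simp
    then have "m = 0" using sl rpow_Suc_less[of k] rpow_pos[of "Suc k"]
      by (intro int_multiple_zero[OF rpow_pos[of k]]) linarith+
    then show False using \<open>\<sigma> * lab w = of_int m * r ^ k\<close> s0 lw by simp
  qed
  then obtain l where l: "w = l *\<^sub>R fvec 1" using lab_zero_fvec by blast
  have wB: "w $ 1 = B$1$1 + B$1$2 * (real q / N)" "w $ 2 = B$2$1 + B$2$2 * (real q / N)"
    unfolding w_def matrix_vector_mult_def by (simp_all add: sum_2 fvec_def)
  have wl: "w $ 1 = l" "w $ 2 = l * (real q / N)" unfolding l by (simp_all add: fvec_def)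
  define mm where "mm = real q / N"
  have m1: "B$1$2 * mm = l - B$1$1" and m2: "B$2$1 = (l - B$2$2) * mm"
    using wB wl unfolding mm_def by (simp_all add: algebra_simps)
  \<comment> \<open>The eigenvalue \<open>l\<close> satisfies the characteristic equation, which for
    determinant 1 and trace 2 is \<open>(l - 1) * (l - 1) = 0\<close>.\<close>
  have "B$1$2 * B$2$1 = (B$1$2 * mm) * (l - B$2$2)" unfolding m2 by (simp only: mult.assoc mult.commute mult.left_commute)
  then have "B$1$2 * B$2$1 = (l - B$1$1) * (l - B$2$2)" unfolding m1 .
  moreover have "B$1$1 * B$2$2 - B$1$2 * B$2$1 = 1" "B$1$1 + B$2$2 = 2"
    using B by (simp_all add: det_2 trace_2)
  moreover have "(l - B$1$1) * (l - B$2$2) = l * l - l * (B$1$1 + B$2$2) + B$1$1 * B$2$2" by (simp add: algebra_simps)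
  ultimately have "(l - 1) * (l - 1) = 0" by (simp add: algebra_simps)
  then have "w = fvec 1" using l by simp
  then have Bd: "B *v fvec 1 = fvec 1" unfolding w_def .
  have pg1: "cpath (\<lambda>t. \<psi> (g t)) (fvec 1) I" using pg unfolding Bd .
  have "\<forall>t\<in>I. \<exists>s\<in>I. \<psi> (g t) = g s"
  proof
    fix t assume "t \<in> I"
    then have "\<psi> (g t) \<in> \<psi> ` edge k" unfolding g(1) by blast
    then have "\<psi> (g t) \<in> g ` I" unfolding im unfolding g(1) .
    then show "\<exists>s\<in>I. \<psi> (g t) = g s" by blast
  qed
  then obtain \<tau> where \<tau>: "\<And>t. t \<in> I \<Longrightarrow> \<tau> t \<in> I" "\<And>t. t \<in> I \<Longrightarrow> \<psi> (g t) = g (\<tau> t)" by metis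
  \<comment> \<open>The image path and the edge itself, started at \<open>\<tau> t\<close>, are
    straight with the same velocity and agree at 0, so they agree as long as both parameters stay in
    \<open>I\<close>.\<close>
  have loc: "\<tau> t' - t' = \<tau> t - t" if t: "t \<in> I" "t' \<in> I" "\<tau> t + (t' - t) \<in> I" for t t'
  proof -
    let ?K = "{s. t + s \<in> I} \<inter> {s. \<tau> t + s \<in> I}"
    have K: "?K = {max (x0 - t) (x0 - \<tau> t)<..<min (x0 + width k - t) (x0 + width k - \<tau> t)}"
      unfolding I_def by auto
    have "connected ?K" unfolding K by simp
    moreover have "cpath (\<lambda>s. \<psi> (g (t + s))) (fvec 1) ?K"
      using cpath_subset[OF cpath_rescale[OF pg1, of t 1]] by simp
    moreover have "cpath (\<lambda>s. g (\<tau> t + s)) (fvec 1) ?K"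
      using cpath_subset[OF cpath_rescale[OF g(3), of "\<tau> t" 1]] by simp
    ultimately have "\<psi> (g (t + (t' - t))) = g (\<tau> t + (t' - t))"
      using cpath_unique[of "\<lambda>s. \<psi> (g (t + s))" "fvec 1" ?K "\<lambda>s. g (\<tau> t + s)" 0 "t' - t"] t \<tau>[OF t(1)] by simp
    then have "g (\<tau> t') = g (\<tau> t + (t' - t))" using \<tau>(2)[OF t(2)] by simp
    then have "\<tau> t' = \<tau> t + (t' - t)" using g(2) \<tau>(1)[OF t(2)] t(3) by (meson inj_onD)
    then show ?thesis by simp
  qed
  have "\<forall>a\<in>I. eventually (\<lambda>b. \<tau> a - a = \<tau> b - b) (at a within I)"
  proof
    fix a assume a: "a \<in> I"
    have ta: "x0 < \<tau> a" "\<tau> a < x0 + width k" using \<tau>(1)[OF a] unfolding I_def by auto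
    show "eventually (\<lambda>b. \<tau> a - a = \<tau> b - b) (at a within I)"
      unfolding eventually_at
    proof (intro exI[of _ "min (\<tau> a - x0) (x0 + width k - \<tau> a)"] conjI ballI impI)
      fix b assume b: "b \<in> I" "b \<noteq> a \<and> dist b a < min (\<tau> a - x0) (x0 + width k - \<tau> a)"
      then have "\<tau> a + (b - a) \<in> I" unfolding I_def dist_real_def by auto
      then show "\<tau> a - a = \<tau> b - b" using loc[OF a b(1)] by simp
    qed (use ta in simp)
  qed
  then have const: "\<tau> a - a = \<tau> b - b" if "a \<in> I" "b \<in> I" for a b
    using connected_local_const[of I a b "\<lambda>t. \<tau> t - t"] that unfolding I_def by simp
  define D where "D = \<tau> t - t"
  have D: "\<tau> s = s + D" if "s \<in> I" for s using const[OF that t(1)] unfolding D_def by simp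
  have sur: "\<exists>s\<in>I. y = s + D" if "y \<in> I" for y
  proof -
    have "g y \<in> \<psi> ` (g ` I)" using that im unfolding g(1) by simp
    then obtain s where s: "s \<in> I" "g y = \<psi> (g s)" by blast
    have "y = \<tau> s" by (rule inj_onD[OF g(2) _ that \<tau>(1)[OF s(1)]]) (simp add: s \<tau>(2)[OF s(1)])
    then show ?thesis using D s(1) by auto
  qed
  have "D = 0"
  proof (rule ccontr)
    assume "D \<noteq> 0"
    \<comment> \<open>A nonzero shift would leave out the points of \<open>I\<close> closer than its
      size to one end, contrary to surjectivity.\<close>
    define e where "e = min \<bar>D\<bar> (width k) / 2"
    have e: "0 < e" "e < \<bar>D\<bar>" "e < width k" using \<open>D \<noteq> 0\<close> width_pos[of k] unfolding e_def by auto
    show False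
    proof (cases "0 < D")
      case True
      have "x0 + e \<in> I" using e unfolding I_def by simp
      then show False using sur[of "x0 + e"] True e unfolding I_def by auto
    next
      case False
      have "x0 + width k - e \<in> I" using e unfolding I_def by simp
      then show False using sur[of "x0 + width k - e"] False e unfolding I_def by auto
    qed
  qed
  then have "\<psi> (g s) = g s" if "s \<in> I" for s using \<tau>(2)[OF that] D[OF that] by simp
  then show ?thesis using Bd g(1) by auto
qed

lemma no_parabolic:
  assumes aff: "affine_diffeo r \<phi> A" and par: "parabolic A" and fix_d: "fixes_decomp r \<phi> (range cyl)"
  shows False
proof -
  define \<psi> where "\<psi> = \<phi> \<circ> \<phi>"
  define B where "B = A ** A"
  have affB: "affine_diffeo r \<psi> B" unfolding \<psi>_def B_def using affine_diffeo_compose[OF aff aff] .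
  have B: "det B = 1" "trace B = 2" "B \<noteq> mat 1" using parabolic_square[OF par] unfolding B_def by auto
  define C' where "C' k = cyl k - {arm_sing r}" for k
  have im1: "(\<lambda>X. \<phi> ` X) ` range C' = range C'"
    using fix_d unfolding fixes_decomp_def C'_def image_image .
  have "(\<lambda>X. \<psi> ` X) ` range C' = (\<lambda>X. \<phi> ` X) ` ((\<lambda>X. \<phi> ` X) ` range C')"
    unfolding \<psi>_def image_image by (simp add: image_comp)
  then have im: "(\<lambda>X. \<psi> ` X) ` range C' = range C'" unfolding im1 .
  have inj: "inj_on \<psi> (arm_Xo r)" using affB unfolding affine_diffeo_def bij_betw_def by blast
  have C'X: "C' k \<subseteq> arm_Xo r" for k unfolding C'_def arm_Xo_def using cyl_sub_X by blast
  have C'inj: "C' k = C' j \<Longrightarrow> k = j" for k j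
    unfolding C'_def using cyl_inj[of k j] sing_in_cyl[of k] sing_in_cyl[of j] by (metis insert_Diff)
  have "\<exists>j. \<psi> ` C' k = C' j" for k
  proof -
    have "\<psi> ` C' k \<in> (\<lambda>X. \<psi> ` X) ` range C'" by blast
    then show ?thesis unfolding im by auto
  qed
  then obtain f where f: "\<And>k. \<psi> ` C' k = C' (f k)" by metis
  have "inj f"
  proof (rule injI)
    fix k j assume "f k = f j"
    then have "\<psi> ` C' k = \<psi> ` C' j" using f[of k] f[of j] by simp
    then have "C' k = C' j" using inj_on_image_eq_iff[OF inj C'X[of k] C'X[of j]] by simp
    then show "k = j" by (rule C'inj)
  qed
  moreover have "surj f"
  proof -
    have "\<exists>k. j = f k" for j
    proof -
      have "C' j \<in> (\<lambda>X. \<psi> ` X) ` range C'" unfolding im by blast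
      then obtain k where "C' j = \<psi> ` C' k" by auto
      then have "C' j = C' (f k)" using f[of k] by simp
      then show ?thesis using C'inj by blast
    qed
    then show ?thesis by (auto simp: surj_def)
  qed
  \<comment> \<open>Adjacency in the path is expressed by intersections of punctured cylinders,
    which an injective map respects.\<close>
  moreover have adj: "(k = Suc j \<or> j = Suc k) \<longleftrightarrow> k \<noteq> j \<and> C' k \<inter> C' j \<noteq> {}" for k j
  proof -
    have 1: "C' k \<inter> C' (Suc k) \<noteq> {}" for k using edge_pt_edge[of k] unfolding edge_def C'_def by blast
    have 2: "j = Suc k" if "k < j" "C' k \<inter> C' j \<noteq> {}" for k j
      using that cyl_meet_adjacent[of k j] unfolding C'_def by blast
    show ?thesis
    proof
      assume "k = Suc j \<or> j = Suc k"
      then show "k \<noteq> j \<and> C' k \<inter> C' j \<noteq> {}" using 1[of k] 1[of j] by (auto simp: Int_commute)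
    next
      assume a: "k \<noteq> j \<and> C' k \<inter> C' j \<noteq> {}"
      then show "k = Suc j \<or> j = Suc k" using 2[of k j] 2[of j k] by (auto simp: Int_commute nat_neq_iff)
    qed
  qed
  have fint: "\<psi> ` (C' k \<inter> C' j) = C' (f k) \<inter> C' (f j)" for k j
    using inj_on_image_Int[OF inj C'X C'X, of k j] f by simp
  have "(k = Suc j \<or> j = Suc k) \<longleftrightarrow> (f k = Suc (f j) \<or> f j = Suc (f k))" for k j
    unfolding adj using fint[of k j] inj_eq[OF \<open>inj f\<close>, of k j] by (metis image_is_empty)
  ultimately have fk: "f k = k" for k using path_graph_automorphism[of f k] by blast
  have dlk: "\<psi> ` edge k = edge k" for k
    using fint[of k "Suc k"] unfolding fk edge_def C'_def .
  note tr = translation_edge[OF affB B(1,2) dlk]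
  have fixq: "\<psi> (cls (edge_pt k)) = cls (edge_pt k)" for k using tr[of k] edge_pt_edge by blast
  \<comment> \<open>The test vector points straight down, from the point on edge
    \<open>Suc k\<close> to the one on edge \<open>k\<close>, across cylinder
    \<open>Suc k\<close>.\<close>
  define w where "w = B *v pt 0 (-1)"
  \<comment> \<open>The index is taken so large that the vertical segment of length \<open>h\<close>
    and its image with velocity \<open>w\<close> both stay within the margin
    \<open>1/6\<close>.\<close>
  have "0 < 1 / (6 * (norm w + 1))" using norm_ge_zero[of w] by (simp add: add_nonneg_pos)
  then obtain k where "r ^ k < 1 / (6 * (norm w + 1))" using real_arch_pow_inv r_less_1 by blast
  then have k: "r ^ k * (norm w + 1) < 1 / 6" using norm_ge_zero[of w] by (simp add: field_simps add_nonneg_pos)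
  define h where "h = (r ^ Suc k - r ^ Suc (Suc k)) / N"
  have N1: "1 \<le> N" using Q_ge_2 unfolding N_def by simp
  have h0: "0 < h" unfolding h_def using rpow_Suc_less[of "Suc k"] N_pos by simp
  have "h \<le> (r ^ Suc k - r ^ Suc (Suc k)) / 1" unfolding h_def using N1 rpow_Suc_less[of "Suc k"]
    by (intro divide_left_mono) auto
  then have hk: "h \<le> r ^ k" unfolding div_by_1 using rpow_Suc_less[of k] rpow_pos[of "Suc (Suc k)"] by linarith
  have hw: "h * norm w < 1 / 6" "h < 1 / 6"
  proof -
    have "h * (norm w + 1) \<le> r ^ k * (norm w + 1)" using hk by (intro mult_right_mono) auto
    then have "h * norm w + h < 1 / 6" using k by (simp add: algebra_simps)
    moreover have "0 \<le> h * norm w" using h0 by simp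
    ultimately show "h * norm w < 1 / 6" "h < 1 / 6" using h0 by linarith+
  qed
  let ?p = "edge_pt (Suc k)"
  have p1: "?p $ 1 = 1 / 4" unfolding edge_pt_def by simp
  have stay: "?p + v \<in> open_square" if "norm v < 1 / 6" for v
    using comp_less[OF that] edge_pt_facts(1,2)[of "Suc k"] p1 unfolding open_square_def by auto
  have end_q: "?p + h *\<^sub>R pt 0 (-1) = edge_pt k"
  proof -
    have "h = (real q + real q / 4 - r ^ Suc (Suc k)) / N - (real q + real q / 4 - r ^ Suc k) / N"
      unfolding h_def diff_divide_distrib[symmetric] by simp
    then show ?thesis unfolding edge_pt_def by (simp add: vec_eq_iff forall_2)
  qed
  have "cpath (\<lambda>s. cls (?p + s *\<^sub>R pt 0 (-1))) (pt 0 (-1)) {0..h}"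
  proof (rule open_square_cpath, rule stay)
    fix s assume "s \<in> {0..h}"
    then show "norm (s *\<^sub>R pt 0 (-1)) < 1 / 6" using hw norm_pt[of 0 "-1"] by simp
  qed
  from affine_cpath[OF affB this] have c1: "cpath (\<lambda>s. \<psi> (cls (?p + s *\<^sub>R pt 0 (-1)))) w {0..h}"
    unfolding w_def .
  have c2: "cpath (\<lambda>s. cls (?p + s *\<^sub>R w)) w {0..h}"
  proof (rule open_square_cpath, rule stay)
    fix s assume s: "s \<in> {0..h}"
    then have "s * norm w \<le> h * norm w" by (intro mult_right_mono) auto
    then show "norm (s *\<^sub>R w) < 1 / 6" using hw s by simp
  qed
  \<comment> \<open>The image of the vertical segment starts at the fixed point \<open>?p\<close>
    and is straight with velocity \<open>w\<close>, so it is the planar segment. Its end is the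
    other fixed point, which determines \<open>w\<close>.\<close>
  have "\<psi> (cls (?p + h *\<^sub>R pt 0 (-1))) = cls (?p + h *\<^sub>R w)"
    by (rule cpath_unique[OF c1 c2, of 0 h]) (use h0 fixq[of "Suc k"] in simp_all)
  then have "cls (?p + h *\<^sub>R w) = cls (edge_pt k)" unfolding end_q fixq ..
  then have "?p + h *\<^sub>R w = ?p + h *\<^sub>R pt 0 (-1)" unfolding end_q using open_square_facts(2)[OF edge_pt_open_square] by blast
  then have w: "w = pt 0 (-1)" using h0 by simp
  \<comment> \<open>The derivative now fixes the vertical vector and the flow vector, which together
    span the plane.\<close>
  have e2: "B$1$2 = 0" "B$2$2 = 1"
    using arg_cong[OF w, of "\<lambda>v. v $ 1"] arg_cong[OF w, of "\<lambda>v. v $ 2"]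
    unfolding w_def matrix_vector_mult_def by (simp_all add: sum_2)
  have Bd: "B *v fvec 1 = fvec 1" using tr by blast
  have "B$1$1 = 1" "B$2$1 = 0"
    using arg_cong[OF Bd, of "\<lambda>v. v $ 1"] arg_cong[OF Bd, of "\<lambda>v. v $ 2"] e2
    unfolding matrix_vector_mult_def by (simp_all add: sum_2 fvec_def)
  then have "B = mat 1" using e2 mat_nth_2 by (intro mat2_eqI) simp_all
  then show False using B(3) by simp
qed

end

theorem theorem1p1:
  fixes q :: nat
  assumes "q \<noteq> 0" and "q \<noteq> 1"
  shows "\<exists>D. cyl_decomp (1 / real q) D (vector [2 * real q - 1, real q]) \<and>
             has_rigid_spine (1 / real q) D \<and>
             \<not> (\<exists>\<phi> A. affine_diffeo (1 / real q) \<phi> A \<and> parabolic A \<and>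
                       fixes_decomp (1 / real q) \<phi> D)"
proof -
  interpret tail q "1 / real q"
    by unfold_locales (use assms in auto)
  have "cyl_decomp (1 / real q) (range cyl) (vector [2 * real q - 1, real q])"
    using cyl_cyl_decomp unfolding pt_def N_def .
  then show ?thesis using cyl_rigid_spine no_parabolic by blast
qed

end
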